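(* (Intuitionistically valid.) The set $\mathbb{R}_d$ of Dedekind reals is isomorphic to $$R_d=\{(L,U)\in\mathbb{R}_{cl}\mid\forall k\in\mathbb{N}\ \exists q\in\mathbb{Q}\ (q-2^{-k}\in L\wedge q+2^{-k}\in U)\}.$$
   Context: The statement is a theorem of intuitionistic higher-order logic. A Dedekind cut is a pair $(L,U)$ of subsets of $\mathbb{Q}$ such that: - $L$ and $U$ are inhabited; - $q\in L\Leftrightarrow\exists r(q<r\wedge r\in L)$ and $r\in U\Leftrightarrow\exists q(q\in U\wedge q<r)$; - $q\in L\wedge r\in U\Rightarrow q<r$; - $q<r\Rightarrow q\in L\vee r\in U$. $\mathbb{R}_d$ is the set of Dedekind cuts. For a set $A$, $\mathcal{P}_{\neg\neg}(A)=\{S\subseteq A\mid\forall x\in A\,(\neg\neg(x\in S)\Rightarrow x\in S)\}$. A classical Dedekind cut is a pair $(L,U)\in\mathcal{P}_{\neg\neg}(\mathbb{Q})\times\mathcal{P}_{\neg\neg}(\mathbb{Q})$ such that, for $q,r$ ranging over $\mathbb{Q}$: - $\neg\forall q\,(q\notin L)$ and $\neg\forall r\,(r\notin U)$; - $q<r\wedge r\in L\Rightarrow q\in L$, and $q\in U\wedge q<r\Rightarrow r\in U$; - $(\forall r\,(r\in L\Rightarrow r\le q))\Rightarrow q\notin L$, and $(\forall q\,(q\in U\Rightarrow r\le q))\Rightarrow r\notin U$; - $q\in L\wedge r\in U\Rightarrow q<r$; - $q\notin L\wedge r\notin U\Rightarrow r\le q$. $\mathbb{R}_{cl}$ is the set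 of classical Dedekind cuts. *)

theory Defs
  imports Main
begin

text \<open>
  Isabelle/HOL is classical, so a notion such as a double-negation-closed set is vacuous when it
  is read in the ambient logic. Intuitionistic validity is therefore rendered as derivability in
  intuitionistic higher-order logic, which is formalised here as an object logic: a simply typed
  lambda-calculus in the style of Church, with a type of truth values, function types (so that
  predicates are functions into truth values), products, and types of natural and rational
  numbers. Equality is extensional, for functions and for propositions. Neither excluded middle
  nor any choice principle is assumed.
\<close>

section \<open>Types and terms\<close>

datatype ty =
    Omega
  | NatT
  | RatT
  | ProdT ty ty  (infixr \<open>\<^bold>\<times>\<close> 65)
  | FunT ty ty  (infixr \<open>\<^bold>\<Rightarrow>\<close> 60)

abbreviation PowT :: "ty \<Rightarrow> ty"
  where "PowT T \<equiv> T \<^bold>\<Rightarrow> Omega"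

datatype const =
    BotC | AndC | OrC | ImpC
  | AllC ty | ExC ty | EqC ty
  | PairC ty ty | FstC ty ty | SndC ty ty
  | ZeroC | SucC | RecC ty
  | QZeroC | QOneC | QAddC | QNegC | QMulC | QInvC | QLessC

primrec const_ty :: "const \<Rightarrow> ty" where
  "const_ty BotC = Omega"
| "const_ty AndC = Omega \<^bold>\<Rightarrow> Omega \<^bold>\<Rightarrow> Omega"
| "const_ty OrC = Omega \<^bold>\<Rightarrow> Omega \<^bold>\<Rightarrow> Omega"
| "const_ty ImpC = Omega \<^bold>\<Rightarrow> Omega \<^bold>\<Rightarrow> Omega"
| "const_ty (AllC T) = PowT T \<^bold>\<Rightarrow> Omega"
| "const_ty (ExC T) = PowT T \<^bold>\<Rightarrow> Omega"
| "const_ty (EqC T) = T \<^bold>\<Rightarrow> T \<^bold>\<Rightarrow> Omega"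
| "const_ty (PairC S T) = S \<^bold>\<Rightarrow> T \<^bold>\<Rightarrow> S \<^bold>\<times> T"
| "const_ty (FstC S T) = S \<^bold>\<times> T \<^bold>\<Rightarrow> S"
| "const_ty (SndC S T) = S \<^bold>\<times> T \<^bold>\<Rightarrow> T"
| "const_ty ZeroC = NatT"
| "const_ty SucC = NatT \<^bold>\<Rightarrow> NatT"
| "const_ty (RecC T) = T \<^bold>\<Rightarrow> (NatT \<^bold>\<Rightarrow> T \<^bold>\<Rightarrow> T) \<^bold>\<Rightarrow> NatT \<^bold>\<Rightarrow> T"
| "const_ty QZeroC = RatT"
| "const_ty QOneC = RatT"
| "const_ty QAddC = RatT \<^bold>\<Rightarrow> RatT \<^bold>\<Rightarrow> RatT"
| "const_ty QNegC = RatT \<^bold>\<Rightarrow> RatT"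
| "const_ty QMulC = RatT \<^bold>\<Rightarrow> RatT \<^bold>\<Rightarrow> RatT"
| "const_ty QInvC = RatT \<^bold>\<Rightarrow> RatT"
| "const_ty QLessC = RatT \<^bold>\<Rightarrow> RatT \<^bold>\<Rightarrow> Omega"

text \<open>
  Locally nameless terms: free variables are named and carry their type (variables with the same
  name and different types are different), bound variables are de Bruijn indices.
\<close>

datatype trm =
    Var string ty
  | Bnd nat
  | Cn const
  | Abs ty trm
  | App trm trm  (infixl \<open>\<bullet>\<close> 90)

primrec fv :: "trm \<Rightarrow> (string \<times> ty) set" where
  "fv (Var x T) = {(x, T)}"
| "fv (Bnd i) = {}"
| "fv (Cn c) = {}"
| "fv (Abs T b) = fv b"
| "fv (s \<bullet> t) = fv s \<union> fv t"

text \<open>Only locally closed terms are ever put for an index, so no lifting is needed.\<close>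

primrec opn :: "nat \<Rightarrow> trm \<Rightarrow> trm \<Rightarrow> trm" where
  "opn k u (Var x T) = Var x T"
| "opn k u (Bnd i) = (if i = k then u else Bnd i)"
| "opn k u (Cn c) = Cn c"
| "opn k u (Abs T b) = Abs T (opn (Suc k) u b)"
| "opn k u (s \<bullet> t) = opn k u s \<bullet> opn k u t"

primrec cls :: "nat \<Rightarrow> string \<Rightarrow> ty \<Rightarrow> trm \<Rightarrow> trm" where
  "cls k x T (Var y S) = (if y = x \<and> S = T then Bnd k else Var y S)"
| "cls k x T (Bnd i) = Bnd i"
| "cls k x T (Cn c) = Cn c"
| "cls k x T (Abs S b) = Abs S (cls (Suc k) x T b)"
| "cls k x T (s \<bullet> t) = cls k x T s \<bullet> cls k x T t"

text \<open>The list gives the types of the dangling indices.\<close>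

inductive has_type :: "ty list \<Rightarrow> trm \<Rightarrow> ty \<Rightarrow> bool" where
  ty_Var: "has_type \<Delta> (Var x T) T"
| ty_Bnd: "i < length \<Delta> \<Longrightarrow> has_type \<Delta> (Bnd i) (\<Delta> ! i)"
| ty_Cn: "has_type \<Delta> (Cn c) (const_ty c)"
| ty_Abs: "has_type (S # \<Delta>) b T \<Longrightarrow> has_type \<Delta> (Abs S b) (S \<^bold>\<Rightarrow> T)"
| ty_App: "has_type \<Delta> s (S \<^bold>\<Rightarrow> T) \<Longrightarrow> has_type \<Delta> t S \<Longrightarrow> has_type \<Delta> (s \<bullet> t) T"

abbreviation wt :: "trm \<Rightarrow> ty \<Rightarrow> bool"
  where "wt t T \<equiv> has_type [] t T"


section \<open>Notation of the object logic\<close>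

text \<open>
  The term \<open>lam x T (\<lambda>v. F v)\<close> is the abstraction of the object logic that binds the variable
  called \<open>x\<close> of type \<open>T\<close>, which the body refers to as \<open>v\<close>. A free variable with that name and
  type occurring in \<open>F\<close> would be captured; this is harmless below, as binders are only applied
  in the construction of closed terms.
\<close>

definition lam :: "string \<Rightarrow> ty \<Rightarrow> (trm \<Rightarrow> trm) \<Rightarrow> trm"  (\<open>\<^bold>\<lambda>\<close>)
  where "\<^bold>\<lambda> x T F = Abs T (cls 0 x T (F (Var x T)))"

abbreviation fm_all :: "string \<Rightarrow> ty \<Rightarrow> (trm \<Rightarrow> trm) \<Rightarrow> trm"  (\<open>\<^bold>\<forall>\<close>)
  where "\<^bold>\<forall> x T F \<equiv> Cn (AllC T) \<bullet> \<^bold>\<lambda> x T F"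

abbreviation fm_ex :: "string \<Rightarrow> ty \<Rightarrow> (trm \<Rightarrow> trm) \<Rightarrow> trm"  (\<open>\<^bold>\<exists>\<close>)
  where "\<^bold>\<exists> x T F \<equiv> Cn (ExC T) \<bullet> \<^bold>\<lambda> x T F"

abbreviation fm_bot :: trm  (\<open>\<^bold>\<bottom>\<close>)
  where "\<^bold>\<bottom> \<equiv> Cn BotC"

abbreviation fm_conj :: "trm \<Rightarrow> trm \<Rightarrow> trm"  (infixr \<open>\<^bold>\<and>\<close> 35)
  where "\<phi> \<^bold>\<and> \<psi> \<equiv> Cn AndC \<bullet> \<phi> \<bullet> \<psi>"

abbreviation fm_disj :: "trm \<Rightarrow> trm \<Rightarrow> trm"  (infixr \<open>\<^bold>\<or>\<close> 30)
  where "\<phi> \<^bold>\<or> \<psi> \<equiv> Cn OrC \<bullet> \<phi> \<bullet> \<psi>"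

abbreviation fm_imp :: "trm \<Rightarrow> trm \<Rightarrow> trm"  (infixr \<open>\<^bold>\<longrightarrow>\<close> 25)
  where "\<phi> \<^bold>\<longrightarrow> \<psi> \<equiv> Cn ImpC \<bullet> \<phi> \<bullet> \<psi>"

abbreviation fm_iff :: "trm \<Rightarrow> trm \<Rightarrow> trm"  (infixr \<open>\<^bold>\<longleftrightarrow>\<close> 25)
  where "\<phi> \<^bold>\<longleftrightarrow> \<psi> \<equiv> (\<phi> \<^bold>\<longrightarrow> \<psi>) \<^bold>\<and> (\<psi> \<^bold>\<longrightarrow> \<phi>)"

abbreviation fm_neg :: "trm \<Rightarrow> trm"  (\<open>\<^bold>\<not> _\<close> [40] 40)
  where "\<^bold>\<not> \<phi> \<equiv> \<phi> \<^bold>\<longrightarrow> \<^bold>\<bottom>"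

abbreviation fm_eq :: "trm \<Rightarrow> ty \<Rightarrow> trm \<Rightarrow> trm"  (\<open>(_ \<^bold>=\<^bsub>_\<^esub> _)\<close> [51, 0, 51] 50)
  where "s \<^bold>=\<^bsub>T\<^esub> t \<equiv> Cn (EqC T) \<bullet> s \<bullet> t"

abbreviation (input) fm_mem :: "trm \<Rightarrow> trm \<Rightarrow> trm"  (infix \<open>\<^bold>\<in>\<close> 50)
  where "t \<^bold>\<in> A \<equiv> A \<bullet> t"

abbreviation (input) fm_not_mem :: "trm \<Rightarrow> trm \<Rightarrow> trm"  (infix \<open>\<^bold>\<notin>\<close> 50)
  where "t \<^bold>\<notin> A \<equiv> \<^bold>\<not> (t \<^bold>\<in> A)"

abbreviation pair :: "ty \<Rightarrow> ty \<Rightarrow> trm \<Rightarrow> trm \<Rightarrow> trm"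
  where "pair S T s t \<equiv> Cn (PairC S T) \<bullet> s \<bullet> t"

abbreviation nsuc :: "trm \<Rightarrow> trm"
  where "nsuc n \<equiv> Cn SucC \<bullet> n"

abbreviation qzero :: trm  (\<open>\<^bold>0\<close>)
  where "\<^bold>0 \<equiv> Cn QZeroC"

abbreviation qone :: trm  (\<open>\<^bold>1\<close>)
  where "\<^bold>1 \<equiv> Cn QOneC"

abbreviation qadd :: "trm \<Rightarrow> trm \<Rightarrow> trm"  (infixl \<open>\<^bold>+\<close> 65)
  where "q \<^bold>+ r \<equiv> Cn QAddC \<bullet> q \<bullet> r"

abbreviation qneg :: "trm \<Rightarrow> trm"
  where "qneg q \<equiv> Cn QNegC \<bullet> q"

abbreviation qsub :: "trm \<Rightarrow> trm \<Rightarrow> trm"  (infixl \<open>\<^bold>-\<close> 65)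
  where "q \<^bold>- r \<equiv> q \<^bold>+ qneg r"

abbreviation qmul :: "trm \<Rightarrow> trm \<Rightarrow> trm"  (infixl \<open>\<^bold>*\<close> 70)
  where "q \<^bold>* r \<equiv> Cn QMulC \<bullet> q \<bullet> r"

abbreviation qinv :: "trm \<Rightarrow> trm"
  where "qinv q \<equiv> Cn QInvC \<bullet> q"

abbreviation qless :: "trm \<Rightarrow> trm \<Rightarrow> trm"  (infix \<open>\<^bold><\<close> 50)
  where "q \<^bold>< r \<equiv> Cn QLessC \<bullet> q \<bullet> r"

abbreviation qle :: "trm \<Rightarrow> trm \<Rightarrow> trm"  (infix \<open>\<^bold>\<le>\<close> 50)
  where "q \<^bold>\<le> r \<equiv> (q \<^bold>< r) \<^bold>\<or> (q \<^bold>=\<^bsub>RatT\<^esub> r)"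

text \<open>The embedding of the natural numbers into the rationals, and \<open>k \<mapsto> 2\<^sup>-\<^sup>k\<close>.\<close>

definition nat_to_rat :: trm
  where "nat_to_rat = Cn (RecC RatT) \<bullet> \<^bold>0 \<bullet> \<^bold>\<lambda> ''n'' NatT (\<lambda>n. \<^bold>\<lambda> ''q'' RatT (\<lambda>q. q \<^bold>+ \<^bold>1))"

definition two_pow_neg :: trm
  where "two_pow_neg =
    Cn (RecC RatT) \<bullet> \<^bold>1 \<bullet> \<^bold>\<lambda> ''n'' NatT (\<lambda>n. \<^bold>\<lambda> ''q'' RatT (\<lambda>q. q \<^bold>* qinv (\<^bold>1 \<^bold>+ \<^bold>1)))"


section \<open>Axioms and derivations\<close>

text \<open>
  The axioms for the rationals are those of a linearly ordered field (with decidable order) in which every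
  element is a fraction of integers. They determine the rationals up to unique isomorphism, also
  intuitionistically, and hold for the usual quotient construction. Equality with zero is
  decidable, so a total inverse with \<open>0\<^sup>-\<^sup>1 = 0\<close> is unproblematic.
\<close>

inductive_set axs :: "trm set" where
  ax_fst: "\<^bold>\<forall> ''a'' S (\<lambda>a. \<^bold>\<forall> ''b'' T (\<lambda>b. Cn (FstC S T) \<bullet> pair S T a b \<^bold>=\<^bsub>S\<^esub> a)) \<in> axs"
| ax_snd: "\<^bold>\<forall> ''a'' S (\<lambda>a. \<^bold>\<forall> ''b'' T (\<lambda>b. Cn (SndC S T) \<bullet> pair S T a b \<^bold>=\<^bsub>T\<^esub> b)) \<in> axs"
| ax_pair: "\<^bold>\<forall> ''p'' (S \<^bold>\<times> T) (\<lambda>p.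
    pair S T (Cn (FstC S T) \<bullet> p) (Cn (SndC S T) \<bullet> p) \<^bold>=\<^bsub>S \<^bold>\<times> T\<^esub> p) \<in> axs"

| ax_suc_zero: "\<^bold>\<forall> ''n'' NatT (\<lambda>n. \<^bold>\<not> (nsuc n \<^bold>=\<^bsub>NatT\<^esub> Cn ZeroC)) \<in> axs"
| ax_suc_inj: "\<^bold>\<forall> ''m'' NatT (\<lambda>m. \<^bold>\<forall> ''n'' NatT (\<lambda>n.
    (nsuc m \<^bold>=\<^bsub>NatT\<^esub> nsuc n) \<^bold>\<longrightarrow> (m \<^bold>=\<^bsub>NatT\<^esub> n))) \<in> axs"
| ax_induct: "\<^bold>\<forall> ''P'' (PowT NatT) (\<lambda>P.
    (Cn ZeroC \<^bold>\<in> P) \<^bold>\<and> \<^bold>\<forall> ''n'' NatT (\<lambda>n. (n \<^bold>\<in> P) \<^bold>\<longrightarrow> (nsuc n \<^bold>\<in> P))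
      \<^bold>\<longrightarrow> \<^bold>\<forall> ''n'' NatT (\<lambda>n. n \<^bold>\<in> P)) \<in> axs"
| ax_rec_zero: "\<^bold>\<forall> ''a'' T (\<lambda>a. \<^bold>\<forall> ''f'' (NatT \<^bold>\<Rightarrow> T \<^bold>\<Rightarrow> T) (\<lambda>f.
    Cn (RecC T) \<bullet> a \<bullet> f \<bullet> Cn ZeroC \<^bold>=\<^bsub>T\<^esub> a)) \<in> axs"
| ax_rec_suc: "\<^bold>\<forall> ''a'' T (\<lambda>a. \<^bold>\<forall> ''f'' (NatT \<^bold>\<Rightarrow> T \<^bold>\<Rightarrow> T) (\<lambda>f. \<^bold>\<forall> ''n'' NatT (\<lambda>n.
    Cn (RecC T) \<bullet> a \<bullet> f \<bullet> nsuc n \<^bold>=\<^bsub>T\<^esub> f \<bullet> n \<bullet> (Cn (RecC T) \<bullet> a \<bullet> f \<bullet> n)))) \<in> axs"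

| ax_add_assoc: "\<^bold>\<forall> ''x'' RatT (\<lambda>x. \<^bold>\<forall> ''y'' RatT (\<lambda>y. \<^bold>\<forall> ''z'' RatT (\<lambda>z.
    (x \<^bold>+ y) \<^bold>+ z \<^bold>=\<^bsub>RatT\<^esub> x \<^bold>+ (y \<^bold>+ z)))) \<in> axs"
| ax_add_comm: "\<^bold>\<forall> ''x'' RatT (\<lambda>x. \<^bold>\<forall> ''y'' RatT (\<lambda>y. x \<^bold>+ y \<^bold>=\<^bsub>RatT\<^esub> y \<^bold>+ x)) \<in> axs"
| ax_add_zero: "\<^bold>\<forall> ''x'' RatT (\<lambda>x. \<^bold>0 \<^bold>+ x \<^bold>=\<^bsub>RatT\<^esub> x) \<in> axs"
| ax_add_neg: "\<^bold>\<forall> ''x'' RatT (\<lambda>x. x \<^bold>+ qneg x \<^bold>=\<^bsub>RatT\<^esub> \<^bold>0) \<in> axs"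
| ax_mul_assoc: "\<^bold>\<forall> ''x'' RatT (\<lambda>x. \<^bold>\<forall> ''y'' RatT (\<lambda>y. \<^bold>\<forall> ''z'' RatT (\<lambda>z.
    (x \<^bold>* y) \<^bold>* z \<^bold>=\<^bsub>RatT\<^esub> x \<^bold>* (y \<^bold>* z)))) \<in> axs"
| ax_mul_comm: "\<^bold>\<forall> ''x'' RatT (\<lambda>x. \<^bold>\<forall> ''y'' RatT (\<lambda>y. x \<^bold>* y \<^bold>=\<^bsub>RatT\<^esub> y \<^bold>* x)) \<in> axs"
| ax_mul_one: "\<^bold>\<forall> ''x'' RatT (\<lambda>x. \<^bold>1 \<^bold>* x \<^bold>=\<^bsub>RatT\<^esub> x) \<in> axs"
| ax_distrib: "\<^bold>\<forall> ''x'' RatT (\<lambda>x. \<^bold>\<forall> ''y'' RatT (\<lambda>y. \<^bold>\<forall> ''z'' RatT (\<lambda>z.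
    x \<^bold>* (y \<^bold>+ z) \<^bold>=\<^bsub>RatT\<^esub> x \<^bold>* y \<^bold>+ x \<^bold>* z))) \<in> axs"
| ax_inv: "\<^bold>\<forall> ''x'' RatT (\<lambda>x. \<^bold>\<not> (x \<^bold>=\<^bsub>RatT\<^esub> \<^bold>0) \<^bold>\<longrightarrow> (x \<^bold>* qinv x \<^bold>=\<^bsub>RatT\<^esub> \<^bold>1)) \<in> axs"
| ax_inv_zero: "(qinv \<^bold>0 \<^bold>=\<^bsub>RatT\<^esub> \<^bold>0) \<in> axs"
| ax_less_irrefl: "\<^bold>\<forall> ''x'' RatT (\<lambda>x. \<^bold>\<not> (x \<^bold>< x)) \<in> axs"
| ax_less_trans: "\<^bold>\<forall> ''x'' RatT (\<lambda>x. \<^bold>\<forall> ''y'' RatT (\<lambda>y. \<^bold>\<forall> ''z'' RatT (\<lambda>z.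
    (x \<^bold>< y) \<^bold>\<and> (y \<^bold>< z) \<^bold>\<longrightarrow> (x \<^bold>< z)))) \<in> axs"
| ax_less_total: "\<^bold>\<forall> ''x'' RatT (\<lambda>x. \<^bold>\<forall> ''y'' RatT (\<lambda>y.
    (x \<^bold>< y) \<^bold>\<or> (x \<^bold>=\<^bsub>RatT\<^esub> y) \<^bold>\<or> (y \<^bold>< x))) \<in> axs"
| ax_less_add: "\<^bold>\<forall> ''x'' RatT (\<lambda>x. \<^bold>\<forall> ''y'' RatT (\<lambda>y. \<^bold>\<forall> ''z'' RatT (\<lambda>z.
    (x \<^bold>< y) \<^bold>\<longrightarrow> (x \<^bold>+ z \<^bold>< y \<^bold>+ z)))) \<in> axs"
| ax_less_mul: "\<^bold>\<forall> ''x'' RatT (\<lambda>x. \<^bold>\<forall> ''y'' RatT (\<lambda>y.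
    (\<^bold>0 \<^bold>< x) \<^bold>\<and> (\<^bold>0 \<^bold>< y) \<^bold>\<longrightarrow> (\<^bold>0 \<^bold>< x \<^bold>* y))) \<in> axs"
| ax_zero_less_one: "(\<^bold>0 \<^bold>< \<^bold>1) \<in> axs"
| ax_fraction: "\<^bold>\<forall> ''q'' RatT (\<lambda>q. \<^bold>\<exists> ''m'' NatT (\<lambda>m. \<^bold>\<exists> ''n'' NatT (\<lambda>n. \<^bold>\<exists> ''k'' NatT (\<lambda>k.
    q \<^bold>* (nat_to_rat \<bullet> nsuc k) \<^bold>=\<^bsub>RatT\<^esub> (nat_to_rat \<bullet> m) \<^bold>- (nat_to_rat \<bullet> n))))) \<in> axs"

text \<open>
  Natural deduction. Typing premises ensure that only well-typed formulas are derivable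
  (\<open>deriv_wt\<close> below). All types are inhabited, so sequents need not record their free variables.
\<close>

inductive deriv :: "trm set \<Rightarrow> trm \<Rightarrow> bool"  (infix \<open>\<^bold>\<turnstile>\<close> 20) where
  d_ax: "\<phi> \<in> axs \<Longrightarrow> \<Gamma> \<^bold>\<turnstile> \<phi>"
| d_hyp: "\<phi> \<in> \<Gamma> \<Longrightarrow> wt \<phi> Omega \<Longrightarrow> \<Gamma> \<^bold>\<turnstile> \<phi>"
| d_weaken: "\<Gamma> \<^bold>\<turnstile> \<phi> \<Longrightarrow> \<Gamma> \<subseteq> \<Gamma>' \<Longrightarrow> \<Gamma>' \<^bold>\<turnstile> \<phi>"

| d_botE: "\<Gamma> \<^bold>\<turnstile> \<^bold>\<bottom> \<Longrightarrow> wt \<phi> Omega \<Longrightarrow> \<Gamma> \<^bold>\<turnstile> \<phi>"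
| d_conjI: "\<Gamma> \<^bold>\<turnstile> \<phi> \<Longrightarrow> \<Gamma> \<^bold>\<turnstile> \<psi> \<Longrightarrow> \<Gamma> \<^bold>\<turnstile> \<phi> \<^bold>\<and> \<psi>"
| d_conjE1: "\<Gamma> \<^bold>\<turnstile> \<phi> \<^bold>\<and> \<psi> \<Longrightarrow> \<Gamma> \<^bold>\<turnstile> \<phi>"
| d_conjE2: "\<Gamma> \<^bold>\<turnstile> \<phi> \<^bold>\<and> \<psi> \<Longrightarrow> \<Gamma> \<^bold>\<turnstile> \<psi>"
| d_disjI1: "\<Gamma> \<^bold>\<turnstile> \<phi> \<Longrightarrow> wt \<psi> Omega \<Longrightarrow> \<Gamma> \<^bold>\<turnstile> \<phi> \<^bold>\<or> \<psi>"
| d_disjI2: "\<Gamma> \<^bold>\<turnstile> \<psi> \<Longrightarrow> wt \<phi> Omega \<Longrightarrow> \<Gamma> \<^bold>\<turnstile> \<phi> \<^bold>\<or> \<psi>"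
| d_disjE: "\<Gamma> \<^bold>\<turnstile> \<phi> \<^bold>\<or> \<psi> \<Longrightarrow> insert \<phi> \<Gamma> \<^bold>\<turnstile> \<chi> \<Longrightarrow> insert \<psi> \<Gamma> \<^bold>\<turnstile> \<chi> \<Longrightarrow> \<Gamma> \<^bold>\<turnstile> \<chi>"
| d_impI: "insert \<phi> \<Gamma> \<^bold>\<turnstile> \<psi> \<Longrightarrow> wt \<phi> Omega \<Longrightarrow> \<Gamma> \<^bold>\<turnstile> \<phi> \<^bold>\<longrightarrow> \<psi>"
| d_impE: "\<Gamma> \<^bold>\<turnstile> \<phi> \<^bold>\<longrightarrow> \<psi> \<Longrightarrow> \<Gamma> \<^bold>\<turnstile> \<phi> \<Longrightarrow> \<Gamma> \<^bold>\<turnstile> \<psi>"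

| d_allI: "\<Gamma> \<^bold>\<turnstile> p \<bullet> Var x T \<Longrightarrow> wt p (PowT T) \<Longrightarrow> (x, T) \<notin> fv p \<Longrightarrow> \<forall>\<psi>\<in>\<Gamma>. (x, T) \<notin> fv \<psi>
    \<Longrightarrow> \<Gamma> \<^bold>\<turnstile> Cn (AllC T) \<bullet> p"
| d_allE: "\<Gamma> \<^bold>\<turnstile> Cn (AllC T) \<bullet> p \<Longrightarrow> wt t T \<Longrightarrow> \<Gamma> \<^bold>\<turnstile> p \<bullet> t"
| d_exI: "\<Gamma> \<^bold>\<turnstile> p \<bullet> t \<Longrightarrow> wt p (PowT T) \<Longrightarrow> wt t T \<Longrightarrow> \<Gamma> \<^bold>\<turnstile> Cn (ExC T) \<bullet> p"
| d_exE: "\<Gamma> \<^bold>\<turnstile> Cn (ExC T) \<bullet> p \<Longrightarrow> insert (p \<bullet> Var x T) \<Gamma> \<^bold>\<turnstile> \<chi> \<Longrightarrow> (x, T) \<notin> fv p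
    \<Longrightarrow> (x, T) \<notin> fv \<chi> \<Longrightarrow> \<forall>\<psi>\<in>\<Gamma>. (x, T) \<notin> fv \<psi> \<Longrightarrow> \<Gamma> \<^bold>\<turnstile> \<chi>"

| d_refl: "wt t T \<Longrightarrow> \<Gamma> \<^bold>\<turnstile> t \<^bold>=\<^bsub>T\<^esub> t"
| d_cong: "\<Gamma> \<^bold>\<turnstile> f \<^bold>=\<^bsub>S \<^bold>\<Rightarrow> T\<^esub> g \<Longrightarrow> \<Gamma> \<^bold>\<turnstile> s \<^bold>=\<^bsub>S\<^esub> t \<Longrightarrow> \<Gamma> \<^bold>\<turnstile> f \<bullet> s \<^bold>=\<^bsub>T\<^esub> g \<bullet> t"
| d_eq_mp: "\<Gamma> \<^bold>\<turnstile> \<phi> \<^bold>=\<^bsub>Omega\<^esub> \<psi> \<Longrightarrow> \<Gamma> \<^bold>\<turnstile> \<phi> \<Longrightarrow> \<Gamma> \<^bold>\<turnstile> \<psi>"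
| d_beta: "wt (Abs S b) (S \<^bold>\<Rightarrow> T) \<Longrightarrow> wt t S \<Longrightarrow> \<Gamma> \<^bold>\<turnstile> Abs S b \<bullet> t \<^bold>=\<^bsub>T\<^esub> opn 0 t b"
| d_fun_ext: "\<Gamma> \<^bold>\<turnstile> f \<bullet> Var x S \<^bold>=\<^bsub>T\<^esub> g \<bullet> Var x S \<Longrightarrow> wt f (S \<^bold>\<Rightarrow> T) \<Longrightarrow> wt g (S \<^bold>\<Rightarrow> T)
    \<Longrightarrow> (x, S) \<notin> fv f \<Longrightarrow> (x, S) \<notin> fv g \<Longrightarrow> \<forall>\<psi>\<in>\<Gamma>. (x, S) \<notin> fv \<psi>
    \<Longrightarrow> \<Gamma> \<^bold>\<turnstile> f \<^bold>=\<^bsub>S \<^bold>\<Rightarrow> T\<^esub> g"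
| d_prop_ext: "\<Gamma> \<^bold>\<turnstile> \<phi> \<^bold>\<longleftrightarrow> \<psi> \<Longrightarrow> \<Gamma> \<^bold>\<turnstile> \<phi> \<^bold>=\<^bsub>Omega\<^esub> \<psi>"


section \<open>Isomorphism of sets\<close>

definition ex_unique :: "ty \<Rightarrow> trm"
  where "ex_unique T = \<^bold>\<lambda> ''P'' (PowT T) (\<lambda>P.
    \<^bold>\<exists> ''x'' T (\<lambda>x. (x \<^bold>\<in> P) \<^bold>\<and> \<^bold>\<forall> ''y'' T (\<lambda>y. (y \<^bold>\<in> P) \<^bold>\<longrightarrow> (y \<^bold>=\<^bsub>T\<^esub> x))))"

abbreviation fm_ex1 :: "string \<Rightarrow> ty \<Rightarrow> (trm \<Rightarrow> trm) \<Rightarrow> trm"  (\<open>\<^bold>\<exists>\<^bold>!\<close>)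
  where "\<^bold>\<exists>\<^bold>! x T F \<equiv> ex_unique T \<bullet> \<^bold>\<lambda> x T F"

text \<open>
  For \<open>A :: PowT S\<close> and \<open>B :: PowT T\<close>, there is a bijection from \<open>A\<close> to \<open>B\<close>. As usual in set theory
  and in topos logic, a function from \<open>A\<close> to \<open>B\<close> is a functional relation \<open>F \<subseteq> A \<times> B\<close>.
\<close>

definition isomorphic :: "ty \<Rightarrow> ty \<Rightarrow> trm"
  where "isomorphic S T = \<^bold>\<lambda> ''A'' (PowT S) (\<lambda>A. \<^bold>\<lambda> ''B'' (PowT T) (\<lambda>B.
    \<^bold>\<exists> ''F'' (PowT (S \<^bold>\<times> T)) (\<lambda>F.
      \<^bold>\<forall> ''x'' S (\<lambda>x. \<^bold>\<forall> ''y'' T (\<lambda>y. (pair S T x y \<^bold>\<in> F) \<^bold>\<longrightarrow> (x \<^bold>\<in> A) \<^bold>\<and> (y \<^bold>\<in> B)))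
      \<^bold>\<and> \<^bold>\<forall> ''x'' S (\<lambda>x. (x \<^bold>\<in> A) \<^bold>\<longrightarrow> \<^bold>\<exists>\<^bold>! ''y'' T (\<lambda>y. pair S T x y \<^bold>\<in> F))
      \<^bold>\<and> \<^bold>\<forall> ''y'' T (\<lambda>y. (y \<^bold>\<in> B) \<^bold>\<longrightarrow> \<^bold>\<exists>\<^bold>! ''x'' S (\<lambda>x. pair S T x y \<^bold>\<in> F)))))"


section \<open>Dedekind cuts\<close>

abbreviation CutT :: ty
  where "CutT \<equiv> PowT RatT \<^bold>\<times> PowT RatT"

abbreviation lower :: "trm \<Rightarrow> trm"
  where "lower c \<equiv> Cn (FstC (PowT RatT) (PowT RatT)) \<bullet> c"

abbreviation upper :: "trm \<Rightarrow> trm"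
  where "upper c \<equiv> Cn (SndC (PowT RatT) (PowT RatT)) \<bullet> c"

definition is_cut :: trm
  where "is_cut = \<^bold>\<lambda> ''L'' (PowT RatT) (\<lambda>L. \<^bold>\<lambda> ''U'' (PowT RatT) (\<lambda>U.
      \<^bold>\<exists> ''q'' RatT (\<lambda>q. q \<^bold>\<in> L)
    \<^bold>\<and> \<^bold>\<exists> ''r'' RatT (\<lambda>r. r \<^bold>\<in> U)
    \<^bold>\<and> \<^bold>\<forall> ''q'' RatT (\<lambda>q. (q \<^bold>\<in> L) \<^bold>\<longleftrightarrow> \<^bold>\<exists> ''r'' RatT (\<lambda>r. (q \<^bold>< r) \<^bold>\<and> (r \<^bold>\<in> L)))
    \<^bold>\<and> \<^bold>\<forall> ''r'' RatT (\<lambda>r. (r \<^bold>\<in> U) \<^bold>\<longleftrightarrow> \<^bold>\<exists> ''q'' RatT (\<lambda>q. (q \<^bold>\<in> U) \<^bold>\<and> (q \<^bold>< r)))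
    \<^bold>\<and> \<^bold>\<forall> ''q'' RatT (\<lambda>q. \<^bold>\<forall> ''r'' RatT (\<lambda>r. (q \<^bold>\<in> L) \<^bold>\<and> (r \<^bold>\<in> U) \<^bold>\<longrightarrow> (q \<^bold>< r)))
    \<^bold>\<and> \<^bold>\<forall> ''q'' RatT (\<lambda>q. \<^bold>\<forall> ''r'' RatT (\<lambda>r. (q \<^bold>< r) \<^bold>\<longrightarrow> (q \<^bold>\<in> L) \<^bold>\<or> (r \<^bold>\<in> U)))))"

definition Reals_d :: trm
  where "Reals_d = \<^bold>\<lambda> ''c'' CutT (\<lambda>c. is_cut \<bullet> lower c \<bullet> upper c)"

definition Pow_notnot :: "ty \<Rightarrow> trm"
  where "Pow_notnot T = \<^bold>\<lambda> ''S'' (PowT T) (\<lambda>S. \<^bold>\<forall> ''x'' T (\<lambda>x. \<^bold>\<not> \<^bold>\<not> (x \<^bold>\<in> S) \<^bold>\<longrightarrow> (x \<^bold>\<in> S)))"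

definition is_classical_cut :: trm
  where "is_classical_cut = \<^bold>\<lambda> ''L'' (PowT RatT) (\<lambda>L. \<^bold>\<lambda> ''U'' (PowT RatT) (\<lambda>U.
      (L \<^bold>\<in> Pow_notnot RatT) \<^bold>\<and> (U \<^bold>\<in> Pow_notnot RatT)
    \<^bold>\<and> (\<^bold>\<not> \<^bold>\<forall> ''q'' RatT (\<lambda>q. q \<^bold>\<notin> L))
    \<^bold>\<and> (\<^bold>\<not> \<^bold>\<forall> ''r'' RatT (\<lambda>r. r \<^bold>\<notin> U))
    \<^bold>\<and> \<^bold>\<forall> ''q'' RatT (\<lambda>q. \<^bold>\<forall> ''r'' RatT (\<lambda>r. (q \<^bold>< r) \<^bold>\<and> (r \<^bold>\<in> L) \<^bold>\<longrightarrow> (q \<^bold>\<in> L)))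
    \<^bold>\<and> \<^bold>\<forall> ''q'' RatT (\<lambda>q. \<^bold>\<forall> ''r'' RatT (\<lambda>r. (q \<^bold>\<in> U) \<^bold>\<and> (q \<^bold>< r) \<^bold>\<longrightarrow> (r \<^bold>\<in> U)))
    \<^bold>\<and> \<^bold>\<forall> ''q'' RatT (\<lambda>q. \<^bold>\<forall> ''r'' RatT (\<lambda>r. (r \<^bold>\<in> L) \<^bold>\<longrightarrow> (r \<^bold>\<le> q)) \<^bold>\<longrightarrow> (q \<^bold>\<notin> L))
    \<^bold>\<and> \<^bold>\<forall> ''r'' RatT (\<lambda>r. \<^bold>\<forall> ''q'' RatT (\<lambda>q. (q \<^bold>\<in> U) \<^bold>\<longrightarrow> (r \<^bold>\<le> q)) \<^bold>\<longrightarrow> (r \<^bold>\<notin> U))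
    \<^bold>\<and> \<^bold>\<forall> ''q'' RatT (\<lambda>q. \<^bold>\<forall> ''r'' RatT (\<lambda>r. (q \<^bold>\<in> L) \<^bold>\<and> (r \<^bold>\<in> U) \<^bold>\<longrightarrow> (q \<^bold>< r)))
    \<^bold>\<and> \<^bold>\<forall> ''q'' RatT (\<lambda>q. \<^bold>\<forall> ''r'' RatT (\<lambda>r. (q \<^bold>\<notin> L) \<^bold>\<and> (r \<^bold>\<notin> U) \<^bold>\<longrightarrow> (r \<^bold>\<le> q)))))"

definition Reals_cl :: trm
  where "Reals_cl = \<^bold>\<lambda> ''c'' CutT (\<lambda>c. is_classical_cut \<bullet> lower c \<bullet> upper c)"

definition Located_cl :: trm
  where "Located_cl = \<^bold>\<lambda> ''c'' CutT (\<lambda>c. (c \<^bold>\<in> Reals_cl) \<^bold>\<and>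
    \<^bold>\<forall> ''k'' NatT (\<lambda>k. \<^bold>\<exists> ''q'' RatT (\<lambda>q.
      (q \<^bold>- two_pow_neg \<bullet> k \<^bold>\<in> lower c) \<^bold>\<and> (q \<^bold>+ two_pow_neg \<bullet> k \<^bold>\<in> upper c))))"


section \<open>Well-typedness\<close>

lemma ty_Bnd': "i < length \<Delta> \<Longrightarrow> \<Delta> ! i = T \<Longrightarrow> has_type \<Delta> (Bnd i) T"
  using ty_Bnd by blast

lemma ty_Cn': "const_ty c = T \<Longrightarrow> has_type \<Delta> (Cn c) T"
  using ty_Cn by blast

inductive_cases ty_VarE: "has_type \<Delta> (Var x S) T"
inductive_cases ty_BndE: "has_type \<Delta> (Bnd i) T"
inductive_cases ty_CnE: "has_type \<Delta> (Cn c) T"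
inductive_cases ty_AbsE: "has_type \<Delta> (Abs S b) T"
inductive_cases ty_AppE: "has_type \<Delta> (s \<bullet> t) T"

lemma has_type_unique: "has_type \<Delta> t T \<Longrightarrow> has_type \<Delta> t T' \<Longrightarrow> T = T'"
proof (induction arbitrary: T' rule: has_type.induct)
  case (ty_App \<Delta> s S T t)
  from ty_App.prems show ?case
    by (rule ty_AppE) (use ty_App.IH in blast)
qed (blast elim: ty_VarE ty_BndE ty_CnE ty_AbsE)+

primrec infer :: "ty list \<Rightarrow> trm \<Rightarrow> ty option" where
  "infer \<Delta> (Var x T) = Some T"
| "infer \<Delta> (Bnd i) = (if i < length \<Delta> then Some (\<Delta> ! i) else None)"
| "infer \<Delta> (Cn c) = Some (const_ty c)"
| "infer \<Delta> (Abs S b) = (case infer (S # \<Delta>) b of Some T \<Rightarrow> Some (S \<^bold>\<Rightarrow> T) | None \<Rightarrow> None)"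
| "infer \<Delta> (s \<bullet> t) = (case infer \<Delta> s of
      Some (S \<^bold>\<Rightarrow> T) \<Rightarrow> if infer \<Delta> t = Some S then Some T else None
    | _ \<Rightarrow> None)"

lemma has_type_iff_infer: "has_type \<Delta> t T \<longleftrightarrow> infer \<Delta> t = Some T"
proof
  show "has_type \<Delta> t T \<Longrightarrow> infer \<Delta> t = Some T"
    by (induction rule: has_type.induct) auto
  show "infer \<Delta> t = Some T \<Longrightarrow> has_type \<Delta> t T"
  proof (induction t arbitrary: \<Delta> T)
    case (App s t)
    then obtain S where "infer \<Delta> s = Some (S \<^bold>\<Rightarrow> T)" "infer \<Delta> t = Some S"
      by (auto split: if_splits option.splits ty.splits)
    with App.IH show ?case
      by (blast intro: ty_App)
  qed (auto intro: has_type.intros split: if_splits option.splits)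
qed

lemmas type_simps = has_type_iff_infer lam_def

lemma wt_nat_to_rat: "wt nat_to_rat (NatT \<^bold>\<Rightarrow> RatT)"
  by (simp add: nat_to_rat_def type_simps)

lemma wt_two_pow_neg: "wt two_pow_neg (NatT \<^bold>\<Rightarrow> RatT)"
  by (simp add: two_pow_neg_def type_simps)

lemma wt_isomorphic: "wt (isomorphic S T) (PowT S \<^bold>\<Rightarrow> PowT T \<^bold>\<Rightarrow> Omega)"
  by (simp add: isomorphic_def ex_unique_def type_simps)

lemma wt_Reals_d: "wt Reals_d (PowT CutT)"
  by (simp add: Reals_d_def is_cut_def type_simps)

lemma wt_Reals_cl: "wt Reals_cl (PowT CutT)"
  by (simp add: Reals_cl_def is_classical_cut_def Pow_notnot_def type_simps)

lemma wt_Located_cl: "wt Located_cl (PowT CutT)"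
  by (simp add: Located_cl_def Reals_cl_def is_classical_cut_def Pow_notnot_def two_pow_neg_def
      type_simps)

lemma wt_axs: "\<phi> \<in> axs \<Longrightarrow> wt \<phi> Omega"
  by (induction rule: axs.induct) (simp_all add: nat_to_rat_def type_simps)

lemma has_type_weaken: "has_type \<Delta> t T \<Longrightarrow> has_type (\<Delta> @ \<Delta>') t T"
  by (induction rule: has_type.induct) (auto intro: has_type.intros ty_Bnd' simp: nth_append)

lemma has_type_opn:
  "has_type (\<Delta> @ [S]) b T \<Longrightarrow> wt u S \<Longrightarrow> has_type \<Delta> (opn (length \<Delta>) u b) T"
proof (induction b arbitrary: \<Delta> T)
  case (Bnd i)
  then show ?case
    using has_type_weaken[of "[]" u S \<Delta>]
    by (auto elim!: ty_BndE intro!: ty_Bnd' simp: nth_append less_Suc_eq)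
next
  case (Abs S' b)
  from Abs.prems(1) obtain T' where T: "T = S' \<^bold>\<Rightarrow> T'" and "has_type ((S' # \<Delta>) @ [S]) b T'"
    by (auto elim: ty_AbsE)
  then show ?case
    using Abs.IH[of "S' # \<Delta>" T'] Abs.prems(2) by (auto intro: ty_Abs)
next
  case (App s t)
  from App.prems(1) obtain S' where "has_type (\<Delta> @ [S]) s (S' \<^bold>\<Rightarrow> T)" "has_type (\<Delta> @ [S]) t S'"
    by (auto elim: ty_AppE)
  with App.IH App.prems(2) have "has_type \<Delta> (opn (length \<Delta>) u s) (S' \<^bold>\<Rightarrow> T)"
    and "has_type \<Delta> (opn (length \<Delta>) u t) S'"
    by auto
  then show ?case
    by (simp add: ty_App)
qed (auto elim!: ty_VarE ty_CnE intro: has_type.intros)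

theorem deriv_wt: "\<Gamma> \<^bold>\<turnstile> \<phi> \<Longrightarrow> wt \<phi> Omega"
proof (induction rule: deriv.induct)
  case (d_ax \<phi> \<Gamma>)
  then show ?case
    by (rule wt_axs)
next
  case (d_beta S b T t)
  then have "has_type ([] @ [S]) b T"
    by (auto elim: ty_AbsE)
  from has_type_opn[OF this d_beta(2)] d_beta show ?case
    by (simp add: has_type_iff_infer)
qed (auto simp: has_type_iff_infer split: option.splits ty.splits if_splits)

end

theory Submission
  imports Defs "HOL-Library.FSet"
begin

text \<open>
  A cut \<open>(L, U)\<close> corresponds to the classical cut \<open>(L', U')\<close> of its double complements;
  in the other direction, \<open>L\<close> is recovered as the set of all \<open>q\<close> below some element of \<open>L'\<close>, and
  dually for \<open>U\<close>. That the double complement of a cut is located to within \<open>2\<^sup>-\<^sup>k\<close> follows from the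
  Archimedean property, by walking from a point of \<open>L\<close> towards \<open>U\<close> in steps of that length.

  To reason inside the object logic, derivability is read as forcing over finite contexts: the
  connectives then satisfy the Kripke-Joyal clauses, which turn an object formula into
  a statement of the ambient logic. A universally quantified formula is forced as soon as all its
  instances by terms are, because a finite context leaves a fresh variable, which is one of these
  terms.
\<close>

section \<open>Forcing\<close>

text \<open>The mathematical obstacle is positive information. A classical cut has inhabitants and
  locatedness only doubly negated; the condition with \<open>2^-k\<close> supplies both outright:
  \<open>k = 0\<close> gives points of the two sides, and a \<open>k\<close> with
  \<open>2^-k\<close> less than half of \<open>y - x\<close> decides between \<open>x\<close> in
  \<open>L\<close> and \<open>y\<close> in \<open>U\<close>. Conversely, a point strictly below one
  of \<open>L'\<close> must be shown to lie in \<open>L\<close> itself. Locatedness of the cut does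
  this, as its other alternative is refuted by disjointness.

  The formal obstacle is that a disjunction derivable from hypotheses need not have a derivable
  disjunct, nor an existential formula a witness. Such facts are therefore recorded on covers.
  Contexts may also be inconsistent, so an absurd case ends in a derivation of the object falsity,
  not in \<open>False\<close>. Finally, induction on the naturals exists only for object formulas,
  so each inductive claim is written as a formula and then translated.\<close>

lemma has_type_opn_ident: "has_type \<Delta> t T \<Longrightarrow> length \<Delta> \<le> k \<Longrightarrow> opn k u t = t"
  by (induction arbitrary: k rule: has_type.induct) auto

text \<open>Typability in the empty context rules out dangling indices, so the term keeps its type
  below binders and survives every opening. For a concrete term these facts serve as rewrite rules
  that let the simplifier compute the body of a formula.\<close>

lemma wtD:
  assumes "wt t T"
  shows "infer \<Delta> t = Some T" "opn k u t = t"
  using has_type_weaken[OF assms, of \<Delta>] has_type_opn_ident[OF assms, of k]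
  by (simp_all add: has_type_iff_infer)

lemma finite_fv: "finite (fv t)"
  by (induction t) auto

lemma ex_fresh:
  assumes "finite A"
  shows "\<exists>x. \<forall>t\<in>A. (x, T) \<notin> fv t"
proof -
  have "finite (fst ` (\<Union>t\<in>A. fv t))"
    using assms by (simp add: finite_fv)
  then obtain x where "x \<notin> fst ` (\<Union>t\<in>A. fv t)"
    using ex_new_if_finite[OF infinite_UNIV_listI] by blast
  then show ?thesis
    by (force intro: exI[of _ x])
qed

definition forces :: "trm fset \<Rightarrow> trm \<Rightarrow> bool"  (infix \<open>\<tturnstile>\<close> 26)
  where "\<Gamma> \<tturnstile> \<phi> \<longleftrightarrow> (fset \<Gamma> \<^bold>\<turnstile> \<phi>)"

lemma forces_mono: "\<Gamma> \<tturnstile> \<phi> \<Longrightarrow> \<Gamma> \<le> \<Delta> \<Longrightarrow> \<Delta> \<tturnstile> \<phi>"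
  unfolding forces_def by (rule d_weaken) (auto simp: less_eq_fset.rep_eq)

lemma forces_hyp: "wt \<phi> Omega \<Longrightarrow> finsert \<phi> \<Gamma> \<tturnstile> \<phi>"
  by (simp add: forces_def d_hyp)

lemma forces_wt: "\<Gamma> \<tturnstile> \<phi> \<Longrightarrow> infer [] \<phi> = Some Omega"
  using deriv_wt by (auto simp: forces_def has_type_iff_infer)

text \<open>
  The existence of a cover of \<open>\<Gamma>\<close> on which \<open>P\<close> holds, in a second-order encoding: whatever formula \<open>P\<close>
  makes true in extended contexts is already true.
\<close>

definition cov :: "trm fset \<Rightarrow> (trm fset \<Rightarrow> bool) \<Rightarrow> bool"
  where "cov \<Gamma> P \<longleftrightarrow> (\<forall>\<Delta>\<ge>\<Gamma>. \<forall>\<chi>. wt \<chi> Omega \<longrightarrow> (\<forall>\<Delta>'\<ge>\<Delta>. P \<Delta>' \<longrightarrow> \<Delta>' \<tturnstile> \<chi>) \<longrightarrow> \<Delta> \<tturnstile> \<chi>)"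

lemma covI: "P \<Gamma> \<Longrightarrow> (\<And>\<Delta>. \<Gamma> \<le> \<Delta> \<Longrightarrow> P \<Gamma> \<Longrightarrow> P \<Delta>) \<Longrightarrow> cov \<Gamma> P"
  unfolding cov_def by blast

lemma cov_mono: "cov \<Gamma> P \<Longrightarrow> \<Gamma> \<le> \<Delta> \<Longrightarrow> cov \<Delta> P"
  unfolding cov_def by (meson order.trans)

text \<open>A formula true on the second family is true at each member of the first, and hence at
  the base. Disjunctions and existential formulas are eliminated in this way, one after the
  other.\<close>

lemma cov_bind:
  assumes "cov \<Gamma> P" "\<And>\<Delta>. \<Gamma> \<le> \<Delta> \<Longrightarrow> P \<Delta> \<Longrightarrow> cov \<Delta> Q"
  shows "cov \<Gamma> Q"
  unfolding cov_def
proof (intro allI impI)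
  fix \<Delta> \<chi>
  assume *: "\<Gamma> \<le> \<Delta>" "wt \<chi> Omega" "\<forall>\<Delta>'\<ge>\<Delta>. Q \<Delta>' \<longrightarrow> \<Delta>' \<tturnstile> \<chi>"
  have "\<Delta>' \<tturnstile> \<chi>" if "\<Delta> \<le> \<Delta>'" "P \<Delta>'" for \<Delta>'
    using assms(2)[of \<Delta>'] that * unfolding cov_def by (meson order.trans order.refl)
  with assms(1) * show "\<Delta> \<tturnstile> \<chi>"
    unfolding cov_def by blast
qed

lemma cov_weaken: "cov \<Gamma> P \<Longrightarrow> (\<And>\<Delta>. \<Gamma> \<le> \<Delta> \<Longrightarrow> P \<Delta> \<Longrightarrow> Q \<Delta>) \<Longrightarrow> cov \<Gamma> Q"
  unfolding cov_def by (meson order.trans)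

text \<open>Formulas are local: in the encoding, \<chi> can be chosen to be \<phi> itself. A case
  distinction over a cover is closed by this step.\<close>

lemma cov_forces:
  assumes "cov \<Gamma> P" "\<And>\<Delta>. \<Gamma> \<le> \<Delta> \<Longrightarrow> P \<Delta> \<Longrightarrow> \<Delta> \<tturnstile> \<phi>" "wt \<phi> Omega"
  shows "\<Gamma> \<tturnstile> \<phi>"
  using assms unfolding cov_def by blast

section \<open>Kripke-Joyal clauses for the connectives\<close>

lemma forces_conj: "(\<Gamma> \<tturnstile> \<phi> \<^bold>\<and> \<psi>) \<longleftrightarrow> (\<Gamma> \<tturnstile> \<phi>) \<and> (\<Gamma> \<tturnstile> \<psi>)"
  unfolding forces_def by (blast intro: d_conjI d_conjE1 d_conjE2)

text \<open>The context \<open>finsert \<phi> \<Gamma>\<close> is the generic extension in which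
  \<phi> holds, so a claim about all such extensions can be tested there.\<close>

lemma forces_imp:
  assumes "wt \<phi> Omega"
  shows "(\<Gamma> \<tturnstile> (\<phi> \<^bold>\<longrightarrow> \<psi>)) \<longleftrightarrow> (\<forall>\<Delta>\<ge>\<Gamma>. (\<Delta> \<tturnstile> \<phi>) \<longrightarrow> (\<Delta> \<tturnstile> \<psi>))"
proof
  assume "\<Gamma> \<tturnstile> (\<phi> \<^bold>\<longrightarrow> \<psi>)"
  then show "\<forall>\<Delta>\<ge>\<Gamma>. (\<Delta> \<tturnstile> \<phi>) \<longrightarrow> (\<Delta> \<tturnstile> \<psi>)"
    using forces_mono[of \<Gamma> "\<phi> \<^bold>\<longrightarrow> \<psi>"] unfolding forces_def by (blast intro: d_impE)
next
  assume "\<forall>\<Delta>\<ge>\<Gamma>. (\<Delta> \<tturnstile> \<phi>) \<longrightarrow> (\<Delta> \<tturnstile> \<psi>)"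
  then have "finsert \<phi> \<Gamma> \<tturnstile> \<psi>"
    using forces_hyp[OF assms] by blast
  then show "\<Gamma> \<tturnstile> (\<phi> \<^bold>\<longrightarrow> \<psi>)"
    using assms by (simp add: forces_def d_impI)
qed

lemma forces_disj:
  assumes wt: "wt \<phi> Omega" "wt \<psi> Omega"
  shows "(\<Gamma> \<tturnstile> \<phi> \<^bold>\<or> \<psi>) \<longleftrightarrow> cov \<Gamma> (\<lambda>\<Delta>. (\<Delta> \<tturnstile> \<phi>) \<or> (\<Delta> \<tturnstile> \<psi>))"
proof
  assume disj: "\<Gamma> \<tturnstile> \<phi> \<^bold>\<or> \<psi>"
  show "cov \<Gamma> (\<lambda>\<Delta>. (\<Delta> \<tturnstile> \<phi>) \<or> (\<Delta> \<tturnstile> \<psi>))"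
    unfolding cov_def
  proof (intro allI impI)
    fix \<Delta> \<chi>
    assume *: "\<Gamma> \<le> \<Delta>" "\<forall>\<Delta>'\<ge>\<Delta>. (\<Delta>' \<tturnstile> \<phi>) \<or> (\<Delta>' \<tturnstile> \<psi>) \<longrightarrow> \<Delta>' \<tturnstile> \<chi>"
    have "finsert \<phi> \<Delta> \<tturnstile> \<chi>" "finsert \<psi> \<Delta> \<tturnstile> \<chi>"
      using * forces_hyp[OF wt(1)] forces_hyp[OF wt(2)] by blast+
    then show "\<Delta> \<tturnstile> \<chi>"
      using forces_mono[OF disj *(1)] by (auto simp: forces_def intro: d_disjE)
  qed
next
  assume "cov \<Gamma> (\<lambda>\<Delta>. (\<Delta> \<tturnstile> \<phi>) \<or> (\<Delta> \<tturnstile> \<psi>))"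
  then show "\<Gamma> \<tturnstile> \<phi> \<^bold>\<or> \<psi>"
    using wt by (elim cov_forces) (auto simp: forces_def has_type_iff_infer intro: d_disjI1 d_disjI2)
qed

text \<open>In the encoding, the empty family covers exactly those contexts from which every formula
  is derivable.\<close>

lemma forces_bot: "(\<Gamma> \<tturnstile> \<^bold>\<bottom>) \<longleftrightarrow> cov \<Gamma> (\<lambda>_. False)"
proof
  assume "\<Gamma> \<tturnstile> \<^bold>\<bottom>"
  then show "cov \<Gamma> (\<lambda>_. False)"
    using forces_mono[of \<Gamma> "\<^bold>\<bottom>"] unfolding cov_def forces_def by (blast intro: d_botE)
qed (auto elim!: cov_forces simp: has_type_iff_infer)

section \<open>Equality and conversion\<close>

lemma forces_eq_refl: "wt t T \<Longrightarrow> \<Gamma> \<tturnstile> t \<^bold>=\<^bsub>T\<^esub> t"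
  by (simp add: forces_def d_refl)

lemma forces_eq_wt: "\<Gamma> \<tturnstile> s \<^bold>=\<^bsub>T\<^esub> t \<Longrightarrow> wt s T \<and> wt t T"
  by (drule forces_wt) (auto simp: has_type_iff_infer split: option.splits if_splits ty.splits)

lemma forces_cong: "\<Gamma> \<tturnstile> f \<^bold>=\<^bsub>S \<^bold>\<Rightarrow> T\<^esub> g \<Longrightarrow> \<Gamma> \<tturnstile> s \<^bold>=\<^bsub>S\<^esub> t \<Longrightarrow> \<Gamma> \<tturnstile> f \<bullet> s \<^bold>=\<^bsub>T\<^esub> g \<bullet> t"
  unfolding forces_def by (rule d_cong)

lemma forces_app_cong: "\<Gamma> \<tturnstile> s \<^bold>=\<^bsub>S\<^esub> t \<Longrightarrow> wt f (S \<^bold>\<Rightarrow> T) \<Longrightarrow> \<Gamma> \<tturnstile> f \<bullet> s \<^bold>=\<^bsub>T\<^esub> f \<bullet> t"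
  by (blast intro: forces_cong forces_eq_refl)

lemma forces_eq_mp: "\<Gamma> \<tturnstile> \<phi> \<^bold>=\<^bsub>Omega\<^esub> \<psi> \<Longrightarrow> \<Gamma> \<tturnstile> \<phi> \<Longrightarrow> \<Gamma> \<tturnstile> \<psi>"
  unfolding forces_def by (rule d_eq_mp)

text \<open>Congruence turns the proposition that \<open>s\<close> equals \<open>s\<close> into the
  one that \<open>t\<close> equals \<open>s\<close>, and transport along equal propositions does the
  rest. Transitivity arises in the same way from rewriting the right-hand side.\<close>

lemma forces_eq_sym:
  assumes "\<Gamma> \<tturnstile> s \<^bold>=\<^bsub>T\<^esub> t"
  shows "\<Gamma> \<tturnstile> t \<^bold>=\<^bsub>T\<^esub> s"
proof -
  have "\<Gamma> \<tturnstile> (Cn (EqC T) \<bullet> s \<bullet> s) \<^bold>=\<^bsub>Omega\<^esub> (Cn (EqC T) \<bullet> t \<bullet> s)"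
    using forces_eq_wt[OF assms]
    by (intro forces_cong[OF forces_app_cong[OF assms]] forces_eq_refl)
      (auto simp: has_type_iff_infer)
  then show ?thesis
    using forces_eq_wt[OF assms] by (blast intro: forces_eq_mp forces_eq_refl)
qed

lemma forces_eq_trans:
  assumes "\<Gamma> \<tturnstile> s \<^bold>=\<^bsub>T\<^esub> t" "\<Gamma> \<tturnstile> t \<^bold>=\<^bsub>T\<^esub> u"
  shows "\<Gamma> \<tturnstile> s \<^bold>=\<^bsub>T\<^esub> u"
proof -
  have "\<Gamma> \<tturnstile> (Cn (EqC T) \<bullet> s \<bullet> t) \<^bold>=\<^bsub>Omega\<^esub> (Cn (EqC T) \<bullet> s \<bullet> u)"
    using forces_eq_wt[OF assms(1)]
    by (intro forces_app_cong[OF assms(2)]) (simp add: has_type_iff_infer)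
  then show ?thesis
    using assms(1) by (rule forces_eq_mp)
qed

lemma forces_eq_iff: "\<Gamma> \<tturnstile> \<phi> \<^bold>=\<^bsub>Omega\<^esub> \<psi> \<Longrightarrow> (\<Gamma> \<tturnstile> \<phi>) \<longleftrightarrow> (\<Gamma> \<tturnstile> \<psi>)"
  by (blast intro: forces_eq_mp forces_eq_sym)

lemma forces_subst: "\<Gamma> \<tturnstile> s \<^bold>=\<^bsub>T\<^esub> t \<Longrightarrow> wt p (PowT T) \<Longrightarrow> (\<Gamma> \<tturnstile> p \<bullet> s) \<longleftrightarrow> (\<Gamma> \<tturnstile> p \<bullet> t)"
  by (rule forces_eq_iff, rule forces_app_cong)

lemma forces_beta_eq: "wt (Abs S b) (S \<^bold>\<Rightarrow> T) \<Longrightarrow> wt t S \<Longrightarrow> \<Gamma> \<tturnstile> Abs S b \<bullet> t \<^bold>=\<^bsub>T\<^esub> opn 0 t b"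
  unfolding forces_def by (rule d_beta)

lemma forces_beta: "wt (Abs S b) (PowT S) \<Longrightarrow> wt t S \<Longrightarrow> (\<Gamma> \<tturnstile> Abs S b \<bullet> t) \<longleftrightarrow> (\<Gamma> \<tturnstile> opn 0 t b)"
  by (rule forces_eq_iff, rule forces_beta_eq)

lemma forces_beta2_eq:
  assumes "wt (Abs S (Abs S' b)) (S \<^bold>\<Rightarrow> S' \<^bold>\<Rightarrow> T)" "wt s S" "wt t S'"
  shows "\<Gamma> \<tturnstile> Abs S (Abs S' b) \<bullet> s \<bullet> t \<^bold>=\<^bsub>T\<^esub> opn 0 t (opn 1 s b)"
proof -
  have 1: "\<Gamma> \<tturnstile> Abs S (Abs S' b) \<bullet> s \<^bold>=\<^bsub>S' \<^bold>\<Rightarrow> T\<^esub> Abs S' (opn 1 s b)"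
    using forces_beta_eq[OF assms(1,2)] by simp
  then have 2: "\<Gamma> \<tturnstile> Abs S' (opn 1 s b) \<bullet> t \<^bold>=\<^bsub>T\<^esub> opn 0 t (opn 1 s b)"
    by (intro forces_beta_eq assms) (blast dest: forces_eq_wt)
  show ?thesis
    using forces_cong[OF 1 forces_eq_refl[OF assms(3)]] 2 by (rule forces_eq_trans)
qed

lemma forces_beta2:
  assumes "wt (Abs S (Abs S' b)) (S \<^bold>\<Rightarrow> S' \<^bold>\<Rightarrow> Omega)" "wt s S" "wt t S'"
  shows "(\<Gamma> \<tturnstile> Abs S (Abs S' b) \<bullet> s \<bullet> t) \<longleftrightarrow> (\<Gamma> \<tturnstile> opn 0 t (opn 1 s b))"
  by (rule forces_eq_iff, rule forces_beta2_eq) (fact assms)+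

section \<open>Quantifiers and extensionality\<close>

lemma forces_all_app:
  assumes "wt p (PowT T)"
  shows "(\<Gamma> \<tturnstile> Cn (AllC T) \<bullet> p) \<longleftrightarrow> (\<forall>t. wt t T \<longrightarrow> (\<Gamma> \<tturnstile> p \<bullet> t))"
proof
  assume "\<forall>t. wt t T \<longrightarrow> (\<Gamma> \<tturnstile> p \<bullet> t)"
  moreover obtain x where "\<forall>t\<in>insert p (fset \<Gamma>). (x, T) \<notin> fv t"
    using ex_fresh[of "insert p (fset \<Gamma>)" T] by auto
  ultimately show "\<Gamma> \<tturnstile> Cn (AllC T) \<bullet> p"
    unfolding forces_def using assms by (auto intro!: d_allI[of _ p x] ty_Var)
qed (simp add: forces_def d_allE)

lemma forces_all:
  assumes "wt (Abs T b) (PowT T)"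
  shows "(\<Gamma> \<tturnstile> Cn (AllC T) \<bullet> Abs T b) \<longleftrightarrow> (\<forall>t. wt t T \<longrightarrow> (\<Gamma> \<tturnstile> opn 0 t b))"
  using forces_all_app[OF assms] forces_beta[OF assms] by simp

lemma forces_ex_app:
  assumes wt: "wt p (PowT T)"
  shows "(\<Gamma> \<tturnstile> Cn (ExC T) \<bullet> p) \<longleftrightarrow> cov \<Gamma> (\<lambda>\<Delta>. \<exists>t. wt t T \<and> (\<Delta> \<tturnstile> p \<bullet> t))"
proof
  assume ex: "\<Gamma> \<tturnstile> Cn (ExC T) \<bullet> p"
  show "cov \<Gamma> (\<lambda>\<Delta>. \<exists>t. wt t T \<and> (\<Delta> \<tturnstile> p \<bullet> t))"
    unfolding cov_def
  proof (intro allI impI)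
    fix \<Delta> \<chi>
    assume *: "\<Gamma> \<le> \<Delta>" "\<forall>\<Delta>'\<ge>\<Delta>. (\<exists>t. wt t T \<and> (\<Delta>' \<tturnstile> p \<bullet> t)) \<longrightarrow> \<Delta>' \<tturnstile> \<chi>"
    \<comment> \<open>The variable must also be fresh for \<chi>, as existential elimination does
      not let its witness occur in the conclusion.\<close>
    obtain x where x: "\<forall>t\<in>{p, \<chi>} \<union> fset \<Delta>. (x, T) \<notin> fv t"
      using ex_fresh[of "{p, \<chi>} \<union> fset \<Delta>" T] by auto
    have "finsert (p \<bullet> Var x T) \<Delta> \<tturnstile> \<chi>"
      using * forces_hyp[of "p \<bullet> Var x T"] wt
      by (meson fsubset_finsertI ty_App ty_Var)
    then show "\<Delta> \<tturnstile> \<chi>"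
      using forces_mono[OF ex *(1)] x by (auto simp: forces_def intro!: d_exE[of _ T p x])
  qed
next
  assume "cov \<Gamma> (\<lambda>\<Delta>. \<exists>t. wt t T \<and> (\<Delta> \<tturnstile> p \<bullet> t))"
  then show "\<Gamma> \<tturnstile> Cn (ExC T) \<bullet> p"
    using wt by (elim cov_forces) (auto simp: forces_def has_type_iff_infer intro: d_exI)
qed

lemma forces_ex:
  assumes "wt (Abs T b) (PowT T)"
  shows "(\<Gamma> \<tturnstile> Cn (ExC T) \<bullet> Abs T b) \<longleftrightarrow> cov \<Gamma> (\<lambda>\<Delta>. \<exists>t. wt t T \<and> (\<Delta> \<tturnstile> opn 0 t b))"
  using forces_ex_app[OF assms] forces_beta[OF assms] by (simp cong: conj_cong)

text \<open>Extensionality at a fresh variable reduces equality of predicates to equality of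
  propositions, and propositional extensionality reduces that to equivalence in all
  extensions.\<close>

lemma forces_set_eqI:
  assumes wt: "wt A (PowT T)" "wt B (PowT T)"
    and iff: "\<And>t \<Delta>. wt t T \<Longrightarrow> \<Gamma> \<le> \<Delta> \<Longrightarrow> (\<Delta> \<tturnstile> A \<bullet> t) \<longleftrightarrow> (\<Delta> \<tturnstile> B \<bullet> t)"
  shows "\<Gamma> \<tturnstile> A \<^bold>=\<^bsub>PowT T\<^esub> B"
proof -
  obtain x where x: "\<forall>t\<in>{A, B} \<union> fset \<Gamma>. (x, T) \<notin> fv t"
    using ex_fresh[of "{A, B} \<union> fset \<Gamma>" T] by auto
  have "\<Gamma> \<tturnstile> (A \<bullet> Var x T \<^bold>\<longleftrightarrow> B \<bullet> Var x T)"
    using wt by (simp add: forces_conj forces_imp ty_App ty_Var has_type_iff_infer)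
      (simp add: iff ty_Var)
  then show ?thesis
    using x wt unfolding forces_def by (auto intro!: d_fun_ext[where f = A and x = x] d_prop_ext)
qed


lemma forces_ax: "\<phi> \<in> axs \<Longrightarrow> \<Gamma> \<tturnstile> \<phi>"
  by (simp add: forces_def d_ax)

text \<open>A form of \<open>wt\<close> that the simplifier can use for terms below binders.\<close>

lemma wt_iff: "wt t T \<longleftrightarrow> (\<forall>\<Delta>. infer \<Delta> t = Some T) \<and> (\<forall>k u. opn k u t = t)"
  using wtD[of t T] by (metis has_type_iff_infer)

text \<open>Once \<open>wt\<close> is unfolded to \<open>infer\<close>, the type of the
  instantiating term would be known in the empty typing context only. This form tells the simplifier
  how the term behaves below further binders.\<close>

lemma forces_all':
  assumes "wt (Abs T b) (PowT T)"
  shows "(\<Gamma> \<tturnstile> Cn (AllC T) \<bullet> Abs T b) \<longleftrightarrow>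
    (\<forall>t. (\<forall>\<Delta>. infer \<Delta> t = Some T) \<and> (\<forall>k u. opn k u t = t) \<longrightarrow> (\<Gamma> \<tturnstile> opn 0 t b))"
  using forces_all[OF assms] unfolding wt_iff[of _ T] .



section \<open>The ordered ring of rational terms\<close>

lemmas forces_simps = forces_conj forces_imp forces_disj forces_all' forces_bot
  lam_def has_type_iff_infer

section \<open>Rational terms modulo provable equality\<close>

lemma rat_ring_axioms:
  assumes wt: "wt a RatT" "wt b RatT" "wt c RatT"
  shows "\<Gamma> \<tturnstile> (a \<^bold>+ b) \<^bold>+ c \<^bold>=\<^bsub>RatT\<^esub> a \<^bold>+ (b \<^bold>+ c)"
    and "\<Gamma> \<tturnstile> a \<^bold>+ b \<^bold>=\<^bsub>RatT\<^esub> b \<^bold>+ a"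
    and "\<Gamma> \<tturnstile> \<^bold>0 \<^bold>+ a \<^bold>=\<^bsub>RatT\<^esub> a"
    and "\<Gamma> \<tturnstile> a \<^bold>+ qneg a \<^bold>=\<^bsub>RatT\<^esub> \<^bold>0"
    and "\<Gamma> \<tturnstile> (a \<^bold>* b) \<^bold>* c \<^bold>=\<^bsub>RatT\<^esub> a \<^bold>* (b \<^bold>* c)"
    and "\<Gamma> \<tturnstile> a \<^bold>* b \<^bold>=\<^bsub>RatT\<^esub> b \<^bold>* a"
    and "\<Gamma> \<tturnstile> \<^bold>1 \<^bold>* a \<^bold>=\<^bsub>RatT\<^esub> a"
    and "\<Gamma> \<tturnstile> a \<^bold>* (b \<^bold>+ c) \<^bold>=\<^bsub>RatT\<^esub> a \<^bold>* b \<^bold>+ a \<^bold>* c"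
  using forces_ax[OF ax_add_assoc] forces_ax[OF ax_add_comm] forces_ax[OF ax_add_zero]
    forces_ax[OF ax_add_neg] forces_ax[OF ax_mul_assoc] forces_ax[OF ax_mul_comm]
    forces_ax[OF ax_mul_one] forces_ax[OF ax_distrib] wt[unfolded wt_iff]
  by (simp_all add: forces_simps)

lemma rat_cong:
  assumes "\<Gamma> \<tturnstile> a \<^bold>=\<^bsub>RatT\<^esub> a'" "\<Gamma> \<tturnstile> b \<^bold>=\<^bsub>RatT\<^esub> b'"
  shows "\<Gamma> \<tturnstile> a \<^bold>+ b \<^bold>=\<^bsub>RatT\<^esub> a' \<^bold>+ b'"
    and "\<Gamma> \<tturnstile> a \<^bold>* b \<^bold>=\<^bsub>RatT\<^esub> a' \<^bold>* b'"
    and "\<Gamma> \<tturnstile> qneg a \<^bold>=\<^bsub>RatT\<^esub> qneg a'"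
  by (rule forces_cong[OF forces_app_cong[OF assms(1)] assms(2)] forces_app_cong[OF assms(1)];
      simp add: has_type_iff_infer)+

text \<open>
  Provable equality makes the rational terms a commutative ring, in which identities can be checked by
  rewriting. It is not an instance of \<open>comm_ring_1\<close>, as \<open>0 \<noteq> 1\<close> would state that
  the object logic is consistent.
\<close>

quotient_type rq = trm / partial: "\<lambda>s t. {||} \<tturnstile> s \<^bold>=\<^bsub>RatT\<^esub> t"
proof (rule part_equivpI)
  show "\<exists>t. {||} \<tturnstile> t \<^bold>=\<^bsub>RatT\<^esub> t"
    by (rule exI, rule forces_eq_refl[of qzero]) (simp add: has_type_iff_infer)
qed (rule sympI transpI, erule forces_eq_sym forces_eq_trans, assumption?)+

instantiation rq :: "{comm_ring, comm_monoid_mult}"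
begin

lift_definition zero_rq :: rq is qzero
  by (rule forces_eq_refl) (simp add: has_type_iff_infer)
lift_definition one_rq :: rq is qone
  by (rule forces_eq_refl) (simp add: has_type_iff_infer)
lift_definition plus_rq :: "rq \<Rightarrow> rq \<Rightarrow> rq" is qadd
  by (rule rat_cong)
lift_definition times_rq :: "rq \<Rightarrow> rq \<Rightarrow> rq" is qmul
  by (rule rat_cong)
lift_definition uminus_rq :: "rq \<Rightarrow> rq" is qneg
  by (rule rat_cong)
definition minus_rq :: "rq \<Rightarrow> rq \<Rightarrow> rq" where "minus_rq x y = x + - y"

instance
proof
  fix a b c :: rq
  show "a + b + c = a + (b + c)"
    by transfer (blast dest: forces_eq_wt intro: rat_ring_axioms)
  show "a + b = b + a"
    by transfer (blast dest: forces_eq_wt intro: rat_ring_axioms)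
  show "0 + a = a"
    by transfer (blast dest: forces_eq_wt intro: rat_ring_axioms)
  have "x + y = y + x" for x y :: rq
    by transfer (blast dest: forces_eq_wt intro: rat_ring_axioms)
  moreover have "a + - a = 0"
    by transfer (blast dest: forces_eq_wt intro: rat_ring_axioms)
  ultimately show "- a + a = 0"
    by simp
  show "a - b = a + - b"
    by (rule minus_rq_def)
  show "a * b * c = a * (b * c)"
    by transfer (blast dest: forces_eq_wt intro: rat_ring_axioms)
  show "a * b = b * a"
    by transfer (blast dest: forces_eq_wt intro: rat_ring_axioms)
  show "1 * a = a"
    by transfer (blast dest: forces_eq_wt intro: rat_ring_axioms)
  have "c * (a + b) = c * a + c * b"
    by transfer (blast dest: forces_eq_wt intro: rat_ring_axioms)
  moreover have "x * y = y * x" for x y :: rq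
    by transfer (blast dest: forces_eq_wt intro: rat_ring_axioms)
  ultimately show "(a + b) * c = a * c + b * c"
    by metis
qed

end

text \<open>The quotient is partial: an ill-typed term is not provably equal to itself and so
  represents no class.\<close>

lemma wt_rep_rq: "wt (rep_rq x) RatT"
  using forces_eq_wt[OF Quotient3_rep_reflp[OF Quotient3_rq, of x]] by simp

lemmas rep_rq_simps [simp] = wtD[OF wt_rep_rq]

lemma forces_eq_rep_abs_rq: "wt t RatT \<Longrightarrow> \<Gamma> \<tturnstile> t \<^bold>=\<^bsub>RatT\<^esub> rep_rq (abs_rq t)"
  by (rule forces_mono[of "{||}"], rule rep_abs_rsp[OF Quotient3_rq forces_eq_refl]) auto

lemma abs_rep_rq [simp]: "abs_rq (rep_rq x) = x"
  by (rule Quotient3_abs_rep[OF Quotient3_rq])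

lemma abs_rq_eqI: "{||} \<tturnstile> s \<^bold>=\<^bsub>RatT\<^esub> t \<Longrightarrow> abs_rq s = abs_rq t"
  using Quotient3_rel[OF Quotient3_rq] forces_eq_wt forces_eq_refl by blast

lemma abs_rq_simps:
  "abs_rq \<^bold>0 = 0" "abs_rq \<^bold>1 = 1"
  "wt s RatT \<Longrightarrow> wt t RatT \<Longrightarrow> abs_rq (s \<^bold>+ t) = abs_rq s + abs_rq t"
  "wt s RatT \<Longrightarrow> wt t RatT \<Longrightarrow> abs_rq (s \<^bold>* t) = abs_rq s * abs_rq t"
  "wt s RatT \<Longrightarrow> abs_rq (qneg s) = - abs_rq s"
  by (simp_all add: zero_rq.abs_eq one_rq.abs_eq plus_rq.abs_eq times_rq.abs_eq uminus_rq.abs_eq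
      forces_eq_refl)

lemma forces_mem_abs_rq: "wt A (PowT RatT) \<Longrightarrow> wt t RatT \<Longrightarrow> (\<Gamma> \<tturnstile> A \<bullet> t) \<longleftrightarrow> (\<Gamma> \<tturnstile> A \<bullet> rep_rq (abs_rq t))"
  by (rule forces_subst[OF forces_eq_rep_abs_rq])

text \<open>Predicates respect provable equality, so each instance can be moved to the chosen
  representative of its class. Quantification over terms thus becomes quantification over elements
  of the ring.\<close>

lemma forces_all_rat:
  assumes "wt (Abs RatT b) (PowT RatT)"
  shows "(\<Gamma> \<tturnstile> Cn (AllC RatT) \<bullet> Abs RatT b) \<longleftrightarrow> (\<forall>x. \<Gamma> \<tturnstile> opn 0 (rep_rq x) b)"
  using forces_all[OF assms] forces_beta[OF assms] forces_mem_abs_rq[OF assms] wt_rep_rq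
  by metis

lemma forces_ex_rat:
  assumes "wt (Abs RatT b) (PowT RatT)"
  shows "(\<Gamma> \<tturnstile> Cn (ExC RatT) \<bullet> Abs RatT b) \<longleftrightarrow> cov \<Gamma> (\<lambda>\<Delta>. \<exists>x. \<Delta> \<tturnstile> opn 0 (rep_rq x) b)"
proof -
  have "(\<exists>t. wt t RatT \<and> (\<Delta> \<tturnstile> opn 0 t b)) \<longleftrightarrow> (\<exists>x. \<Delta> \<tturnstile> opn 0 (rep_rq x) b)" for \<Delta>
    using forces_beta[OF assms] forces_mem_abs_rq[OF assms] wt_rep_rq by metis
  then show ?thesis
    using forces_ex[OF assms] by simp
qed

section \<open>The order relative to a context\<close>

definition less_at :: "trm fset \<Rightarrow> rq \<Rightarrow> rq \<Rightarrow> bool"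
  where "less_at \<Gamma> x y \<longleftrightarrow> (\<Gamma> \<tturnstile> rep_rq x \<^bold>< rep_rq y)"

text \<open>Equality in \<open>rq\<close> means derivability without hypotheses. An equation that
  comes from a case distinction holds only in the extended context and needs this local
  form.\<close>

definition eq_at :: "trm fset \<Rightarrow> rq \<Rightarrow> rq \<Rightarrow> bool"
  where "eq_at \<Gamma> x y \<longleftrightarrow> (\<Gamma> \<tturnstile> rep_rq x \<^bold>=\<^bsub>RatT\<^esub> rep_rq y)"

definition not_at :: "trm fset \<Rightarrow> (trm fset \<Rightarrow> bool) \<Rightarrow> bool"
  where "not_at \<Gamma> P \<longleftrightarrow> (\<forall>\<Delta>\<ge>\<Gamma>. P \<Delta> \<longrightarrow> \<Delta> \<tturnstile> \<^bold>\<bottom>)"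

text \<open>
  As the order is decidable, the negation of the converse strict order is equivalent to the
  disjunction that the object logic uses (\<open>le_at_iff\<close>), and needs no covers.
\<close>

abbreviation le_at :: "trm fset \<Rightarrow> rq \<Rightarrow> rq \<Rightarrow> bool"
  where "le_at \<Gamma> x y \<equiv> not_at \<Gamma> (\<lambda>\<Delta>. less_at \<Delta> y x)"

lemma forces_less:
  assumes "wt s RatT" "wt t RatT"
  shows "(\<Gamma> \<tturnstile> s \<^bold>< t) \<longleftrightarrow> less_at \<Gamma> (abs_rq s) (abs_rq t)"
  unfolding less_at_def
  by (rule forces_eq_iff,
      rule forces_cong[OF forces_app_cong[OF forces_eq_rep_abs_rq[OF assms(1)]]
        forces_eq_rep_abs_rq[OF assms(2)]])
    (simp add: has_type_iff_infer)

lemma forces_rat_eq: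
  assumes "wt s RatT" "wt t RatT"
  shows "(\<Gamma> \<tturnstile> s \<^bold>=\<^bsub>RatT\<^esub> t) \<longleftrightarrow> eq_at \<Gamma> (abs_rq s) (abs_rq t)"
  unfolding eq_at_def
  by (rule forces_eq_iff,
      rule forces_cong[OF forces_app_cong[OF forces_eq_rep_abs_rq[OF assms(1)]]
        forces_eq_rep_abs_rq[OF assms(2)]])
    (simp add: has_type_iff_infer)

lemmas forces_rat_simps = forces_conj forces_imp forces_disj forces_all_rat forces_ex_rat
  forces_less forces_rat_eq abs_rq_simps lam_def has_type_iff_infer

lemma less_at_mono: "less_at \<Gamma> x y \<Longrightarrow> \<Gamma> \<le> \<Delta> \<Longrightarrow> less_at \<Delta> x y"
  unfolding less_at_def by (rule forces_mono)

lemma eq_at_mono: "eq_at \<Gamma> x y \<Longrightarrow> \<Gamma> \<le> \<Delta> \<Longrightarrow> eq_at \<Delta> x y"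
  unfolding eq_at_def by (rule forces_mono)

lemma not_at_mono: "not_at \<Gamma> P \<Longrightarrow> \<Gamma> \<le> \<Delta> \<Longrightarrow> not_at \<Delta> P"
  unfolding not_at_def by (meson order.trans)

lemma not_atI: "(\<And>\<Delta>. \<Gamma> \<le> \<Delta> \<Longrightarrow> P \<Delta> \<Longrightarrow> \<Delta> \<tturnstile> \<^bold>\<bottom>) \<Longrightarrow> not_at \<Gamma> P"
  unfolding not_at_def by blast

lemma not_atD: "not_at \<Gamma> P \<Longrightarrow> P \<Gamma> \<Longrightarrow> \<Gamma> \<tturnstile> \<^bold>\<bottom>"
  unfolding not_at_def by blast

lemma less_at_irrefl: "less_at \<Gamma> x x \<Longrightarrow> \<Gamma> \<tturnstile> \<^bold>\<bottom>"
  using forces_ax[OF ax_less_irrefl] by (simp add: forces_rat_simps) blast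

lemma less_at_trans: "less_at \<Gamma> x y \<Longrightarrow> less_at \<Gamma> y z \<Longrightarrow> less_at \<Gamma> x z"
  using forces_ax[OF ax_less_trans] by (simp add: forces_rat_simps) blast

lemma less_at_add: "less_at \<Gamma> x y \<Longrightarrow> less_at \<Gamma> (x + z) (y + z)"
  using forces_ax[OF ax_less_add] by (simp add: forces_rat_simps) blast

lemma less_at_mult: "less_at \<Gamma> 0 x \<Longrightarrow> less_at \<Gamma> 0 y \<Longrightarrow> less_at \<Gamma> 0 (x * y)"
  using forces_ax[OF ax_less_mul] by (simp add: forces_rat_simps) blast

lemma zero_less_one_at: "less_at \<Gamma> 0 1"
  using forces_ax[OF ax_zero_less_one] by (simp add: forces_rat_simps)

lemma less_at_total: "cov \<Gamma> (\<lambda>\<Delta>. less_at \<Delta> x y \<or> eq_at \<Delta> x y \<or> less_at \<Delta> y x)"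
proof -
  have "cov \<Gamma> (\<lambda>\<Delta>. less_at \<Delta> x y \<or> cov \<Delta> (\<lambda>\<Delta>. eq_at \<Delta> x y \<or> less_at \<Delta> y x))"
    using forces_ax[OF ax_less_total] by (simp add: forces_rat_simps)
  then show ?thesis
    by (rule cov_bind) (auto intro: covI less_at_mono elim: cov_weaken)
qed

lemma forces_botE: "\<Gamma> \<tturnstile> \<^bold>\<bottom> \<Longrightarrow> wt \<phi> Omega \<Longrightarrow> \<Gamma> \<tturnstile> \<phi>"
  unfolding forces_def by (rule d_botE)

lemma less_at_botE: "\<Gamma> \<tturnstile> \<^bold>\<bottom> \<Longrightarrow> less_at \<Gamma> x y"
  unfolding less_at_def by (erule forces_botE) (simp add: has_type_iff_infer)

lemma cov_botE: "\<Gamma> \<tturnstile> \<^bold>\<bottom> \<Longrightarrow> cov \<Gamma> P"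
  unfolding forces_bot by (erule cov_weaken) simp

lemma less_at_cov: "cov \<Gamma> (\<lambda>\<Delta>. less_at \<Delta> x y) \<Longrightarrow> less_at \<Gamma> x y"
  unfolding less_at_def by (erule cov_forces) (simp_all add: has_type_iff_infer)

lemma bot_cov: "cov \<Gamma> (\<lambda>\<Delta>. \<Delta> \<tturnstile> \<^bold>\<bottom>) \<Longrightarrow> \<Gamma> \<tturnstile> \<^bold>\<bottom>"
  by (erule cov_forces) (simp_all add: has_type_iff_infer)

lemma eq_at_sym: "eq_at \<Gamma> x y \<Longrightarrow> eq_at \<Gamma> y x"
  unfolding eq_at_def by (rule forces_eq_sym)

text \<open>Without hypotheses, local equality is the quotient relation itself. Facts about
  constants such as \<open>half\<close> thereby become equations usable for rewriting.\<close>

lemma eq_at_empty: "eq_at {||} x y \<Longrightarrow> x = y"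
  unfolding eq_at_def using abs_rq_eqI by fastforce

lemma eq_at_less:
  assumes "eq_at \<Gamma> x x'" "eq_at \<Gamma> y y'"
  shows "less_at \<Gamma> x y \<longleftrightarrow> less_at \<Gamma> x' y'"
  unfolding less_at_def using assms unfolding eq_at_def
  by (intro forces_eq_iff, intro forces_cong[OF forces_app_cong])
    (assumption | simp add: has_type_iff_infer)+

lemma eq_at_refl: "eq_at \<Gamma> x x"
  unfolding eq_at_def by (rule forces_eq_refl[OF wt_rep_rq])

lemma eq_at_mult:
  assumes "eq_at \<Gamma> x x'" "eq_at \<Gamma> y y'"
  shows "eq_at \<Gamma> (x * y) (x' * y')"
  using rat_cong(2)[OF assms[unfolded eq_at_def]]
  by (simp add: forces_rat_eq abs_rq_simps has_type_iff_infer)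

lemma eq_at_le: "eq_at \<Gamma> x y \<Longrightarrow> le_at \<Gamma> x y"
  by (rule not_atI) (metis eq_at_less eq_at_mono eq_at_refl less_at_irrefl)

lemma less_at_le: "less_at \<Gamma> x y \<Longrightarrow> le_at \<Gamma> x y"
  by (rule not_atI) (metis less_at_mono less_at_irrefl less_at_trans)

lemma le_at_iff: "cov \<Gamma> (\<lambda>\<Delta>. less_at \<Delta> x y \<or> eq_at \<Delta> x y) \<longleftrightarrow> le_at \<Gamma> x y"
proof
  assume "cov \<Gamma> (\<lambda>\<Delta>. less_at \<Delta> x y \<or> eq_at \<Delta> x y)"
  then have "cov \<Delta> (\<lambda>\<Delta>. le_at \<Delta> x y)" if "\<Gamma> \<le> \<Delta>" for \<Delta>
    using that by (blast intro: cov_weaken cov_mono eq_at_le less_at_le)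
  then show "le_at \<Gamma> x y"
    by (blast intro: not_atI bot_cov cov_weaken not_atD less_at_mono)
next
  assume "le_at \<Gamma> x y"
  then show "cov \<Gamma> (\<lambda>\<Delta>. less_at \<Delta> x y \<or> eq_at \<Delta> x y)"
    using less_at_total[of \<Gamma> x y]
    by (elim cov_bind)
      (auto intro: covI cov_botE less_at_mono eq_at_mono dest: not_at_mono not_atD)
qed

lemma less_or_le_at: "cov \<Gamma> (\<lambda>\<Delta>. less_at \<Delta> x y \<or> le_at \<Delta> y x)"
  by (rule cov_weaken[OF less_at_total[of \<Gamma> x y]])
    (auto intro: less_at_le eq_at_le eq_at_sym)

text \<open>Translation by \<open>x - a\<close> shows that a strict inequality depends only on the
  difference of its sides, so rearranging one amounts to checking a ring identity.\<close>

lemma less_at_shift: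
  assumes "less_at \<Gamma> a b" "y - x = b - a"
  shows "less_at \<Gamma> x y"
proof -
  have "b + (x - a) = (b - a) + x"
    by (simp add: algebra_simps)
  also have "\<dots> = y"
    unfolding assms(2)[symmetric] by simp
  finally show ?thesis
    using less_at_add[OF assms(1), of "x - a"] by simp
qed

lemma less_at_iff_diff: "less_at \<Gamma> x y \<longleftrightarrow> less_at \<Gamma> 0 (y - x)"
  by (auto elim: less_at_shift)

lemma le_at_iff_diff: "le_at \<Gamma> x y \<longleftrightarrow> le_at \<Gamma> 0 (y - x)"
proof -
  have "less_at \<Delta> y x \<longleftrightarrow> less_at \<Delta> (y - x) 0" for \<Delta>
    by (auto elim: less_at_shift)
  then show ?thesis
    by simp
qed

lemma pos_add: "less_at \<Gamma> 0 x \<Longrightarrow> less_at \<Gamma> 0 y \<Longrightarrow> less_at \<Gamma> 0 (x + y)"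
  using less_at_add[of \<Gamma> 0 x y] less_at_trans by fastforce

lemma le_less_at_trans: "le_at \<Gamma> x y \<Longrightarrow> less_at \<Gamma> y z \<Longrightarrow> less_at \<Gamma> x z"
  unfolding le_at_iff[symmetric]
  by (rule less_at_cov, erule cov_weaken)
    (metis eq_at_less eq_at_refl less_at_mono less_at_trans)

lemma pos_add_nonneg: "less_at \<Gamma> 0 x \<Longrightarrow> le_at \<Gamma> 0 y \<Longrightarrow> less_at \<Gamma> 0 (x + y)"
  using le_less_at_trans[of \<Gamma> y 0 "x + y"] less_at_add[of \<Gamma> 0 x y] by simp

lemma nonneg_add:
  assumes "le_at \<Gamma> 0 x" "le_at \<Gamma> 0 y"
  shows "le_at \<Gamma> 0 (x + y)"
proof (rule not_atI)
  fix \<Delta>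
  assume \<Delta>: "\<Gamma> \<le> \<Delta>" "less_at \<Delta> (x + y) 0"
  then have "less_at \<Delta> 0 (- (x + y) + x)"
    by (intro pos_add_nonneg not_at_mono[OF assms(1)]) (auto elim: less_at_shift)
  then show "\<Delta> \<tturnstile> \<^bold>\<bottom>"
    using not_atD[OF not_at_mono[OF assms(2) \<Delta>(1)]] less_at_shift by fastforce
qed

lemma bot_covE: "cov \<Gamma> P \<Longrightarrow> (\<And>\<Delta>. \<Gamma> \<le> \<Delta> \<Longrightarrow> P \<Delta> \<Longrightarrow> \<Delta> \<tturnstile> \<^bold>\<bottom>) \<Longrightarrow> \<Gamma> \<tturnstile> \<^bold>\<bottom>"
  by (erule cov_forces) (simp_all add: has_type_iff_infer)

text \<open>Each factor is split into positive and zero, which is allowed because the goal is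
  falsity. A zero factor makes the product locally zero, two positive ones make it positive; either
  contradicts a negative product.\<close>

lemma nonneg_mult:
  assumes "le_at \<Gamma> 0 x" "le_at \<Gamma> 0 y"
  shows "le_at \<Gamma> 0 (x * y)"
proof (rule not_atI)
  fix \<Delta>
  assume \<Delta>: "\<Gamma> \<le> \<Delta>" "less_at \<Delta> (x * y) 0"
  have zero: "\<Delta>' \<tturnstile> \<^bold>\<bottom>" if "\<Delta> \<le> \<Delta>'" "eq_at \<Delta>' 0 x \<or> eq_at \<Delta>' 0 y" for \<Delta>'
    using eq_at_mult[of \<Delta>' 0 x y y] eq_at_mult[of \<Delta>' x x 0 y] eq_at_refl that
      eq_at_le[of \<Delta>' 0 "x * y"] not_atD less_at_mono[OF \<Delta>(2)] by auto
  have "cov \<Delta> (\<lambda>\<Delta>. less_at \<Delta> 0 x \<or> eq_at \<Delta> 0 x)"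
    using not_at_mono[OF assms(1) \<Delta>(1)] by (simp add: le_at_iff)
  then show "\<Delta> \<tturnstile> \<^bold>\<bottom>"
  proof (rule bot_covE)
    fix \<Delta>'
    assume \<Delta>': "\<Delta> \<le> \<Delta>'" "less_at \<Delta>' 0 x \<or> eq_at \<Delta>' 0 x"
    then have "cov \<Delta>' (\<lambda>\<Delta>. less_at \<Delta> 0 y \<or> eq_at \<Delta> 0 y)"
      using not_at_mono[OF assms(2)] \<Delta>(1) by (simp add: le_at_iff)
    then show "\<Delta>' \<tturnstile> \<^bold>\<bottom>"
    proof (rule bot_covE)
      fix \<Delta>''
      assume \<Delta>'': "\<Delta>' \<le> \<Delta>''" "less_at \<Delta>'' 0 y \<or> eq_at \<Delta>'' 0 y"
      then show "\<Delta>'' \<tturnstile> \<^bold>\<bottom>"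
        using \<Delta>' zero[of \<Delta>''] less_at_mult[of \<Delta>'' x y] less_at_irrefl less_at_mono[of \<Delta>' _ _ \<Delta>'']
          eq_at_mono[of \<Delta>' _ _ \<Delta>''] less_at_mono[OF \<Delta>(2), of \<Delta>''] less_at_trans order.trans
        by metis
    qed
  qed
qed

lemma eq_at_nonneg: "eq_at \<Gamma> x y \<Longrightarrow> le_at \<Gamma> 0 (y - x)"
  using eq_at_le le_at_iff_diff by blast

lemma zero_less_two_at: "less_at \<Gamma> 0 (1 + 1)"
  by (intro pos_add zero_less_one_at)

definition inv_rq :: "rq \<Rightarrow> rq"
  where "inv_rq x = abs_rq (qinv (rep_rq x))"

text \<open>Positivity refutes equality with zero, which is the guard of the inverse axiom. The
  guard is discharged only under the hypotheses of \<Gamma>, hence the local equality.\<close>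

lemma inv_rq_at:
  assumes "less_at \<Gamma> 0 x"
  shows "eq_at \<Gamma> (x * inv_rq x) 1"
proof -
  have "not_at \<Gamma> (\<lambda>\<Delta>. eq_at \<Delta> x 0)"
    using assms by (blast intro: not_atI not_atD less_at_mono eq_at_le)
  moreover have "not_at \<Delta> (\<lambda>\<Delta>. eq_at \<Delta> x 0) \<longrightarrow> eq_at \<Delta> (x * inv_rq x) 1" for \<Delta>
    using forces_ax[OF ax_inv, of \<Delta>]
    by (simp add: forces_rat_simps not_at_def inv_rq_def)
  ultimately show ?thesis
    by blast
qed

lemma inv_rq_pos:
  assumes "less_at \<Gamma> 0 x"
  shows "less_at \<Gamma> 0 (inv_rq x)"
proof -
  have "less_at \<Delta> 0 (inv_rq x)" if "\<Gamma> \<le> \<Delta>" "le_at \<Delta> (inv_rq x) 0" for \<Delta>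
  proof (rule less_at_botE)
    have "le_at \<Delta> 0 (x * (- inv_rq x))"
      using that assms le_at_iff_diff[of \<Delta> 0 "inv_rq x"]
      by (intro nonneg_mult) (auto intro: less_at_le less_at_mono)
    moreover have "le_at \<Delta> 0 (x * inv_rq x - 1)"
      by (rule eq_at_nonneg[OF eq_at_sym[OF eq_at_mono[OF inv_rq_at[OF assms] that(1)]]])
    \<comment> \<open>The summands cancel to \<open>0\<close>, which would thus be positive. The
      last one corrects for the inverse equation being merely local. Later refutations use sums of
      the same kind.\<close>
    ultimately have "less_at \<Delta> 0 (1 + (x * (- inv_rq x)) + (x * inv_rq x - 1))"
      by (intro pos_add_nonneg zero_less_one_at)
    then show "\<Delta> \<tturnstile> \<^bold>\<bottom>"
      by (auto intro: less_at_irrefl simp: algebra_simps)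
  qed
  then show ?thesis
    by (intro less_at_cov[OF cov_weaken[OF less_or_le_at[of \<Gamma> 0 "inv_rq x"]]]) blast
qed

definition half :: rq
  where "half = inv_rq (1 + 1)"

lemma half_pos: "less_at \<Gamma> 0 half"
  unfolding half_def by (intro inv_rq_pos zero_less_two_at)

text \<open>Two is positive without hypotheses, so its inverse equation holds in the ring
  itself.\<close>

lemma add_half: "x * half + x * half = x"
proof -
  have "(1 + 1) * half = 1"
    unfolding half_def by (intro eq_at_empty inv_rq_at zero_less_two_at)
  then show ?thesis
    by (metis distrib_left distrib_right mult.assoc mult.commute mult_1)
qed

lemma less_at_dense:
  assumes "less_at \<Gamma> x y"
  shows "less_at \<Gamma> x ((x + y) * half)" "less_at \<Gamma> ((x + y) * half) y"
proof -
  have pos: "less_at \<Gamma> 0 ((y - x) * half)"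
    using assms less_at_iff_diff by (intro less_at_mult half_pos) blast
  \<comment> \<open>Each endpoint is written as a sum of two halves, so that only ring laws are
    needed; \<open>add_half\<close> restores it afterwards.\<close>
  have "(x + y) * half - (x * half + x * half) = (y - x) * half"
    "(y * half + y * half) - (x + y) * half = (y - x) * half"
    by (simp_all add: algebra_simps)
  then show "less_at \<Gamma> x ((x + y) * half)" "less_at \<Gamma> ((x + y) * half) y"
    unfolding add_half by (auto intro: less_at_shift[OF pos])
qed


section \<open>Natural numbers and the Archimedean property\<close>

lemma forces_ex':
  assumes "wt (Abs T b) (PowT T)"
  shows "(\<Gamma> \<tturnstile> Cn (ExC T) \<bullet> Abs T b) \<longleftrightarrow>
    cov \<Gamma> (\<lambda>\<Delta>. \<exists>t. ((\<forall>\<Delta>. infer \<Delta> t = Some T) \<and> (\<forall>k u. opn k u t = t)) \<and> (\<Delta> \<tturnstile> opn 0 t b))"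
  using forces_ex[OF assms] unfolding wt_iff[of _ T] .

section \<open>Recursion and induction in the object logic\<close>

lemma forces_rec:
  assumes "wt a T" "wt f (NatT \<^bold>\<Rightarrow> T \<^bold>\<Rightarrow> T)"
  shows "\<Gamma> \<tturnstile> Cn (RecC T) \<bullet> a \<bullet> f \<bullet> Cn ZeroC \<^bold>=\<^bsub>T\<^esub> a"
    and "wt n NatT \<Longrightarrow> \<Gamma> \<tturnstile> Cn (RecC T) \<bullet> a \<bullet> f \<bullet> nsuc n \<^bold>=\<^bsub>T\<^esub> f \<bullet> n \<bullet> (Cn (RecC T) \<bullet> a \<bullet> f \<bullet> n)"
  using forces_ax[OF ax_rec_zero[of T]] forces_ax[OF ax_rec_suc[of T]] assms
  unfolding wt_iff by (simp_all add: forces_simps)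

text \<open>The predicate has to be a term of the object logic. The successor step ranges over
  extensions because the induction axiom has it as an implication.\<close>

lemma forces_nat_induct:
  assumes wt: "wt (Abs NatT b) (PowT NatT)" "wt n NatT"
    and zero: "\<Gamma> \<tturnstile> opn 0 (Cn ZeroC) b"
    and suc: "\<And>m \<Delta>. \<Gamma> \<le> \<Delta> \<Longrightarrow> wt m NatT \<Longrightarrow> \<Delta> \<tturnstile> opn 0 m b \<Longrightarrow> \<Delta> \<tturnstile> opn 0 (nsuc m) b"
  shows "\<Gamma> \<tturnstile> opn 0 n b"
proof -
  define p where "p = Abs NatT b"
  have p: "infer \<Delta> p = Some (PowT NatT)" "opn k u p = p" for \<Delta> k u
    unfolding p_def by (rule wtD[OF wt(1)])+
  have ax: "\<Gamma> \<tturnstile> (p \<bullet> Cn ZeroC \<^bold>\<and>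
      Cn (AllC NatT) \<bullet> Abs NatT (p \<bullet> Bnd 0 \<^bold>\<longrightarrow> p \<bullet> nsuc (Bnd 0)) \<^bold>\<longrightarrow>
      Cn (AllC NatT) \<bullet> Abs NatT (p \<bullet> Bnd 0))"
    using forces_ax[OF ax_induct, of \<Gamma>]
    by (simp add: lam_def forces_all[of "PowT NatT"] has_type_iff_infer p)
  have "\<Gamma> \<tturnstile> p \<bullet> Cn ZeroC"
    using zero wt by (simp add: p_def forces_beta has_type_iff_infer)
  moreover have "\<Gamma> \<tturnstile> Cn (AllC NatT) \<bullet> Abs NatT (p \<bullet> Bnd 0 \<^bold>\<longrightarrow> p \<bullet> nsuc (Bnd 0))"
  proof -
    have "\<Delta> \<tturnstile> p \<bullet> nsuc m" if "\<Gamma> \<le> \<Delta>" "wt m NatT" "\<Delta> \<tturnstile> p \<bullet> m" for m \<Delta>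
      using suc[OF that(1,2)] that(2,3) wt(1) unfolding p_def
      by (simp add: forces_beta has_type_iff_infer)
    then show ?thesis
      by (simp add: forces_all forces_imp has_type_iff_infer p wt_iff) 
  qed
  ultimately have "\<Gamma> \<tturnstile> Cn (AllC NatT) \<bullet> Abs NatT (p \<bullet> Bnd 0)"
    using ax unfolding forces_def by (blast intro: d_impE d_conjI)
  then have "\<Gamma> \<tturnstile> p \<bullet> n"
    using wt(2) by (simp add: forces_all has_type_iff_infer p)
  then show ?thesis
    using wt by (simp add: p_def forces_beta)
qed

section \<open>Numerals and powers of one half\<close>

definition nat_rq :: "trm \<Rightarrow> rq"
  where "nat_rq n = abs_rq (nat_to_rat \<bullet> n)"

definition pow_rq :: "trm \<Rightarrow> rq"
  where "pow_rq n = abs_rq (two_pow_neg \<bullet> n)"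

lemma cls_nat_fun:
  "cls k x T nat_to_rat = nat_to_rat" "cls k x T two_pow_neg = two_pow_neg"
  by (simp_all add: nat_to_rat_def two_pow_neg_def lam_def)

lemmas nat_fun_simps [simp] = wtD[OF wt_nat_to_rat] wtD[OF wt_two_pow_neg] cls_nat_fun

lemma nat_rq_zero: "nat_rq (Cn ZeroC) = 0"
proof -
  have "{||} \<tturnstile> nat_to_rat \<bullet> Cn ZeroC \<^bold>=\<^bsub>RatT\<^esub> \<^bold>0"
    unfolding nat_to_rat_def by (rule forces_rec) (simp_all add: type_simps)
  then show ?thesis
    unfolding nat_rq_def by (simp add: abs_rq_eqI abs_rq_simps(1)[symmetric])
qed

lemma pow_rq_zero: "pow_rq (Cn ZeroC) = 1"
proof -
  have "{||} \<tturnstile> two_pow_neg \<bullet> Cn ZeroC \<^bold>=\<^bsub>RatT\<^esub> \<^bold>1"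
    unfolding two_pow_neg_def by (rule forces_rec) (simp_all add: type_simps)
  then show ?thesis
    unfolding pow_rq_def by (simp add: abs_rq_eqI abs_rq_simps(2)[symmetric])
qed

lemma nat_rq_suc:
  assumes "wt n NatT"
  shows "nat_rq (nsuc n) = nat_rq n + 1"
proof -
  let ?f = "Abs NatT (Abs RatT (Bnd 0 \<^bold>+ \<^bold>1))"
  have def: "nat_to_rat = Cn (RecC RatT) \<bullet> \<^bold>0 \<bullet> ?f"
    by (simp add: nat_to_rat_def lam_def)
  have "{||} \<tturnstile> nat_to_rat \<bullet> nsuc n \<^bold>=\<^bsub>RatT\<^esub> ?f \<bullet> n \<bullet> (nat_to_rat \<bullet> n)"
    unfolding def by (rule forces_rec) (simp_all add: type_simps assms[unfolded type_simps])
  moreover have "{||} \<tturnstile> ?f \<bullet> n \<bullet> (nat_to_rat \<bullet> n) \<^bold>=\<^bsub>RatT\<^esub> nat_to_rat \<bullet> n \<^bold>+ \<^bold>1"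
    using forces_beta2_eq[of NatT RatT "Bnd 0 \<^bold>+ \<^bold>1" RatT n "nat_to_rat \<bullet> n"] assms
    by (simp add: type_simps)
  ultimately show ?thesis
    using abs_rq_eqI[OF forces_eq_trans] assms
    by (simp add: nat_rq_def abs_rq_simps type_simps)
qed

lemma pow_rq_suc:
  assumes "wt n NatT"
  shows "pow_rq (nsuc n) = pow_rq n * half"
proof -
  let ?f = "Abs NatT (Abs RatT (Bnd 0 \<^bold>* qinv (\<^bold>1 \<^bold>+ \<^bold>1)))"
  have def: "two_pow_neg = Cn (RecC RatT) \<bullet> \<^bold>1 \<bullet> ?f"
    by (simp add: two_pow_neg_def lam_def)
  have "{||} \<tturnstile> two_pow_neg \<bullet> nsuc n \<^bold>=\<^bsub>RatT\<^esub> ?f \<bullet> n \<bullet> (two_pow_neg \<bullet> n)"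
    unfolding def by (rule forces_rec) (simp_all add: type_simps assms[unfolded type_simps])
  moreover have "{||} \<tturnstile> ?f \<bullet> n \<bullet> (two_pow_neg \<bullet> n) \<^bold>=\<^bsub>RatT\<^esub> two_pow_neg \<bullet> n \<^bold>* qinv (\<^bold>1 \<^bold>+ \<^bold>1)"
    using forces_beta2_eq[of NatT RatT "Bnd 0 \<^bold>* qinv (\<^bold>1 \<^bold>+ \<^bold>1)" RatT n "two_pow_neg \<bullet> n"] assms
    by (simp add: type_simps)
  \<comment> \<open>By definition \<open>half\<close> inverts the chosen representative of
    \<open>1 + 1\<close>, not this term; congruence identifies the two inverses.\<close>
  moreover have "abs_rq (qinv (\<^bold>1 \<^bold>+ \<^bold>1)) = half"
  proof -
    have "{||} \<tturnstile> \<^bold>1 \<^bold>+ \<^bold>1 \<^bold>=\<^bsub>RatT\<^esub> rep_rq (1 + 1)"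
      using forces_eq_rep_abs_rq[of "\<^bold>1 \<^bold>+ \<^bold>1"] by (simp add: abs_rq_simps type_simps)
    from forces_app_cong[OF this, of "Cn QInvC" RatT] show ?thesis
      unfolding half_def inv_rq_def by (intro abs_rq_eqI) (simp add: type_simps)
  qed
  ultimately show ?thesis
    using abs_rq_eqI[OF forces_eq_trans] assms
    by (simp add: pow_rq_def abs_rq_simps type_simps)
qed

lemma nat_rq_nonneg:
  assumes "wt n NatT"
  shows "le_at \<Gamma> 0 (nat_rq n)"
proof -
  have iff: "(\<Delta> \<tturnstile> \<^bold>0 \<^bold>\<le> nat_to_rat \<bullet> m) \<longleftrightarrow> le_at \<Delta> 0 (nat_rq m)" if "wt m NatT" for m \<Delta>
    using that by (simp add: forces_rat_simps nat_rq_def le_at_iff)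
  have "\<Gamma> \<tturnstile> opn 0 n (\<^bold>0 \<^bold>\<le> nat_to_rat \<bullet> Bnd 0)"
  proof (rule forces_nat_induct)
    fix m \<Delta>
    assume "wt m NatT" "\<Delta> \<tturnstile> opn 0 m (\<^bold>0 \<^bold>\<le> nat_to_rat \<bullet> Bnd 0)"
    then show "\<Delta> \<tturnstile> opn 0 (nsuc m) (\<^bold>0 \<^bold>\<le> nat_to_rat \<bullet> Bnd 0)"
      using iff[of m] iff[of "nsuc m"] nonneg_add less_at_le[OF zero_less_one_at]
      by (simp add: nat_rq_suc type_simps)
  next
    show "\<Gamma> \<tturnstile> opn 0 (Cn ZeroC) (\<^bold>0 \<^bold>\<le> nat_to_rat \<bullet> Bnd 0)"
      using iff[of "Cn ZeroC"] eq_at_le[OF eq_at_refl] by (simp add: nat_rq_zero type_simps)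
  qed (use assms in \<open>simp_all add: type_simps\<close>)
  then show ?thesis
    using iff[OF assms] by simp
qed

lemma pow_rq_pos:
  assumes "wt n NatT"
  shows "less_at \<Gamma> 0 (pow_rq n)"
proof -
  have iff: "(\<Delta> \<tturnstile> \<^bold>0 \<^bold>< two_pow_neg \<bullet> m) \<longleftrightarrow> less_at \<Delta> 0 (pow_rq m)" if "wt m NatT" for m \<Delta>
    using that by (simp add: forces_rat_simps pow_rq_def)
  have "\<Gamma> \<tturnstile> opn 0 n (\<^bold>0 \<^bold>< two_pow_neg \<bullet> Bnd 0)"
  proof (rule forces_nat_induct)
    fix m \<Delta>
    assume "wt m NatT" "\<Delta> \<tturnstile> opn 0 m (\<^bold>0 \<^bold>< two_pow_neg \<bullet> Bnd 0)"
    then show "\<Delta> \<tturnstile> opn 0 (nsuc m) (\<^bold>0 \<^bold>< two_pow_neg \<bullet> Bnd 0)"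
      using iff[of m] iff[of "nsuc m"] less_at_mult half_pos by (simp add: pow_rq_suc type_simps)
  next
    show "\<Gamma> \<tturnstile> opn 0 (Cn ZeroC) (\<^bold>0 \<^bold>< two_pow_neg \<bullet> Bnd 0)"
      using iff[of "Cn ZeroC"] zero_less_one_at by (simp add: pow_rq_zero type_simps)
  qed (use assms in \<open>simp_all add: type_simps\<close>)
  then show ?thesis
    using iff[OF assms] by simp
qed

text \<open>Since \<open>n + 2 \<le> 2 * (n + 1)\<close>, halving the power offsets the growth of
  the other factor, and the product never exceeds its value \<open>1\<close> at zero. The bound
  \<open>2\<close> leaves room for a strict inequality.\<close>

lemma nat_mult_pow_rq_less:
  assumes "wt n NatT"
  shows "less_at \<Gamma> ((nat_rq n + 1) * pow_rq n) (1 + 1)"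
proof -
  let ?b = "(nat_to_rat \<bullet> Bnd 0 \<^bold>+ \<^bold>1) \<^bold>* (two_pow_neg \<bullet> Bnd 0) \<^bold>< \<^bold>1 \<^bold>+ \<^bold>1"
  have iff: "(\<Delta> \<tturnstile> opn 0 m ?b) \<longleftrightarrow> less_at \<Delta> ((nat_rq m + 1) * pow_rq m) (1 + 1)"
    if "wt m NatT" for m \<Delta>
    using that by (simp add: forces_rat_simps pow_rq_def nat_rq_def)
  have "\<Gamma> \<tturnstile> opn 0 n ?b"
  proof (rule forces_nat_induct)
    fix m \<Delta>
    assume m: "wt m NatT" "\<Delta> \<tturnstile> opn 0 m ?b"
    \<comment> \<open>The slack in the induction hypothesis. Half of
      \<open>?d + ?d + nat_rq m * pow_rq m\<close> is exactly the slack at the successor.\<close>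
    let ?d = "1 + 1 - (nat_rq m + 1) * pow_rq m"
    have "less_at \<Delta> 0 ?d"
      using m iff less_at_iff_diff by blast
    moreover have "le_at \<Delta> 0 (nat_rq m * pow_rq m)"
      by (intro nonneg_mult nat_rq_nonneg less_at_le[OF pow_rq_pos] m)
    ultimately have "less_at \<Delta> 0 ((?d + ?d + nat_rq m * pow_rq m) * half)"
      by (intro less_at_mult half_pos pos_add_nonneg pos_add)
    moreover have "(?d + ?d + nat_rq m * pow_rq m) * half = ((1 + 1) * half + (1 + 1) * half)
        - (nat_rq m + 1 + 1) * (pow_rq m * half)"
      by (simp add: algebra_simps)
    ultimately have "less_at \<Delta> ((nat_rq m + 1 + 1) * (pow_rq m * half)) (1 + 1)"
      using less_at_iff_diff by (simp add: add_half)
    then show "\<Delta> \<tturnstile> opn 0 (nsuc m) ?b"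
      using iff[of "nsuc m"] m(1) by (simp add: nat_rq_suc pow_rq_suc type_simps)
  next
    show "\<Gamma> \<tturnstile> opn 0 (Cn ZeroC) ?b"
      using iff[of "Cn ZeroC"] less_at_add[OF zero_less_one_at, of \<Gamma> 1]
      by (simp add: nat_rq_zero pow_rq_zero type_simps)
  qed (use assms in \<open>simp_all add: type_simps\<close>)
  then show ?thesis
    using iff[OF assms] by simp
qed

section \<open>The Archimedean property\<close>

lemma rat_fraction:
  "cov \<Gamma> (\<lambda>\<Delta>. \<exists>m n k. wt m NatT \<and> wt n NatT \<and> wt k NatT \<and>
    eq_at \<Delta> (x * (nat_rq k + 1)) (nat_rq m - nat_rq n))"
proof -
  have "cov \<Gamma> (\<lambda>\<Delta>. \<exists>m. wt m NatT \<and> cov \<Delta> (\<lambda>\<Delta>. \<exists>n. wt n NatT \<and> cov \<Delta> (\<lambda>\<Delta>. \<exists>k. wt k NatT \<and>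
    eq_at \<Delta> (x * abs_rq (nat_to_rat \<bullet> nsuc k)) (nat_rq m - nat_rq n))))"
    using forces_ax[OF ax_fraction, of \<Gamma>] unfolding wt_iff
    by (simp add: forces_rat_simps forces_ex' nat_rq_def cong: conj_cong)
  then show ?thesis
    by (rule cov_bind)
      (elim exE conjE, erule cov_bind, elim exE conjE, erule cov_weaken, metis nat_rq_suc nat_rq_def)
qed

text \<open>Write \<open>x * (k + 1) = m - n\<close>. The bound is \<open>m + 1\<close>, for if it
  were at most \<open>x\<close>, then
  \<open>x * (k + 1) \<ge> x \<ge> m + 1 > m - n\<close>.\<close>

lemma archimedean_at: "cov \<Gamma> (\<lambda>\<Delta>. \<exists>n. wt n NatT \<and> less_at \<Delta> x (nat_rq n))"
proof (rule cov_bind[OF rat_fraction[of \<Gamma> x]], elim exE conjE)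
  fix \<Delta> m n k
  assume wt: "wt m NatT" "wt n NatT" "wt k NatT"
    and eq: "eq_at \<Delta> (x * (nat_rq k + 1)) (nat_rq m - nat_rq n)"
  have suc: "wt (nsuc m) NatT"
    using wt(1) by (simp add: type_simps)
  have absurd: "\<Delta>' \<tturnstile> \<^bold>\<bottom>" if \<Delta>': "\<Delta> \<le> \<Delta>'" "le_at \<Delta>' (nat_rq m + 1) x" for \<Delta>'
  proof -
    let ?x = "x - (nat_rq m + 1)"
    have x: "le_at \<Delta>' 0 ?x"
      using \<Delta>'(2) by (rule le_at_iff_diff[THEN iffD1])
    have d: "le_at \<Delta>' 0 (nat_rq m - nat_rq n - x * (nat_rq k + 1))"
      by (rule not_at_mono[OF eq_at_nonneg[OF eq] \<Delta>'(1)])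
    \<comment> \<open>The differences along this chain of estimates, together with \<open>1\<close>;
      they cancel to \<open>0\<close>.\<close>
    have "less_at \<Delta>' 0 (1 + (?x * nat_rq k + ?x + (nat_rq m + 1) * nat_rq k + nat_rq n
        + (nat_rq m - nat_rq n - x * (nat_rq k + 1))))"
      by (intro x d pos_add_nonneg nonneg_add nonneg_mult nat_rq_nonneg wt zero_less_one_at
          less_at_le[OF zero_less_one_at])
    moreover have "1 + (?x * nat_rq k + ?x + (nat_rq m + 1) * nat_rq k + nat_rq n
        + (nat_rq m - nat_rq n - x * (nat_rq k + 1))) = 0"
      by (simp add: algebra_simps)
    ultimately show ?thesis
      using less_at_irrefl by simp
  qed
  show "cov \<Delta> (\<lambda>\<Delta>. \<exists>n. wt n NatT \<and> less_at \<Delta> x (nat_rq n))"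
    by (rule cov_weaken[OF less_or_le_at[of \<Delta> x "nat_rq m + 1"]])
      (use suc absurd nat_rq_suc[OF wt(1)] less_at_botE in metis)
qed

text \<open>Bound \<open>x * inv_rq e\<close> by a numeral and multiply by \<open>e\<close>. The
  inverse equation holds only locally, so it enters as the nonnegative summand
  \<open>x * (e * inv_rq e) - x * 1\<close>.\<close>

lemma archimedean_mult_at:
  assumes "less_at \<Gamma> 0 e"
  shows "cov \<Gamma> (\<lambda>\<Delta>. \<exists>n. wt n NatT \<and> less_at \<Delta> x (nat_rq n * e))"
proof (rule cov_weaken[OF archimedean_at[of \<Gamma> "x * inv_rq e"]], elim exE conjE, intro exI conjI)
  fix \<Delta> n
  assume \<Delta>: "\<Gamma> \<le> \<Delta>" and less: "less_at \<Delta> (x * inv_rq e) (nat_rq n)"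
  have "le_at \<Delta> 0 (x * (e * inv_rq e) - x * 1)"
    by (intro eq_at_nonneg eq_at_mult eq_at_refl eq_at_sym[OF inv_rq_at] less_at_mono[OF assms \<Delta>])
  then have "less_at \<Delta> 0 ((nat_rq n - x * inv_rq e) * e + (x * (e * inv_rq e) - x * 1))"
    using less less_at_iff_diff
    by (intro pos_add_nonneg less_at_mult less_at_mono[OF assms \<Delta>]) blast+
  then show "less_at \<Delta> x (nat_rq n * e)"
    by (rule less_at_shift) (simp add: algebra_simps)
qed

text \<open>Choose \<open>n\<close> with \<open>2 < n * e\<close>. If \<open>e \<le> 2^-n\<close>,
  then \<open>2 < n * e \<le> n * 2^-n < (n + 1) * 2^-n < 2\<close>.\<close>

lemma pow_rq_small:
  assumes "less_at \<Gamma> 0 e"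
  shows "cov \<Gamma> (\<lambda>\<Delta>. \<exists>k. wt k NatT \<and> less_at \<Delta> (pow_rq k) e)"
proof (rule cov_bind[OF archimedean_mult_at[OF assms, of "1 + 1"]], elim exE conjE)
  fix \<Delta> n
  assume \<Delta>: "\<Gamma> \<le> \<Delta>" and n: "wt n NatT" "less_at \<Delta> (1 + 1) (nat_rq n * e)"
  have absurd: "\<Delta>' \<tturnstile> \<^bold>\<bottom>" if \<Delta>': "\<Delta> \<le> \<Delta>'" "le_at \<Delta>' e (pow_rq n)" for \<Delta>'
  proof -
    have le: "le_at \<Delta>' 0 (pow_rq n - e)"
      using \<Delta>'(2) by (rule le_at_iff_diff[THEN iffD1])
    have less: "less_at \<Delta>' 0 ((1 + 1) - (nat_rq n + 1) * pow_rq n)"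
      "less_at \<Delta>' 0 (nat_rq n * e - (1 + 1))"
      using less_at_mono[OF n(2) \<Delta>'(1)] nat_mult_pow_rq_less[OF n(1), of \<Delta>']
      by (auto elim: less_at_shift)
    have "less_at \<Delta>' 0 (pow_rq n + ((1 + 1) - (nat_rq n + 1) * pow_rq n)
        + (nat_rq n * e - (1 + 1)) + nat_rq n * (pow_rq n - e))"
      by (intro le less pos_add_nonneg pos_add nonneg_mult nat_rq_nonneg pow_rq_pos n)
    moreover have "pow_rq n + ((1 + 1) - (nat_rq n + 1) * pow_rq n)
        + (nat_rq n * e - (1 + 1)) + nat_rq n * (pow_rq n - e) = 0"
      by (simp add: algebra_simps)
    ultimately show ?thesis
      using less_at_irrefl by simp
  qed
  show "cov \<Delta> (\<lambda>\<Delta>. \<exists>k. wt k NatT \<and> less_at \<Delta> (pow_rq k) e)"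
    by (rule cov_weaken[OF less_or_le_at[of \<Delta> "pow_rq n" e]])
      (use n absurd less_at_botE in blast)
qed


section \<open>Cuts\<close>

abbreviation mem :: "trm fset \<Rightarrow> trm \<Rightarrow> rq \<Rightarrow> bool"
  where "mem \<Gamma> A x \<equiv> \<Gamma> \<tturnstile> A \<bullet> rep_rq x"

definition greater_at :: "trm fset \<Rightarrow> rq \<Rightarrow> rq \<Rightarrow> bool"
  where "greater_at \<Gamma> x y \<longleftrightarrow> less_at \<Gamma> y x"

definition rounded :: "(trm fset \<Rightarrow> rq \<Rightarrow> rq \<Rightarrow> bool) \<Rightarrow> trm fset \<Rightarrow> trm \<Rightarrow> bool"
  where "rounded R \<Gamma> A \<longleftrightarrow> cov \<Gamma> (\<lambda>\<Delta>. \<exists>x. mem \<Delta> A x) \<and>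
    (\<forall>x. \<forall>\<Delta>\<ge>\<Gamma>. mem \<Delta> A x \<longleftrightarrow> cov \<Delta> (\<lambda>\<Delta>. \<exists>y. R \<Delta> x y \<and> mem \<Delta> A y))"

text \<open>The one-sided conditions of a classical cut. The last clause excludes an extremal
  element; its weak inequality appears as a negated strict one, so that \<open>R\<close> can be
  either orientation.\<close>

definition stably_rounded :: "(trm fset \<Rightarrow> rq \<Rightarrow> rq \<Rightarrow> bool) \<Rightarrow> trm fset \<Rightarrow> trm \<Rightarrow> bool"
  where "stably_rounded R \<Gamma> A \<longleftrightarrow>
    (\<forall>x. \<forall>\<Delta>\<ge>\<Gamma>. not_at \<Delta> (\<lambda>\<Delta>. not_at \<Delta> (\<lambda>\<Delta>. mem \<Delta> A x)) \<longrightarrow> mem \<Delta> A x) \<and>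
    not_at \<Gamma> (\<lambda>\<Delta>. \<forall>x. not_at \<Delta> (\<lambda>\<Delta>. mem \<Delta> A x)) \<and>
    (\<forall>x y. \<forall>\<Delta>\<ge>\<Gamma>. R \<Delta> x y \<longrightarrow> mem \<Delta> A y \<longrightarrow> mem \<Delta> A x) \<and>
    (\<forall>x. \<forall>\<Delta>\<ge>\<Gamma>. (\<forall>y. \<forall>\<Delta>'\<ge>\<Delta>. mem \<Delta>' A y \<longrightarrow> not_at \<Delta>' (\<lambda>\<Delta>. R \<Delta> x y)) \<longrightarrow>
      not_at \<Delta> (\<lambda>\<Delta>. mem \<Delta> A x))"

definition disjoint_at :: "trm fset \<Rightarrow> trm \<Rightarrow> trm \<Rightarrow> bool"
  where "disjoint_at \<Gamma> L U \<longleftrightarrow> (\<forall>x y. \<forall>\<Delta>\<ge>\<Gamma>. mem \<Delta> L x \<longrightarrow> mem \<Delta> U y \<longrightarrow> less_at \<Delta> x y)"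

definition located_at :: "trm fset \<Rightarrow> trm \<Rightarrow> trm \<Rightarrow> bool"
  where "located_at \<Gamma> L U \<longleftrightarrow>
    (\<forall>x y. \<forall>\<Delta>\<ge>\<Gamma>. less_at \<Delta> x y \<longrightarrow> cov \<Delta> (\<lambda>\<Delta>. mem \<Delta> L x \<or> mem \<Delta> U y))"

definition stably_located_at :: "trm fset \<Rightarrow> trm \<Rightarrow> trm \<Rightarrow> bool"
  where "stably_located_at \<Gamma> L U \<longleftrightarrow> (\<forall>x y. \<forall>\<Delta>\<ge>\<Gamma>.
    not_at \<Delta> (\<lambda>\<Delta>. mem \<Delta> L x) \<longrightarrow> not_at \<Delta> (\<lambda>\<Delta>. mem \<Delta> U y) \<longrightarrow> le_at \<Delta> y x)"

definition eps_located_at :: "trm fset \<Rightarrow> trm \<Rightarrow> trm \<Rightarrow> bool"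
  where "eps_located_at \<Gamma> L U \<longleftrightarrow> (\<forall>k. wt k NatT \<longrightarrow>
    cov \<Gamma> (\<lambda>\<Delta>. \<exists>x. mem \<Delta> L (x - pow_rq k) \<and> mem \<Delta> U (x + pow_rq k)))"

definition notnot_at :: "trm fset \<Rightarrow> trm \<Rightarrow> trm \<Rightarrow> bool"
  where "notnot_at \<Gamma> A A' \<longleftrightarrow>
    (\<forall>x. \<forall>\<Delta>\<ge>\<Gamma>. mem \<Delta> A' x \<longleftrightarrow> not_at \<Delta> (\<lambda>\<Delta>. not_at \<Delta> (\<lambda>\<Delta>. mem \<Delta> A x)))"

text \<open>The witness \<open>y\<close> is positive information, found on a cover. It is what
  allows \<open>A\<close> to be rounded while \<open>A'\<close> is merely stable.\<close>

definition interior_at :: "(trm fset \<Rightarrow> rq \<Rightarrow> rq \<Rightarrow> bool) \<Rightarrow> trm fset \<Rightarrow> trm \<Rightarrow> trm \<Rightarrow> bool"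
  where "interior_at R \<Gamma> A A' \<longleftrightarrow>
    (\<forall>x. \<forall>\<Delta>\<ge>\<Gamma>. mem \<Delta> A x \<longleftrightarrow> cov \<Delta> (\<lambda>\<Delta>. \<exists>y. R \<Delta> x y \<and> mem \<Delta> A' y))"

lemma cov_exI:
  assumes "R \<Gamma> x y" "mem \<Gamma> A y" "\<And>\<Delta>. \<Gamma> \<le> \<Delta> \<Longrightarrow> R \<Delta> x y"
  shows "cov \<Gamma> (\<lambda>\<Delta>. \<exists>y. R \<Delta> x y \<and> mem \<Delta> A y)"
proof (rule cov_weaken)
  show "cov \<Gamma> (\<lambda>\<Delta>. R \<Delta> x y \<and> mem \<Delta> A y)"
    using assms by (intro covI) (auto intro: forces_mono)
qed auto

lemma notnot_atI: "notnot_at \<Gamma> A A' \<Longrightarrow> \<Gamma> \<le> \<Delta> \<Longrightarrow> mem \<Delta> A x \<Longrightarrow> mem \<Delta> A' x"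
  unfolding notnot_at_def by (blast intro: not_atI not_atD forces_mono)

text \<open>As the goal is falsity, the double negation in \<open>A'\<close> can be removed by
  passing to an extension.\<close>

lemma notnot_atE:
  assumes "notnot_at \<Gamma> A A'" "\<Gamma> \<le> \<Delta>" "mem \<Delta> A' x"
    "\<And>\<Delta>'. \<Delta> \<le> \<Delta>' \<Longrightarrow> mem \<Delta>' A x \<Longrightarrow> \<Delta>' \<tturnstile> \<^bold>\<bottom>"
  shows "\<Delta> \<tturnstile> \<^bold>\<bottom>"
proof -
  have "not_at \<Delta> (\<lambda>\<Delta>. not_at \<Delta> (\<lambda>\<Delta>. mem \<Delta> A x))"
    using assms(1-3) by (simp add: notnot_at_def)
  moreover have "not_at \<Delta> (\<lambda>\<Delta>. mem \<Delta> A x)"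
    using assms(4) by (rule not_atI)
  ultimately show ?thesis
    by (rule not_atD)
qed

text \<open>Lower sets with the order and upper sets with its converse are treated together.\<close>

locale orientation =
  fixes R :: "trm fset \<Rightarrow> rq \<Rightarrow> rq \<Rightarrow> bool"
  assumes R: "R = less_at \<or> R = greater_at"
begin

lemma mono: "R \<Gamma> x y \<Longrightarrow> \<Gamma> \<le> \<Delta> \<Longrightarrow> R \<Delta> x y"
  using R less_at_mono by (auto simp: greater_at_def)

lemma trans: "R \<Gamma> x y \<Longrightarrow> R \<Gamma> y z \<Longrightarrow> R \<Gamma> x z"
  using R less_at_trans by (auto simp: greater_at_def)

lemma dense: "R \<Gamma> x y \<Longrightarrow> \<exists>z. R \<Gamma> x z \<and> R \<Gamma> z y"
  using R less_at_dense unfolding greater_at_def by metis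

lemma unbounded: "\<exists>x. \<forall>\<Gamma>. R \<Gamma> x y"
proof -
  have "less_at \<Gamma> (y - 1) y" "less_at \<Gamma> y (y + 1)" for \<Gamma>
    using less_at_shift[OF zero_less_one_at] by simp_all
  with R show ?thesis
    unfolding greater_at_def by metis
qed

lemma interiorI: "interior_at R \<Gamma> A A' \<Longrightarrow> \<Gamma> \<le> \<Delta> \<Longrightarrow> R \<Delta> x y \<Longrightarrow> mem \<Delta> A' y \<Longrightarrow> mem \<Delta> A x"
  unfolding interior_at_def by (blast intro: cov_exI[of R] mono)

lemma rounded_iff: "rounded R \<Gamma> A \<longleftrightarrow> cov \<Gamma> (\<lambda>\<Delta>. \<exists>x. mem \<Delta> A x) \<and> interior_at R \<Gamma> A A"
  unfolding rounded_def interior_at_def ..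

text \<open>Every clause concludes with falsity or with membership in \<open>A'\<close>, itself a
  double negation. Points of \<open>A'\<close> may therefore be taken in \<open>A\<close>, where
  roundedness applies.\<close>

lemma rounded_notnot:
  assumes rounded: "rounded R \<Gamma> A" and nn: "notnot_at \<Gamma> A A'"
  shows "stably_rounded R \<Gamma> A'"
  unfolding stably_rounded_def
proof (intro conjI allI impI)
  have int: "interior_at R \<Gamma> A A" and ex: "cov \<Gamma> (\<lambda>\<Delta>. \<exists>x. mem \<Delta> A x)"
    using rounded by (auto simp: rounded_iff)
  have nnI: "mem \<Delta> A' x"
    if "\<Gamma> \<le> \<Delta>" "\<And>\<Delta>'. \<Delta> \<le> \<Delta>' \<Longrightarrow> not_at \<Delta>' (\<lambda>\<Delta>. mem \<Delta> A x) \<Longrightarrow> \<Delta>' \<tturnstile> \<^bold>\<bottom>" for \<Delta> x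
    using nn that unfolding notnot_at_def by (blast intro: not_atI)
  show "mem \<Delta> A' x" if "\<Gamma> \<le> \<Delta>" "not_at \<Delta> (\<lambda>\<Delta>. not_at \<Delta> (\<lambda>\<Delta>. mem \<Delta> A' x))" for x \<Delta>
  proof (rule nnI)
    fix \<Delta>'
    assume \<Delta>': "\<Delta> \<le> \<Delta>'" "not_at \<Delta>' (\<lambda>\<Delta>. mem \<Delta> A x)"
    have "not_at \<Delta>' (\<lambda>\<Delta>. mem \<Delta> A' x)"
    proof (rule not_atI)
      fix \<Delta>''
      assume "\<Delta>' \<le> \<Delta>''" "mem \<Delta>'' A' x"
      then show "\<Delta>'' \<tturnstile> \<^bold>\<bottom>"
        using \<Delta>' that(1) by (intro notnot_atE[OF nn, of \<Delta>'' x]) (auto simp: not_at_def)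
    qed
    then show "\<Delta>' \<tturnstile> \<^bold>\<bottom>"
      using not_at_mono[OF that(2) \<Delta>'(1)] by (rule not_atD[rotated])
  qed (rule that)
  show "not_at \<Gamma> (\<lambda>\<Delta>. \<forall>x. not_at \<Delta> (\<lambda>\<Delta>. mem \<Delta> A' x))"
  proof (rule not_atI)
    fix \<Delta>
    assume \<Delta>: "\<Gamma> \<le> \<Delta>" "\<forall>x. not_at \<Delta> (\<lambda>\<Delta>. mem \<Delta> A' x)"
    show "\<Delta> \<tturnstile> \<^bold>\<bottom>"
      by (rule bot_covE[OF cov_mono[OF ex \<Delta>(1)]])
        (use \<Delta>(2) in \<open>auto simp: not_at_def dest: notnot_atI[OF nn order.trans[OF \<Delta>(1)]]\<close>)
  qed
  show "mem \<Delta> A' x" if "\<Gamma> \<le> \<Delta>" "R \<Delta> x y" "mem \<Delta> A' y" for x y \<Delta>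
  proof (rule nnI)
    fix \<Delta>'
    assume \<Delta>': "\<Delta> \<le> \<Delta>'" "not_at \<Delta>' (\<lambda>\<Delta>. mem \<Delta> A x)"
    show "\<Delta>' \<tturnstile> \<^bold>\<bottom>"
    proof (rule notnot_atE[OF nn, of \<Delta>' y])
      fix \<Delta>''
      assume \<Delta>'': "\<Delta>' \<le> \<Delta>''" "mem \<Delta>'' A y"
      then have "mem \<Delta>'' A x"
        using interiorI[OF int] mono[OF that(2)] \<Delta>' that(1) by (meson order.trans)
      then show "\<Delta>'' \<tturnstile> \<^bold>\<bottom>"
        using \<Delta>' \<Delta>'' by (auto simp: not_at_def)
    qed (use \<Delta>' that forces_mono in auto)
  qed (rule that)
  show "not_at \<Delta> (\<lambda>\<Delta>. mem \<Delta> A' x)"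
    if \<Delta>: "\<Gamma> \<le> \<Delta>" "\<forall>y. \<forall>\<Delta>'\<ge>\<Delta>. mem \<Delta>' A' y \<longrightarrow> not_at \<Delta>' (\<lambda>\<Delta>. R \<Delta> x y)" for x \<Delta>
  proof (rule not_atI)
    fix \<Delta>'
    assume \<Delta>': "\<Delta> \<le> \<Delta>'" "mem \<Delta>' A' x"
    show "\<Delta>' \<tturnstile> \<^bold>\<bottom>"
    proof (rule notnot_atE[OF nn _ \<Delta>'(2)])
      fix \<Delta>''
      assume \<Delta>'': "\<Delta>' \<le> \<Delta>''" "mem \<Delta>'' A x"
      then have "cov \<Delta>'' (\<lambda>\<Delta>. \<exists>y. R \<Delta> x y \<and> mem \<Delta> A y)"
        using int \<Delta>' \<Delta> unfolding interior_at_def by (meson order.trans)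
      then show "\<Delta>'' \<tturnstile> \<^bold>\<bottom>"
        by (rule bot_covE) (use \<Delta>'' \<Delta>' \<Delta> notnot_atI[OF nn] not_atD in \<open>meson order.trans\<close>)
    qed (use \<Delta> \<Delta>' in auto)
  qed
qed

text \<open>By density there is a point between \<open>x\<close> and its witness, and it lies in the
  interior with the same witness. Transitivity composes witnesses for the converse. Inhabitedness
  follows by stepping off a point of \<open>A'\<close>.\<close>

lemma interior_rounded:
  assumes ex: "cov \<Gamma> (\<lambda>\<Delta>. \<exists>x. mem \<Delta> A' x)" and int: "interior_at R \<Gamma> A A'"
  shows "rounded R \<Gamma> A"
  unfolding rounded_def
proof (intro conjI allI impI iffI)
  show "cov \<Gamma> (\<lambda>\<Delta>. \<exists>x. mem \<Delta> A x)"
    by (rule cov_weaken[OF ex]) (use unbounded interiorI[OF int] in blast)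
next
  fix x \<Delta>
  assume "\<Gamma> \<le> \<Delta>" "mem \<Delta> A x"
  then have "cov \<Delta> (\<lambda>\<Delta>. \<exists>y. R \<Delta> x y \<and> mem \<Delta> A' y)"
    using int by (simp add: interior_at_def)
  then show "cov \<Delta> (\<lambda>\<Delta>. \<exists>y. R \<Delta> x y \<and> mem \<Delta> A y)"
    by (rule cov_weaken) (use \<open>\<Gamma> \<le> \<Delta>\<close> dense interiorI[OF int] in \<open>meson order.trans\<close>)
next
  fix x \<Delta>
  assume \<Delta>: "\<Gamma> \<le> \<Delta>" "cov \<Delta> (\<lambda>\<Delta>. \<exists>y. R \<Delta> x y \<and> mem \<Delta> A y)"
  have "cov \<Delta> (\<lambda>\<Delta>. \<exists>y. R \<Delta> x y \<and> mem \<Delta> A' y)"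
  proof (rule cov_bind[OF \<Delta>(2)], elim exE conjE)
    fix \<Delta>' y
    assume \<Delta>': "\<Delta> \<le> \<Delta>'" "R \<Delta>' x y" "mem \<Delta>' A y"
    then have "cov \<Delta>' (\<lambda>\<Delta>. \<exists>z. R \<Delta> y z \<and> mem \<Delta> A' z)"
      using int \<Delta>(1) unfolding interior_at_def by (meson order.trans)
    then show "cov \<Delta>' (\<lambda>\<Delta>. \<exists>y. R \<Delta> x y \<and> mem \<Delta> A' y)"
      by (rule cov_weaken) (use \<Delta>' trans mono in blast)
  qed
  then show "mem \<Delta> A x"
    using int \<Delta>(1) by (simp add: interior_at_def)
qed

text \<open>If \<open>x\<close> in \<open>A'\<close> were outside the interior, no point of
  \<open>A'\<close> would lie strictly beyond it, and the clause against extremal elements would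
  expel \<open>x\<close>. Conversely, closure puts the interior inside \<open>A'\<close>, which is
  stable.\<close>

lemma interior_notnot:
  assumes st: "stably_rounded R \<Gamma> A'" and int: "interior_at R \<Gamma> A A'"
  shows "notnot_at \<Gamma> A A'"
  unfolding notnot_at_def
proof (intro conjI allI impI iffI)
  fix x \<Delta>
  assume \<Delta>: "\<Gamma> \<le> \<Delta>" "mem \<Delta> A' x"
  show "not_at \<Delta> (\<lambda>\<Delta>. not_at \<Delta> (\<lambda>\<Delta>. mem \<Delta> A x))"
  proof (rule not_atI)
    fix \<Delta>'
    assume \<Delta>': "\<Delta> \<le> \<Delta>'" "not_at \<Delta>' (\<lambda>\<Delta>. mem \<Delta> A x)"
    have "not_at \<Delta>'' (\<lambda>\<Delta>. R \<Delta> x y)" if "\<Delta>' \<le> \<Delta>''" "mem \<Delta>'' A' y" for y \<Delta>''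
    proof (rule not_atI)
      fix \<Delta>3
      assume "\<Delta>'' \<le> \<Delta>3" "R \<Delta>3 x y"
      moreover from this have "mem \<Delta>3 A x"
        using interiorI[OF int] forces_mono[OF that(2)] that(1) \<Delta>' \<Delta> by (meson order.trans)
      ultimately show "\<Delta>3 \<tturnstile> \<^bold>\<bottom>"
        using \<Delta>'(2) that(1) unfolding not_at_def by (meson order.trans)
    qed
    then have "not_at \<Delta>' (\<lambda>\<Delta>. mem \<Delta> A' x)"
      using st \<Delta> \<Delta>' unfolding stably_rounded_def by (meson order.trans)
    then show "\<Delta>' \<tturnstile> \<^bold>\<bottom>"
      using forces_mono[OF \<Delta>(2) \<Delta>'(1)] by (rule not_atD)
  qed
next
  fix x \<Delta>
  assume \<Delta>: "\<Gamma> \<le> \<Delta>" "not_at \<Delta> (\<lambda>\<Delta>. not_at \<Delta> (\<lambda>\<Delta>. mem \<Delta> A x))"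
  have down: "\<Delta>' \<tturnstile> \<^bold>\<bottom>" if \<Delta>': "\<Delta> \<le> \<Delta>'" "not_at \<Delta>' (\<lambda>\<Delta>. mem \<Delta> A' x)" "mem \<Delta>' A x" for \<Delta>'
  proof (rule bot_covE)
    show "cov \<Delta>' (\<lambda>\<Delta>. \<exists>y. R \<Delta> x y \<and> mem \<Delta> A' y)"
      using int \<Delta>' \<Delta>(1) unfolding interior_at_def by (meson order.trans)
    fix \<Delta>''
    assume \<Delta>'': "\<Delta>' \<le> \<Delta>''" "\<exists>y. R \<Delta>'' x y \<and> mem \<Delta>'' A' y"
    then have "mem \<Delta>'' A' x"
      using st \<Delta>(1) \<Delta>'(1) unfolding stably_rounded_def by (meson order.trans)
    then show "\<Delta>'' \<tturnstile> \<^bold>\<bottom>"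
      using \<Delta>'(2) \<Delta>''(1) unfolding not_at_def by blast
  qed
  have "not_at \<Delta> (\<lambda>\<Delta>. not_at \<Delta> (\<lambda>\<Delta>. mem \<Delta> A' x))"
  proof (rule not_atI)
    fix \<Delta>'
    assume \<Delta>': "\<Delta> \<le> \<Delta>'" "not_at \<Delta>' (\<lambda>\<Delta>. mem \<Delta> A' x)"
    have "not_at \<Delta>' (\<lambda>\<Delta>. mem \<Delta> A x)"
      using down \<Delta>' not_at_mono by (meson not_atI order.trans)
    then show "\<Delta>' \<tturnstile> \<^bold>\<bottom>"
      using not_at_mono[OF \<Delta>(2) \<Delta>'(1)] by (rule not_atD[rotated])
  qed
  then show "mem \<Delta> A' x"
    using st \<Delta>(1) by (simp add: stably_rounded_def)
qed

text \<open>One inclusion is roundedness of \<open>A\<close> together with \<open>A\<close> being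
  contained in \<open>A'\<close>. The other is the premise \<open>dec\<close>: it recovers an actual
  membership from a doubly negated one, for which the opposite side of the cut will be used.\<close>

lemma interior_unique:
  assumes wt: "wt A (PowT RatT)" and rounded: "rounded R \<Gamma> A" and nn: "notnot_at \<Gamma> A A'"
    and dec: "\<And>x y \<Delta>. \<Gamma> \<le> \<Delta> \<Longrightarrow> R \<Delta> x y \<Longrightarrow> mem \<Delta> A' y \<Longrightarrow> mem \<Delta> A x"
  shows "interior_at R \<Gamma> A A'"
  unfolding interior_at_def
proof (intro conjI allI impI iffI)
  fix x \<Delta>
  assume \<Delta>: "\<Gamma> \<le> \<Delta>" "mem \<Delta> A x"
  then have "cov \<Delta> (\<lambda>\<Delta>. \<exists>y. R \<Delta> x y \<and> mem \<Delta> A y)"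
    using rounded by (simp add: rounded_def)
  then show "cov \<Delta> (\<lambda>\<Delta>. \<exists>y. R \<Delta> x y \<and> mem \<Delta> A' y)"
    by (rule cov_weaken) (use \<Delta>(1) notnot_atI[OF nn] in \<open>meson order.trans\<close>)
next
  fix x \<Delta>
  assume \<Delta>: "\<Gamma> \<le> \<Delta>" "cov \<Delta> (\<lambda>\<Delta>. \<exists>y. R \<Delta> x y \<and> mem \<Delta> A' y)"
  show "mem \<Delta> A x"
    by (rule cov_forces[OF \<Delta>(2)])
      (use \<Delta>(1) dec wt wt_rep_rq ty_App in \<open>meson order.trans\<close>)+
qed

end

interpretation lower: orientation less_at
  by unfold_locales simp

interpretation upper: orientation greater_at
  by unfold_locales simp

section \<open>Transfer of disjointness and locatedness\<close>

text \<open>The order is decidable, so \<open>x < y\<close> may be shown by refuting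
  \<open>y \<le> x\<close>; inside the refutation both double negations can be removed.\<close>

lemma disjoint_notnot:
  assumes disj: "disjoint_at \<Gamma> L U" and nn: "notnot_at \<Gamma> L L'" "notnot_at \<Gamma> U U'"
  shows "disjoint_at \<Gamma> L' U'"
  unfolding disjoint_at_def
proof (intro allI impI)
  fix x y \<Delta>
  assume \<Delta>: "\<Gamma> \<le> \<Delta>" and x: "mem \<Delta> L' x" and y: "mem \<Delta> U' y"
  have "\<Delta>' \<tturnstile> \<^bold>\<bottom>" if \<Delta>': "\<Delta> \<le> \<Delta>'" and le: "le_at \<Delta>' y x" for \<Delta>'
  proof (rule notnot_atE[OF nn(1) order.trans[OF \<Delta> \<Delta>'] forces_mono[OF x \<Delta>']])
    fix \<Delta>1
    assume \<Delta>1: "\<Delta>' \<le> \<Delta>1" "mem \<Delta>1 L x"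
    have \<Gamma>1: "\<Gamma> \<le> \<Delta>1"
      using \<Delta> \<Delta>' \<Delta>1 by auto
    show "\<Delta>1 \<tturnstile> \<^bold>\<bottom>"
    proof (rule notnot_atE[OF nn(2) \<Gamma>1 forces_mono[OF y order.trans[OF \<Delta>' \<Delta>1(1)]]])
      fix \<Delta>2
      assume \<Delta>2: "\<Delta>1 \<le> \<Delta>2" "mem \<Delta>2 U y"
      then have "less_at \<Delta>2 x y"
        using disj \<Gamma>1 forces_mono[OF \<Delta>1(2) \<Delta>2(1)] unfolding disjoint_at_def by (meson order.trans)
      then show "\<Delta>2 \<tturnstile> \<^bold>\<bottom>"
        using le \<Delta>1(1) \<Delta>2(1) unfolding not_at_def by (meson order.trans)
    qed
  qed
  then show "less_at \<Delta> x y"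
    by (intro less_at_cov[OF cov_weaken[OF less_or_le_at[of \<Delta> x y]]]) (blast intro: less_at_botE)
qed

lemma stably_located_notnot:
  assumes loc: "located_at \<Gamma> L U" and nn: "notnot_at \<Gamma> L L'" "notnot_at \<Gamma> U U'"
  shows "stably_located_at \<Gamma> L' U'"
  unfolding stably_located_at_def
proof (intro allI impI not_atI)
  fix x y \<Delta> \<Delta>'
  assume \<Delta>: "\<Gamma> \<le> \<Delta>" "not_at \<Delta> (\<lambda>\<Delta>. mem \<Delta> L' x)" "not_at \<Delta> (\<lambda>\<Delta>. mem \<Delta> U' y)"
    and \<Delta>': "\<Delta> \<le> \<Delta>'" "less_at \<Delta>' x y"
  show "\<Delta>' \<tturnstile> \<^bold>\<bottom>"
  proof (rule bot_covE)
    show "cov \<Delta>' (\<lambda>\<Delta>. mem \<Delta> L x \<or> mem \<Delta> U y)"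
      using loc \<Delta>(1) \<Delta>' unfolding located_at_def by (meson order.trans)
    fix \<Delta>1
    assume \<Delta>1: "\<Delta>' \<le> \<Delta>1" "mem \<Delta>1 L x \<or> mem \<Delta>1 U y"
    then have "mem \<Delta>1 L' x \<or> mem \<Delta>1 U' y"
      using notnot_atI[OF nn(1)] notnot_atI[OF nn(2)] \<Delta>(1) \<Delta>'(1) by (meson order.trans)
    then show "\<Delta>1 \<tturnstile> \<^bold>\<bottom>"
      using \<Delta>(2,3) \<Delta>'(1) \<Delta>1(1) unfolding not_at_def by (meson order.trans)
  qed
qed

lemma disjoint_interior:
  assumes disj: "disjoint_at \<Gamma> L' U'"
    and int: "interior_at less_at \<Gamma> L L'" "interior_at greater_at \<Gamma> U U'"
  shows "disjoint_at \<Gamma> L U"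
  unfolding disjoint_at_def
proof (intro allI impI)
  fix x y \<Delta>
  assume \<Delta>: "\<Gamma> \<le> \<Delta>" "mem \<Delta> L x" "mem \<Delta> U y"
  have "cov \<Delta> (\<lambda>\<Delta>. less_at \<Delta> x y)"
  proof (rule cov_bind)
    show "cov \<Delta> (\<lambda>\<Delta>. \<exists>x'. less_at \<Delta> x x' \<and> mem \<Delta> L' x')"
      using int(1) \<Delta> by (simp add: interior_at_def)
    fix \<Delta>1
    assume \<Delta>1: "\<Delta> \<le> \<Delta>1" "\<exists>x'. less_at \<Delta>1 x x' \<and> mem \<Delta>1 L' x'"
    have "cov \<Delta>1 (\<lambda>\<Delta>. \<exists>y'. greater_at \<Delta> y y' \<and> mem \<Delta> U' y')"
      using int(2) \<Delta>(1) \<Delta>1(1) forces_mono[OF \<Delta>(3) \<Delta>1(1)]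
      unfolding interior_at_def by (meson order.trans)
    then show "cov \<Delta>1 (\<lambda>\<Delta>. less_at \<Delta> x y)"
    proof (rule cov_weaken, elim exE conjE)
      fix \<Delta>2 y'
      assume \<Delta>2: "\<Delta>1 \<le> \<Delta>2" "greater_at \<Delta>2 y y'" "mem \<Delta>2 U' y'"
      obtain x' where x': "less_at \<Delta>1 x x'" "mem \<Delta>1 L' x'"
        using \<Delta>1(2) by blast
      have "less_at \<Delta>2 x' y'"
        using disj \<Delta>(1) \<Delta>1(1) \<Delta>2 forces_mono[OF x'(2) \<Delta>2(1)]
        unfolding disjoint_at_def by (meson order.trans)
      then show "less_at \<Delta>2 x y"
        using less_at_mono[OF x'(1) \<Delta>2(1)] \<Delta>2(2) less_at_trans unfolding greater_at_def by blast
    qed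
  qed
  then show "less_at \<Delta> x y"
    by (rule less_at_cov)
qed

text \<open>Take \<open>2^-k\<close> less than half of \<open>y - x\<close> and compare
  \<open>x\<close> with \<open>z - 2^-k\<close>. If \<open>x\<close> is not below it, then
  \<open>z + 2^-k \<le> x + 2 * 2^-k < y\<close>.\<close>

lemma located_interior:
  assumes eps: "eps_located_at \<Gamma> L' U'"
    and int: "interior_at less_at \<Gamma> L L'" "interior_at greater_at \<Gamma> U U'"
  shows "located_at \<Gamma> L U"
  unfolding located_at_def
proof (intro allI impI)
  fix x y \<Delta>
  assume \<Delta>: "\<Gamma> \<le> \<Delta>" "less_at \<Delta> x y"
  have "less_at \<Delta> 0 ((y - x) * half)"
    using \<Delta>(2) by (intro less_at_mult half_pos) (rule less_at_iff_diff[THEN iffD1])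
  from pow_rq_small[OF this] show "cov \<Delta> (\<lambda>\<Delta>. mem \<Delta> L x \<or> mem \<Delta> U y)"
  proof (rule cov_bind, elim exE conjE)
    fix \<Delta>1 k
    assume \<Delta>1: "\<Delta> \<le> \<Delta>1" and k: "wt k NatT" "less_at \<Delta>1 (pow_rq k) ((y - x) * half)"
    have \<Gamma>1: "\<Gamma> \<le> \<Delta>1"
      using \<Delta> \<Delta>1 by auto
    have "cov \<Delta>1 (\<lambda>\<Delta>. \<exists>z. mem \<Delta> L' (z - pow_rq k) \<and> mem \<Delta> U' (z + pow_rq k))"
      using eps k(1) \<Gamma>1 by (auto simp: eps_located_at_def intro: cov_mono)
    then show "cov \<Delta>1 (\<lambda>\<Delta>. mem \<Delta> L x \<or> mem \<Delta> U y)"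
    proof (rule cov_bind, elim exE conjE)
      fix \<Delta>2 z
      assume \<Delta>2: "\<Delta>1 \<le> \<Delta>2" and z: "mem \<Delta>2 L' (z - pow_rq k)" "mem \<Delta>2 U' (z + pow_rq k)"
      show "cov \<Delta>2 (\<lambda>\<Delta>. mem \<Delta> L x \<or> mem \<Delta> U y)"
      proof (rule cov_weaken[OF less_or_le_at[of \<Delta>2 x "z - pow_rq k"]], elim disjE)
        fix \<Delta>3
        assume \<Delta>3: "\<Delta>2 \<le> \<Delta>3"
        then have \<Gamma>3: "\<Gamma> \<le> \<Delta>3"
          using \<Gamma>1 \<Delta>2 by auto
        show "mem \<Delta>3 L x \<or> mem \<Delta>3 U y" if "less_at \<Delta>3 x (z - pow_rq k)"
          using lower.interiorI[OF int(1) \<Gamma>3 that forces_mono[OF z(1) \<Delta>3]] ..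
        show "mem \<Delta>3 L x \<or> mem \<Delta>3 U y" if "le_at \<Delta>3 (z - pow_rq k) x"
        proof (rule disjI2)
          have le: "le_at \<Delta>3 0 (x - (z - pow_rq k))"
            using that by (rule le_at_iff_diff[THEN iffD1])
          have less: "less_at \<Delta>3 0 ((y - x) * half - pow_rq k)"
            using less_at_mono[OF k(2)] \<Delta>2 \<Delta>3 by (auto simp flip: less_at_iff_diff)
          have "less_at \<Delta>3 0 (((y - x) * half - pow_rq k) + ((y - x) * half - pow_rq k)
              + (x - (z - pow_rq k)))"
            by (intro pos_add_nonneg pos_add less le)
          moreover have "((y - x) * half - pow_rq k) + ((y - x) * half - pow_rq k)
              + (x - (z - pow_rq k)) = y - (z + pow_rq k)"
          proof -
            have "((y - x) * half - pow_rq k) + ((y - x) * half - pow_rq k)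
                + (x - (z - pow_rq k)) = ((y - x) * half + (y - x) * half) + x - (z + pow_rq k)"
              by (simp add: algebra_simps)
            then show ?thesis
              unfolding add_half by simp
          qed
          ultimately have "greater_at \<Delta>3 y (z + pow_rq k)"
            unfolding greater_at_def using less_at_iff_diff by simp
          then show "mem \<Delta>3 U y"
            using upper.interiorI[OF int(2) \<Gamma>3] forces_mono[OF z(2) \<Delta>3] by blast
        qed
      qed
    qed
  qed
qed

text \<open>
  Walking from a point of \<open>L\<close> in steps of length \<open>p\<close>, each new point is still in \<open>L\<close> or the next
  one is in \<open>U\<close>; the first alternative cannot persist, since \<open>U\<close> is inhabited.
\<close>

lemma located_walk:
  assumes wt: "wt L (PowT RatT)" "wt \<chi> Omega" "wt n NatT"
    and loc: "located_at \<Gamma> L U" and p: "less_at \<Gamma> 0 p" and a: "mem \<Gamma> L a"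
    and \<chi>: "\<And>\<Delta> x. \<Gamma> \<le> \<Delta> \<Longrightarrow> mem \<Delta> L (x - p) \<Longrightarrow> mem \<Delta> U (x + p) \<Longrightarrow> \<Delta> \<tturnstile> \<chi>"
  shows "cov \<Gamma> (\<lambda>\<Delta>. (\<Delta> \<tturnstile> \<chi>) \<or> mem \<Delta> L (a + nat_rq n * p))"
proof -
  \<comment> \<open>A cover is no object formula, so the induction cannot be about one. An arbitrary
    \<chi> that follows from the desired location stands in for it.\<close>
  let ?b = "\<chi> \<^bold>\<or> L \<bullet> (rep_rq a \<^bold>+ (nat_to_rat \<bullet> Bnd 0) \<^bold>* rep_rq p)"
  note [simp] = wtD[OF wt(1)] wtD[OF wt(2)]
  have iff: "(\<Delta> \<tturnstile> opn 0 m ?b) \<longleftrightarrow> cov \<Delta> (\<lambda>\<Delta>. (\<Delta> \<tturnstile> \<chi>) \<or> mem \<Delta> L (a + nat_rq m * p))"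
    if "wt m NatT" for m \<Delta>
    using that forces_mem_abs_rq[OF wt(1), of "rep_rq a \<^bold>+ (nat_to_rat \<bullet> m) \<^bold>* rep_rq p"]
    by (simp add: forces_disj abs_rq_simps nat_rq_def type_simps)
  have "\<Gamma> \<tturnstile> opn 0 n ?b"
  proof (rule forces_nat_induct)
    fix m \<Delta>
    assume \<Delta>: "\<Gamma> \<le> \<Delta>" and m: "wt m NatT" and IH: "\<Delta> \<tturnstile> opn 0 m ?b"
    have suc: "wt (nsuc m) NatT" "nat_rq (nsuc m) = nat_rq m + 1"
      using m by (simp_all add: nat_rq_suc type_simps)
    have "cov \<Delta> (\<lambda>\<Delta>. (\<Delta> \<tturnstile> \<chi>) \<or> mem \<Delta> L (a + nat_rq m * p))"
      using IH iff[OF m] by simp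
    then have "cov \<Delta> (\<lambda>\<Delta>. (\<Delta> \<tturnstile> \<chi>) \<or> mem \<Delta> L (a + (nat_rq m + 1) * p))"
    proof (rule cov_bind, elim disjE)
      show "cov \<Delta>1 (\<lambda>\<Delta>. (\<Delta> \<tturnstile> \<chi>) \<or> mem \<Delta> L (a + (nat_rq m + 1) * p))" if "\<Delta>1 \<tturnstile> \<chi>" for \<Delta>1
        using that by (intro covI) (auto intro: forces_mono)
    next
      fix \<Delta>1
      assume \<Delta>1: "\<Delta> \<le> \<Delta>1" "mem \<Delta>1 L (a + nat_rq m * p)"
      \<comment> \<open>The candidate centre: the current point is \<open>?x - p\<close>, so if
        \<open>?x + p\<close> lies in \<open>U\<close>, then \<chi> follows.\<close>
      let ?x = "a + (nat_rq m + 1) * p"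
      have "less_at \<Delta>1 ?x (?x + p)"
        using less_at_shift[OF less_at_mono[OF p], of \<Delta>1 "?x + p" ?x] \<Delta> \<Delta>1(1) by auto
      then have "cov \<Delta>1 (\<lambda>\<Delta>. mem \<Delta> L ?x \<or> mem \<Delta> U (?x + p))"
        using loc \<Delta> \<Delta>1(1) unfolding located_at_def by (meson order.trans)
      then show "cov \<Delta>1 (\<lambda>\<Delta>. (\<Delta> \<tturnstile> \<chi>) \<or> mem \<Delta> L ?x)"
      proof (rule cov_weaken)
        fix \<Delta>2
        assume \<Delta>2: "\<Delta>1 \<le> \<Delta>2" "mem \<Delta>2 L ?x \<or> mem \<Delta>2 U (?x + p)"
        have "a + nat_rq m * p = ?x - p"
          by (simp add: algebra_simps)
        then have "mem \<Delta>2 L (?x - p)"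
          using forces_mono[OF \<Delta>1(2) \<Delta>2(1)] by (simp only:)
        then show "(\<Delta>2 \<tturnstile> \<chi>) \<or> mem \<Delta>2 L ?x"
          using \<chi>[of \<Delta>2 ?x] \<Delta> \<Delta>1(1) \<Delta>2 by auto
      qed
    qed
    then show "\<Delta> \<tturnstile> opn 0 (nsuc m) ?b"
      unfolding iff[OF suc(1)] suc(2) .
  next
    have "cov \<Gamma> (\<lambda>\<Delta>. (\<Delta> \<tturnstile> \<chi>) \<or> mem \<Delta> L (a + nat_rq (Cn ZeroC) * p))"
      using a by (intro covI) (auto simp: nat_rq_zero intro: forces_mono)
    then show "\<Gamma> \<tturnstile> opn 0 (Cn ZeroC) ?b"
      by (subst iff) (simp_all add: type_simps)
  qed (use wt(3) in \<open>simp_all add: type_simps\<close>)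
  then show ?thesis
    using iff[OF wt(3)] by simp
qed

text \<open>Walk from \<open>a\<close> in \<open>L\<close> for \<open>n\<close> steps, where
  \<open>b\<close> is in \<open>U\<close> and \<open>b < a + n * 2^-k\<close>. Arriving in
  \<open>L\<close> would contradict disjointness.\<close>

lemma eps_located:
  assumes wt: "wt L (PowT RatT)"
    and ex: "cov \<Gamma> (\<lambda>\<Delta>. \<exists>x. mem \<Delta> L x)" "cov \<Gamma> (\<lambda>\<Delta>. \<exists>x. mem \<Delta> U x)"
    and disj: "disjoint_at \<Gamma> L U" and loc: "located_at \<Gamma> L U"
  shows "eps_located_at \<Gamma> L U"
  unfolding eps_located_at_def
proof (intro allI impI)
  fix k
  assume k: "wt k NatT"
  let ?p = "pow_rq k"
  show "cov \<Gamma> (\<lambda>\<Delta>. \<exists>x. mem \<Delta> L (x - ?p) \<and> mem \<Delta> U (x + ?p))" (is "cov _ ?P")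
    \<comment> \<open>This exposes the arbitrary formula \<chi> with which
      \<open>located_walk\<close> works.\<close>
    unfolding cov_def
  proof (intro allI impI)
    fix \<Delta> \<chi>
    assume \<Delta>: "\<Gamma> \<le> \<Delta>" and wt\<chi>: "wt \<chi> Omega" and \<chi>: "\<forall>\<Delta>'\<ge>\<Delta>. ?P \<Delta>' \<longrightarrow> \<Delta>' \<tturnstile> \<chi>"
    show "\<Delta> \<tturnstile> \<chi>"
    proof (rule cov_forces[OF cov_mono[OF ex(1) \<Delta>] _ wt\<chi>], elim exE)
      fix \<Delta>1 a
      assume \<Delta>1: "\<Delta> \<le> \<Delta>1" and a: "mem \<Delta>1 L a"
      have \<Gamma>1: "\<Gamma> \<le> \<Delta>1"
        using \<Delta> \<Delta>1 by auto
      show "\<Delta>1 \<tturnstile> \<chi>"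
      proof (rule cov_forces[OF cov_mono[OF ex(2) \<Gamma>1] _ wt\<chi>], elim exE)
        fix \<Delta>2 b
        assume \<Delta>2: "\<Delta>1 \<le> \<Delta>2" and b: "mem \<Delta>2 U b"
        show "\<Delta>2 \<tturnstile> \<chi>"
        proof (rule cov_forces[OF archimedean_mult_at[OF pow_rq_pos[OF k], of \<Delta>2 "b - a"] _ wt\<chi>],
            elim exE conjE)
          fix \<Delta>3 n
          assume \<Delta>3: "\<Delta>2 \<le> \<Delta>3" and n: "wt n NatT" "less_at \<Delta>3 (b - a) (nat_rq n * ?p)"
          have \<Gamma>3: "\<Gamma> \<le> \<Delta>3" "\<Delta> \<le> \<Delta>3" "\<Delta>1 \<le> \<Delta>3"
            using \<Delta> \<Delta>1 \<Delta>2 \<Delta>3 by auto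
          have "cov \<Delta>3 (\<lambda>\<Delta>. (\<Delta> \<tturnstile> \<chi>) \<or> mem \<Delta> L (a + nat_rq n * ?p))"
          proof (rule located_walk[OF wt wt\<chi> n(1) _ pow_rq_pos[OF k] forces_mono[OF a \<Gamma>3(3)]])
            show "located_at \<Delta>3 L U"
              using loc \<Gamma>3(1) unfolding located_at_def by (meson order.trans)
          qed (use \<chi> \<Gamma>3(2) in \<open>meson order.trans\<close>)
          then show "\<Delta>3 \<tturnstile> \<chi>"
          proof (rule cov_forces[OF _ _ wt\<chi>], elim disjE)
            fix \<Delta>4
            assume \<Delta>4: "\<Delta>3 \<le> \<Delta>4" "mem \<Delta>4 L (a + nat_rq n * ?p)"
            have "\<Gamma> \<le> \<Delta>4" "mem \<Delta>4 U b"
              using \<Gamma>3(1) \<Delta>3 \<Delta>4(1) forces_mono[OF b] by auto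
            then have "less_at \<Delta>4 (a + nat_rq n * ?p) b"
              using disj \<Delta>4(2) by (simp add: disjoint_at_def)
            moreover have "less_at \<Delta>4 b (a + nat_rq n * ?p)"
              by (rule less_at_shift[OF less_at_mono[OF n(2) \<Delta>4(1)]]) (simp add: algebra_simps)
            ultimately show "\<Delta>4 \<tturnstile> \<chi>"
              using forces_botE[OF _ wt\<chi>] less_at_irrefl less_at_trans by blast
          qed
        qed
      qed
    qed
  qed
qed

section \<open>From the object formulas to their semantic forms\<close>

lemma forces_is_cut:
  assumes "wt L (PowT RatT)" "wt U (PowT RatT)"
  shows "(\<Gamma> \<tturnstile> is_cut \<bullet> L \<bullet> U) \<longleftrightarrow> rounded less_at \<Gamma> L \<and> rounded greater_at \<Gamma> U \<and>
    disjoint_at \<Gamma> L U \<and> located_at \<Gamma> L U"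
proof -
  note [simp] = wtD[OF assms(1)] wtD[OF assms(2)]
  \<comment> \<open>The object biconditional is a conjunction of two implications, each of which
    ranges over extensions by itself.\<close>
  have iff: "(\<forall>\<Delta>\<ge>\<Gamma>. P \<Delta> \<longleftrightarrow> Q \<Delta>) \<longleftrightarrow>
      (\<forall>\<Delta>\<ge>\<Gamma>. P \<Delta> \<longrightarrow> Q \<Delta>) \<and> (\<forall>\<Delta>\<ge>\<Gamma>. Q \<Delta> \<longrightarrow> P \<Delta>)" for P Q
    by blast
  show ?thesis
    unfolding is_cut_def rounded_def disjoint_at_def located_at_def greater_at_def iff
    by (simp add: forces_beta2 forces_rat_simps conj_commute) (auto simp: conj_commute)
qed

lemma forces_is_classical_cut:
  assumes "wt L (PowT RatT)" "wt U (PowT RatT)"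
  shows "(\<Gamma> \<tturnstile> is_classical_cut \<bullet> L \<bullet> U) \<longleftrightarrow>
    stably_rounded less_at \<Gamma> L \<and> stably_rounded greater_at \<Gamma> U \<and>
    disjoint_at \<Gamma> L U \<and> stably_located_at \<Gamma> L U"
proof -
  note [simp] = wtD[OF assms(1)] wtD[OF assms(2)]
  have swap: "(\<forall>x y. \<forall>\<Delta>\<ge>\<Gamma>. greater_at \<Delta> x y \<longrightarrow> mem \<Delta> U y \<longrightarrow> mem \<Delta> U x) \<longleftrightarrow>
      (\<forall>y x. \<forall>\<Delta>\<ge>\<Gamma>. mem \<Delta> U y \<and> less_at \<Delta> y x \<longrightarrow> mem \<Delta> U x)"
    unfolding greater_at_def by blast
  show ?thesis
    unfolding is_classical_cut_def Pow_notnot_def stably_rounded_def disjoint_at_def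
      stably_located_at_def swap
    by (simp add: forces_beta2 forces_beta forces_rat_simps le_at_iff not_at_def greater_at_def
        imp_conjL conj_ac)
qed

text \<open>If \<open>x < y\<close> and \<open>y\<close> is doubly negated in \<open>L\<close>,
  locatedness gives \<open>x\<close> in \<open>L\<close> or \<open>y\<close> in \<open>U\<close>,
  and disjointness refutes the latter. Dually for \<open>U\<close>. Hence a cut is determined by its
  double complement.\<close>

lemma cut_interior:
  assumes wt: "wt L (PowT RatT)" "wt U (PowT RatT)"
    and rounded: "rounded less_at \<Gamma> L" "rounded greater_at \<Gamma> U"
    and disj: "disjoint_at \<Gamma> L U" and loc: "located_at \<Gamma> L U"
    and nn: "notnot_at \<Gamma> L L'" "notnot_at \<Gamma> U U'"
  shows "interior_at less_at \<Gamma> L L'" "interior_at greater_at \<Gamma> U U'"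
proof -
  have wt_mem: "wt (L \<bullet> rep_rq x) Omega" "wt (U \<bullet> rep_rq x) Omega" for x
    using wt wt_rep_rq ty_App by blast+
  have absurd: "\<Delta> \<tturnstile> \<^bold>\<bottom>" if "\<Gamma> \<le> \<Delta>" "mem \<Delta> L x" "mem \<Delta> U x" for x \<Delta>
    using disj that less_at_irrefl unfolding disjoint_at_def by blast
  have cov: "cov \<Delta> (\<lambda>\<Delta>. mem \<Delta> L x \<or> mem \<Delta> U y)" if "\<Gamma> \<le> \<Delta>" "less_at \<Delta> x y" for x y \<Delta>
    using loc that by (simp add: located_at_def)
  show "interior_at less_at \<Gamma> L L'"
  proof (rule lower.interior_unique[OF wt(1) rounded(1) nn(1)])
    fix x y \<Delta>
    assume \<Delta>: "\<Gamma> \<le> \<Delta>" "less_at \<Delta> x y" "mem \<Delta> L' y"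
    show "mem \<Delta> L x"
    proof (rule cov_forces[OF cov[OF \<Delta>(1,2)] _ wt_mem(1)], elim disjE)
      fix \<Delta>'
      assume \<Delta>': "\<Delta> \<le> \<Delta>'" "mem \<Delta>' U y"
      have "\<Delta>' \<tturnstile> \<^bold>\<bottom>"
        by (rule notnot_atE[OF nn(1) order.trans[OF \<Delta>(1) \<Delta>'(1)] forces_mono[OF \<Delta>(3) \<Delta>'(1)]])
          (use \<Delta>(1) \<Delta>' absurd forces_mono in \<open>meson order.trans\<close>)
      then show "mem \<Delta>' L x"
        using wt_mem(1) by (rule forces_botE)
    qed
  qed
  show "interior_at greater_at \<Gamma> U U'"
  proof (rule upper.interior_unique[OF wt(2) rounded(2) nn(2)])
    fix x y \<Delta>
    assume \<Delta>: "\<Gamma> \<le> \<Delta>" "greater_at \<Delta> x y" "mem \<Delta> U' y"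
    show "mem \<Delta> U x"
    proof (rule cov_forces[OF cov[OF \<Delta>(1) \<Delta>(2)[unfolded greater_at_def]] _ wt_mem(2)], elim disjE)
      fix \<Delta>'
      assume \<Delta>': "\<Delta> \<le> \<Delta>'" "mem \<Delta>' L y"
      have "\<Delta>' \<tturnstile> \<^bold>\<bottom>"
        by (rule notnot_atE[OF nn(2) order.trans[OF \<Delta>(1) \<Delta>'(1)] forces_mono[OF \<Delta>(3) \<Delta>'(1)]])
          (use \<Delta>(1) \<Delta>' absurd forces_mono in \<open>meson order.trans\<close>)
      then show "mem \<Delta>' U x"
        using wt_mem(2) by (rule forces_botE)
    qed
  qed
qed


section \<open>The isomorphism\<close>

lemma forces_fst_snd:
  assumes "wt s S" "wt t T"
  shows "\<Gamma> \<tturnstile> Cn (FstC S T) \<bullet> pair S T s t \<^bold>=\<^bsub>S\<^esub> s" "\<Gamma> \<tturnstile> Cn (SndC S T) \<bullet> pair S T s t \<^bold>=\<^bsub>T\<^esub> t"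
  using forces_ax[OF ax_fst[of S T]] forces_ax[OF ax_snd[of S T]] assms[unfolded wt_iff]
  by (simp_all add: forces_simps)

lemma forces_pair_eqI:
  assumes wt: "wt p (S \<^bold>\<times> T)" "wt q (S \<^bold>\<times> T)"
    and eq: "\<Gamma> \<tturnstile> Cn (FstC S T) \<bullet> p \<^bold>=\<^bsub>S\<^esub> Cn (FstC S T) \<bullet> q"
      "\<Gamma> \<tturnstile> Cn (SndC S T) \<bullet> p \<^bold>=\<^bsub>T\<^esub> Cn (SndC S T) \<bullet> q"
  shows "\<Gamma> \<tturnstile> p \<^bold>=\<^bsub>S \<^bold>\<times> T\<^esub> q"
proof -
  have eta: "\<Gamma> \<tturnstile> pair S T (Cn (FstC S T) \<bullet> r) (Cn (SndC S T) \<bullet> r) \<^bold>=\<^bsub>S \<^bold>\<times> T\<^esub> r"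
    if "wt r (S \<^bold>\<times> T)" for r
    using forces_ax[OF ax_pair[of S T]] that[unfolded wt_iff] by (simp add: forces_simps)
  have "wt (Cn (PairC S T)) (S \<^bold>\<Rightarrow> T \<^bold>\<Rightarrow> S \<^bold>\<times> T)"
    by (simp add: has_type_iff_infer)
  from forces_cong[OF forces_app_cong[OF eq(1) this] eq(2)] show ?thesis
    using eta[OF wt(1)] eta[OF wt(2)] forces_eq_sym forces_eq_trans by blast
qed

lemma forces_ex1I:
  assumes "wt p (PowT T)" "wt t T" "\<Gamma> \<tturnstile> p \<bullet> t"
    and "\<And>\<Delta> u. \<Gamma> \<le> \<Delta> \<Longrightarrow> wt u T \<Longrightarrow> \<Delta> \<tturnstile> p \<bullet> u \<Longrightarrow> \<Delta> \<tturnstile> u \<^bold>=\<^bsub>T\<^esub> t"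
  shows "\<Gamma> \<tturnstile> ex_unique T \<bullet> p"
proof -
  note [simp] = wtD[OF assms(1)] wtD[OF assms(2)]
  have "\<Gamma> \<tturnstile> opn 0 t (p \<bullet> Bnd 0 \<^bold>\<and>
      Cn (AllC T) \<bullet> Abs T (p \<bullet> Bnd 0 \<^bold>\<longrightarrow> (Bnd 0 \<^bold>=\<^bsub>T\<^esub> Bnd 1)))"
    using assms(3,4) by (simp add: forces_conj forces_all' forces_imp has_type_iff_infer)
  then have "\<Gamma> \<tturnstile> Cn (ExC T) \<bullet> Abs T (p \<bullet> Bnd 0 \<^bold>\<and>
      Cn (AllC T) \<bullet> Abs T (p \<bullet> Bnd 0 \<^bold>\<longrightarrow> (Bnd 0 \<^bold>=\<^bsub>T\<^esub> Bnd 1)))"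
    by (subst forces_ex)
      (auto intro!: covI exI[of _ t] assms(2) elim: forces_mono simp: has_type_iff_infer simp del: opn.simps)
  then show ?thesis
    by (simp add: ex_unique_def lam_def forces_beta has_type_iff_infer)
qed

lemma wt_is_cut: "wt is_cut (PowT RatT \<^bold>\<Rightarrow> PowT RatT \<^bold>\<Rightarrow> Omega)"
  by (simp add: is_cut_def type_simps)

lemma wt_is_classical_cut: "wt is_classical_cut (PowT RatT \<^bold>\<Rightarrow> PowT RatT \<^bold>\<Rightarrow> Omega)"
  by (simp add: is_classical_cut_def Pow_notnot_def type_simps)

lemma wt_ex_unique: "wt (ex_unique T) (PowT (PowT T))"
  by (simp add: ex_unique_def type_simps)

lemma cls_closed:
  "cls k x S is_cut = is_cut" "cls k x S is_classical_cut = is_classical_cut"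
  "cls k x S Reals_cl = Reals_cl" "cls k x S (ex_unique T) = ex_unique T"
  "cls k x S Reals_d = Reals_d" "cls k x S Located_cl = Located_cl"
  by (simp_all add: is_cut_def is_classical_cut_def Reals_cl_def Pow_notnot_def ex_unique_def
      Reals_d_def Located_cl_def two_pow_neg_def lam_def)

lemmas closed_simps = cls_closed wtD[OF wt_is_cut] wtD[OF wt_is_classical_cut]
  wtD[OF wt_ex_unique] wtD[OF wt_Reals_cl] wtD[OF wt_Reals_d] wtD[OF wt_Located_cl]

lemma wt_lower_upper: "wt c CutT \<Longrightarrow> wt (lower c) (PowT RatT)" "wt c CutT \<Longrightarrow> wt (upper c) (PowT RatT)"
  by (simp_all add: has_type_iff_infer)

lemma forces_Reals_d:
  assumes "wt c CutT"
  shows "(\<Gamma> \<tturnstile> Reals_d \<bullet> c) \<longleftrightarrow> rounded less_at \<Gamma> (lower c) \<and> rounded greater_at \<Gamma> (upper c) \<and>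
    disjoint_at \<Gamma> (lower c) (upper c) \<and> located_at \<Gamma> (lower c) (upper c)"
proof -
  have "(\<Gamma> \<tturnstile> Reals_d \<bullet> c) \<longleftrightarrow> (\<Gamma> \<tturnstile> is_cut \<bullet> lower c \<bullet> upper c)"
    using assms unfolding Reals_d_def by (simp add: lam_def forces_beta has_type_iff_infer closed_simps)
  then show ?thesis
    using assms by (simp add: forces_is_cut wt_lower_upper)
qed

lemma forces_Located_cl:
  assumes "wt c CutT"
  shows "(\<Gamma> \<tturnstile> Located_cl \<bullet> c) \<longleftrightarrow>
    stably_rounded less_at \<Gamma> (lower c) \<and> stably_rounded greater_at \<Gamma> (upper c) \<and>
    disjoint_at \<Gamma> (lower c) (upper c) \<and> stably_located_at \<Gamma> (lower c) (upper c) \<and>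
    eps_located_at \<Gamma> (lower c) (upper c)"
proof -
  note [simp] = wtD[OF assms]
  have mem: "(\<Delta> \<tturnstile> lower c \<bullet> (rep_rq x \<^bold>- two_pow_neg \<bullet> k)) \<longleftrightarrow> mem \<Delta> (lower c) (x - pow_rq k)"
    "(\<Delta> \<tturnstile> upper c \<bullet> (rep_rq x \<^bold>+ two_pow_neg \<bullet> k)) \<longleftrightarrow> mem \<Delta> (upper c) (x + pow_rq k)"
    if "infer [] k = Some NatT" for \<Delta> x k
    using that
      forces_mem_abs_rq[OF wt_lower_upper(1)[OF assms], of "rep_rq x \<^bold>- two_pow_neg \<bullet> k" \<Delta>]
      forces_mem_abs_rq[OF wt_lower_upper(2)[OF assms], of "rep_rq x \<^bold>+ two_pow_neg \<bullet> k" \<Delta>]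
    by (simp_all add: abs_rq_simps pow_rq_def has_type_iff_infer)
  have "(\<Gamma> \<tturnstile> Located_cl \<bullet> c) \<longleftrightarrow>
      (\<Gamma> \<tturnstile> is_classical_cut \<bullet> lower c \<bullet> upper c) \<and> eps_located_at \<Gamma> (lower c) (upper c)"
    unfolding Located_cl_def eps_located_at_def wt_iff
    by (simp add: lam_def forces_beta forces_conj forces_all' forces_ex_rat has_type_iff_infer
        closed_simps mem)
      (simp add: Reals_cl_def lam_def forces_beta has_type_iff_infer closed_simps)
  then show ?thesis
    using assms by (simp add: forces_is_classical_cut wt_lower_upper)
qed

text \<open>Explicit terms are asked for in place of covers, because comprehension will provide
  them. Uniqueness must hold in extensions, being an implication in the object logic.\<close>

lemma isomorphicI:
  assumes wt: "wt A (PowT S)" "wt B (PowT T)" "wt F (PowT (S \<^bold>\<times> T))"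
    and sub: "\<And>x y \<Delta>. \<Gamma> \<le> \<Delta> \<Longrightarrow> wt x S \<Longrightarrow> wt y T \<Longrightarrow> \<Delta> \<tturnstile> F \<bullet> pair S T x y \<Longrightarrow>
      (\<Delta> \<tturnstile> A \<bullet> x) \<and> (\<Delta> \<tturnstile> B \<bullet> y)"
    and right: "\<And>x \<Delta>. \<Gamma> \<le> \<Delta> \<Longrightarrow> wt x S \<Longrightarrow> \<Delta> \<tturnstile> A \<bullet> x \<Longrightarrow> \<exists>y. wt y T \<and> (\<Delta> \<tturnstile> F \<bullet> pair S T x y) \<and>
      (\<forall>\<Delta>'\<ge>\<Delta>. \<forall>y'. wt y' T \<longrightarrow> (\<Delta>' \<tturnstile> F \<bullet> pair S T x y') \<longrightarrow> (\<Delta>' \<tturnstile> y' \<^bold>=\<^bsub>T\<^esub> y))"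
    and left: "\<And>y \<Delta>. \<Gamma> \<le> \<Delta> \<Longrightarrow> wt y T \<Longrightarrow> \<Delta> \<tturnstile> B \<bullet> y \<Longrightarrow> \<exists>x. wt x S \<and> (\<Delta> \<tturnstile> F \<bullet> pair S T x y) \<and>
      (\<forall>\<Delta>'\<ge>\<Delta>. \<forall>x'. wt x' S \<longrightarrow> (\<Delta>' \<tturnstile> F \<bullet> pair S T x' y) \<longrightarrow> (\<Delta>' \<tturnstile> x' \<^bold>=\<^bsub>S\<^esub> x))"
  shows "\<Gamma> \<tturnstile> isomorphic S T \<bullet> A \<bullet> B"
proof -
  note [simp] = wtD[OF wt(1)] wtD[OF wt(2)] wtD[OF wt(3)] closed_simps
  have ex1: "\<Delta> \<tturnstile> ex_unique T \<bullet> Abs T (F \<bullet> pair S T x (Bnd 0))"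
    if x: "\<Gamma> \<le> \<Delta>" "wt x S" "\<Delta> \<tturnstile> A \<bullet> x" for x \<Delta>
  proof -
    note [simp] = wtD[OF x(2)]
    obtain y where "wt y T" "\<Delta> \<tturnstile> F \<bullet> pair S T x y"
      "\<forall>\<Delta>'\<ge>\<Delta>. \<forall>y'. wt y' T \<longrightarrow> (\<Delta>' \<tturnstile> F \<bullet> pair S T x y') \<longrightarrow> (\<Delta>' \<tturnstile> y' \<^bold>=\<^bsub>T\<^esub> y)"
      using right[OF x] by blast
    then show ?thesis
      by (intro forces_ex1I[where t = y]) (simp_all add: forces_beta has_type_iff_infer)
  qed
  have ex1': "\<Delta> \<tturnstile> ex_unique S \<bullet> Abs S (F \<bullet> pair S T (Bnd 0) y)"
    if y: "\<Gamma> \<le> \<Delta>" "wt y T" "\<Delta> \<tturnstile> B \<bullet> y" for y \<Delta>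
  proof -
    note [simp] = wtD[OF y(2)]
    obtain x where "wt x S" "\<Delta> \<tturnstile> F \<bullet> pair S T x y"
      "\<forall>\<Delta>'\<ge>\<Delta>. \<forall>x'. wt x' S \<longrightarrow> (\<Delta>' \<tturnstile> F \<bullet> pair S T x' y) \<longrightarrow> (\<Delta>' \<tturnstile> x' \<^bold>=\<^bsub>S\<^esub> x)"
      using left[OF y] by blast
    then show ?thesis
      by (intro forces_ex1I[where t = x]) (simp_all add: forces_beta has_type_iff_infer)
  qed
  define b where "b = (Cn (AllC S) \<bullet> Abs S (Cn (AllC T) \<bullet> Abs T (Bnd 2 \<bullet> pair S T (Bnd 1) (Bnd 0)
        \<^bold>\<longrightarrow> (A \<bullet> Bnd 1 \<^bold>\<and> B \<bullet> Bnd 0)))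
      \<^bold>\<and> Cn (AllC S) \<bullet> Abs S (A \<bullet> Bnd 0 \<^bold>\<longrightarrow>
        ex_unique T \<bullet> Abs T (Bnd 2 \<bullet> pair S T (Bnd 1) (Bnd 0)))
      \<^bold>\<and> Cn (AllC T) \<bullet> Abs T (B \<bullet> Bnd 0 \<^bold>\<longrightarrow>
        ex_unique S \<bullet> Abs S (Bnd 2 \<bullet> pair S T (Bnd 0) (Bnd 1))))"
  have "\<Gamma> \<tturnstile> opn 0 F b"
    unfolding b_def using sub ex1 ex1' unfolding wt_iff
    by (simp add: forces_conj forces_all' forces_imp has_type_iff_infer numeral_2_eq_2)
  then have "\<Gamma> \<tturnstile> Cn (ExC (PowT (S \<^bold>\<times> T))) \<bullet> Abs (PowT (S \<^bold>\<times> T)) b"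
    by (subst forces_ex)
      (auto intro!: covI exI[of _ F] wt(3) elim: forces_mono simp: b_def has_type_iff_infer
        numeral_2_eq_2 simp del: opn.simps)
  \<comment> \<open>Below the binders of \<open>F\<close>, \<open>x\<close> and \<open>y\<close>,
    the indices 4 and 3 denote \<open>A\<close> and \<open>B\<close>; applying the two abstractions
    turns the matrix into \<open>b\<close>.\<close>
  moreover have "isomorphic S T = Abs (PowT S) (Abs (PowT T) (Cn (ExC (PowT (S \<^bold>\<times> T))) \<bullet> Abs (PowT (S \<^bold>\<times> T))
      (Cn (AllC S) \<bullet> Abs S (Cn (AllC T) \<bullet> Abs T (Bnd 2 \<bullet> pair S T (Bnd 1) (Bnd 0)
        \<^bold>\<longrightarrow> (Bnd 4 \<bullet> Bnd 1 \<^bold>\<and> Bnd 3 \<bullet> Bnd 0)))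
      \<^bold>\<and> Cn (AllC S) \<bullet> Abs S (Bnd 3 \<bullet> Bnd 0 \<^bold>\<longrightarrow>
        ex_unique T \<bullet> Abs T (Bnd 2 \<bullet> pair S T (Bnd 1) (Bnd 0)))
      \<^bold>\<and> Cn (AllC T) \<bullet> Abs T (Bnd 2 \<bullet> Bnd 0 \<^bold>\<longrightarrow>
        ex_unique S \<bullet> Abs S (Bnd 2 \<bullet> pair S T (Bnd 0) (Bnd 1))))))"
    by (simp add: isomorphic_def lam_def eval_nat_numeral)
  ultimately show ?thesis
    by (simp add: forces_beta2 has_type_iff_infer b_def eval_nat_numeral)
qed

lemma forces_lower_upper_pair:
  assumes "wt A (PowT RatT)" "wt B (PowT RatT)"
  shows "mem \<Gamma> (lower (pair (PowT RatT) (PowT RatT) A B)) x \<longleftrightarrow> mem \<Gamma> A x"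
    and "mem \<Gamma> (upper (pair (PowT RatT) (PowT RatT) A B)) x \<longleftrightarrow> mem \<Gamma> B x"
  by (rule forces_eq_iff,
      rule forces_cong[OF forces_fst_snd(1)[OF assms] forces_eq_refl[OF wt_rep_rq]]
        forces_cong[OF forces_fst_snd(2)[OF assms] forces_eq_refl[OF wt_rep_rq]])+

lemma forces_set_eq_ratI:
  assumes wt: "wt A (PowT RatT)" "wt B (PowT RatT)"
    and iff: "\<And>x \<Delta>. \<Gamma> \<le> \<Delta> \<Longrightarrow> mem \<Delta> A x \<longleftrightarrow> mem \<Delta> B x"
  shows "\<Gamma> \<tturnstile> A \<^bold>=\<^bsub>PowT RatT\<^esub> B"
  by (rule forces_set_eqI[OF wt]) (simp add: forces_mem_abs_rq[OF wt(1)] forces_mem_abs_rq[OF wt(2)] iff)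

section \<open>The graph of the double complement map\<close>

definition notnot_rel :: trm
  where "notnot_rel = \<^bold>\<lambda> ''A'' (PowT RatT) (\<lambda>A. \<^bold>\<lambda> ''B'' (PowT RatT) (\<lambda>B.
    \<^bold>\<forall> ''x'' RatT (\<lambda>x. (x \<^bold>\<in> B) \<^bold>\<longleftrightarrow> \<^bold>\<not> \<^bold>\<not> (x \<^bold>\<in> A))))"

lemma wt_notnot_rel: "wt notnot_rel (PowT RatT \<^bold>\<Rightarrow> PowT RatT \<^bold>\<Rightarrow> Omega)"
  by (simp add: notnot_rel_def type_simps)

lemma forces_notnot_rel:
  assumes "wt A (PowT RatT)" "wt B (PowT RatT)"
  shows "(\<Gamma> \<tturnstile> notnot_rel \<bullet> A \<bullet> B) \<longleftrightarrow> notnot_at \<Gamma> A B"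
proof -
  note [simp] = wtD[OF assms(1)] wtD[OF assms(2)]
  have "(\<Gamma> \<tturnstile> notnot_rel \<bullet> A \<bullet> B) \<longleftrightarrow>
    (\<forall>x. (\<forall>\<Delta>\<ge>\<Gamma>. mem \<Delta> B x \<longrightarrow> not_at \<Delta> (\<lambda>\<Delta>. not_at \<Delta> (\<lambda>\<Delta>. mem \<Delta> A x))) \<and>
      (\<forall>\<Delta>\<ge>\<Gamma>. not_at \<Delta> (\<lambda>\<Delta>. not_at \<Delta> (\<lambda>\<Delta>. mem \<Delta> A x)) \<longrightarrow> mem \<Delta> B x))"
    unfolding notnot_rel_def not_at_def
    by (simp add: forces_beta2 forces_conj forces_imp forces_all_rat lam_def has_type_iff_infer)
  then show ?thesis
    unfolding notnot_at_def by blast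
qed

text \<open>Both memberships are built in, since a functional relation has to be contained in the
  product of the two sets.\<close>

definition cut_rel :: trm
  where "cut_rel = \<^bold>\<lambda> ''p'' (CutT \<^bold>\<times> CutT) (\<lambda>p.
    (Cn (FstC CutT CutT) \<bullet> p \<^bold>\<in> Reals_d) \<^bold>\<and> (Cn (SndC CutT CutT) \<bullet> p \<^bold>\<in> Located_cl) \<^bold>\<and>
    notnot_rel \<bullet> lower (Cn (FstC CutT CutT) \<bullet> p) \<bullet> lower (Cn (SndC CutT CutT) \<bullet> p) \<^bold>\<and>
    notnot_rel \<bullet> upper (Cn (FstC CutT CutT) \<bullet> p) \<bullet> upper (Cn (SndC CutT CutT) \<bullet> p))"

lemma cls_notnot_rel: "cls k x T notnot_rel = notnot_rel"
  by (simp add: notnot_rel_def lam_def)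

lemmas cut_rel_simps = lam_def has_type_iff_infer closed_simps cls_notnot_rel wtD[OF wt_notnot_rel]

lemma wt_cut_rel: "wt cut_rel (PowT (CutT \<^bold>\<times> CutT))"
  by (simp add: cut_rel_def cut_rel_simps)

lemma forces_cut_rel:
  assumes wt: "wt c CutT" "wt d CutT"
  shows "(\<Gamma> \<tturnstile> cut_rel \<bullet> pair CutT CutT c d) \<longleftrightarrow>
    (\<Gamma> \<tturnstile> Reals_d \<bullet> c) \<and> (\<Gamma> \<tturnstile> Located_cl \<bullet> d) \<and>
    notnot_at \<Gamma> (lower c) (lower d) \<and> notnot_at \<Gamma> (upper c) (upper d)"
proof -
  let ?p = "pair CutT CutT c d"
  let ?c = "Cn (FstC CutT CutT) \<bullet> ?p" and ?d = "Cn (SndC CutT CutT) \<bullet> ?p"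
  note [simp] = wtD[OF wt(1)] wtD[OF wt(2)]
  note eq = forces_fst_snd[OF wt, of \<Gamma>]
  have fst_eq: "\<Gamma> \<tturnstile> f \<bullet> ?c \<^bold>=\<^bsub>T\<^esub> f \<bullet> c" and snd_eq: "\<Gamma> \<tturnstile> f \<bullet> ?d \<^bold>=\<^bsub>T\<^esub> f \<bullet> d"
    if "wt f (CutT \<^bold>\<Rightarrow> T)" for f T
    using eq that by (blast intro: forces_app_cong)+
  have wt_proj: "wt (Cn (FstC (PowT RatT) (PowT RatT))) (CutT \<^bold>\<Rightarrow> PowT RatT)"
    "wt (Cn (SndC (PowT RatT) (PowT RatT))) (CutT \<^bold>\<Rightarrow> PowT RatT)"
    by (simp_all add: has_type_iff_infer)
  have rel: "(\<Gamma> \<tturnstile> notnot_rel \<bullet> (f \<bullet> ?c) \<bullet> (f \<bullet> ?d)) \<longleftrightarrow> notnot_at \<Gamma> (f \<bullet> c) (f \<bullet> d)"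
    if f: "wt f (CutT \<^bold>\<Rightarrow> PowT RatT)" for f
  proof -
    have "(\<Gamma> \<tturnstile> notnot_rel \<bullet> (f \<bullet> ?c) \<bullet> (f \<bullet> ?d)) \<longleftrightarrow> (\<Gamma> \<tturnstile> notnot_rel \<bullet> (f \<bullet> c) \<bullet> (f \<bullet> d))"
      by (rule forces_eq_iff, rule forces_cong[OF forces_app_cong[OF fst_eq[OF f] wt_notnot_rel] snd_eq[OF f]])
    also have "\<dots> \<longleftrightarrow> notnot_at \<Gamma> (f \<bullet> c) (f \<bullet> d)"
      using f wt by (intro forces_notnot_rel) (blast intro: ty_App)+
    finally show ?thesis .
  qed
  have "(\<Gamma> \<tturnstile> cut_rel \<bullet> ?p) \<longleftrightarrow> (\<Gamma> \<tturnstile> Reals_d \<bullet> ?c) \<and> (\<Gamma> \<tturnstile> Located_cl \<bullet> ?d) \<and>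
      (\<Gamma> \<tturnstile> notnot_rel \<bullet> lower ?c \<bullet> lower ?d) \<and> (\<Gamma> \<tturnstile> notnot_rel \<bullet> upper ?c \<bullet> upper ?d)"
    unfolding cut_rel_def by (simp add: forces_beta forces_conj cut_rel_simps)
  also have "\<dots> \<longleftrightarrow> (\<Gamma> \<tturnstile> Reals_d \<bullet> c) \<and> (\<Gamma> \<tturnstile> Located_cl \<bullet> d) \<and>
      notnot_at \<Gamma> (lower c) (lower d) \<and> notnot_at \<Gamma> (upper c) (upper d)"
    using forces_eq_iff[OF fst_eq[OF wt_Reals_d]] forces_eq_iff[OF snd_eq[OF wt_Located_cl]]
      rel[OF wt_proj(1)] rel[OF wt_proj(2)] by simp
  finally show ?thesis .
qed

lemma ex_notnot_set:
  assumes "wt A (PowT RatT)"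
  shows "\<exists>B. wt B (PowT RatT) \<and> (\<forall>\<Gamma>. notnot_at \<Gamma> A B)"
proof (intro exI conjI allI)
  note [simp] = wtD[OF assms]
  let ?B = "Abs RatT (\<^bold>\<not> \<^bold>\<not> (A \<bullet> Bnd 0))"
  show "wt ?B (PowT RatT)"
    by (simp add: has_type_iff_infer)
  show "notnot_at \<Gamma> A ?B" for \<Gamma>
    unfolding notnot_at_def not_at_def by (simp add: forces_beta forces_imp has_type_iff_infer)
qed

text \<open>Comprehension is abstraction. As \<open>R\<close> is a relation of the ambient logic and
  not a term, each orientation gets its own abstraction.\<close>

lemma ex_interior_set:
  assumes A: "wt A (PowT RatT)" and R: "orientation R"
  shows "\<exists>B. wt B (PowT RatT) \<and> (\<forall>\<Gamma>. interior_at R \<Gamma> B A)"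
proof -
  note [simp] = wtD[OF A]
  let ?B = "\<lambda>b. Abs RatT (Cn (ExC RatT) \<bullet> Abs RatT (b \<^bold>\<and> A \<bullet> Bnd 0))"
  have "wt (?B (Bnd 1 \<^bold>< Bnd 0)) (PowT RatT)" "wt (?B (Bnd 0 \<^bold>< Bnd 1)) (PowT RatT)"
    by (simp_all add: has_type_iff_infer)
  moreover have "interior_at less_at \<Gamma> (?B (Bnd 1 \<^bold>< Bnd 0)) A"
    "interior_at greater_at \<Gamma> (?B (Bnd 0 \<^bold>< Bnd 1)) A" for \<Gamma>
    unfolding interior_at_def greater_at_def
    by (simp_all add: forces_beta forces_conj forces_ex_rat forces_less has_type_iff_infer)
  ultimately show ?thesis
    using orientation.R[OF R] by metis
qed

text \<open>Projections of a pair are only provably equal to its components. They agree on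
  membership in every context, and nothing else matters here.\<close>

lemma notnot_at_cong_right:
  "(\<And>\<Delta> x. mem \<Delta> B x \<longleftrightarrow> mem \<Delta> B' x) \<Longrightarrow> notnot_at \<Gamma> A B \<longleftrightarrow> notnot_at \<Gamma> A B'"
  by (simp add: notnot_at_def)

lemma interior_at_cong_left:
  "(\<And>\<Delta> x. mem \<Delta> A x \<longleftrightarrow> mem \<Delta> A' x) \<Longrightarrow> interior_at R \<Gamma> A B \<longleftrightarrow> interior_at R \<Gamma> A' B"
  by (simp add: interior_at_def)

text \<open>An interval that locates the cut also locates its double complement, because the latter
  contains the former.\<close>

lemma cut_notnot_cut:
  assumes c: "wt c CutT" "\<Gamma> \<tturnstile> Reals_d \<bullet> c" and d: "wt d CutT"
    and nn: "notnot_at \<Gamma> (lower c) (lower d)" "notnot_at \<Gamma> (upper c) (upper d)"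
  shows "\<Gamma> \<tturnstile> Located_cl \<bullet> d"
proof -
  note cut = c(2)[unfolded forces_Reals_d[OF c(1)]]
  have "eps_located_at \<Gamma> (lower c) (upper c)"
    using cut by (intro eps_located wt_lower_upper c) (auto simp: rounded_def)
  then have "eps_located_at \<Gamma> (lower d) (upper d)"
    unfolding eps_located_at_def
    by (blast intro: cov_weaken notnot_atI[OF nn(1)] notnot_atI[OF nn(2)])
  with cut show ?thesis
    unfolding forces_Located_cl[OF d]
    using nn lower.rounded_notnot upper.rounded_notnot disjoint_notnot stably_located_notnot
    by blast
qed

lemma classical_cut_interior_cut:
  assumes d: "wt d CutT" "\<Gamma> \<tturnstile> Located_cl \<bullet> d" and c: "wt c CutT"
    and int: "interior_at less_at \<Gamma> (lower c) (lower d)" "interior_at greater_at \<Gamma> (upper c) (upper d)"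
  shows "\<Gamma> \<tturnstile> Reals_d \<bullet> c"
proof -
  note cut = d(2)[unfolded forces_Located_cl[OF d(1)]]
  \<comment> \<open>A classical cut has inhabitants only up to double negation; the location
    condition at \<open>k = 0\<close> yields actual ones.\<close>
  have "cov \<Gamma> (\<lambda>\<Delta>. \<exists>x. mem \<Delta> (lower d) (x - pow_rq (Cn ZeroC)) \<and> mem \<Delta> (upper d) (x + pow_rq (Cn ZeroC)))"
    using cut unfolding eps_located_at_def by (simp add: has_type_iff_infer)
  then have "cov \<Gamma> (\<lambda>\<Delta>. \<exists>x. mem \<Delta> (lower d) x)" "cov \<Gamma> (\<lambda>\<Delta>. \<exists>x. mem \<Delta> (upper d) x)"
    by (blast intro: cov_weaken)+
  with cut int show ?thesis
    unfolding forces_Reals_d[OF c]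
    using lower.interior_rounded upper.interior_rounded disjoint_interior located_interior
    by blast
qed

lemma cut_rel_right_unique:
  assumes wt: "wt c CutT" "wt d CutT" "wt d' CutT"
    and rel: "\<Gamma> \<tturnstile> cut_rel \<bullet> pair CutT CutT c d" "\<Gamma> \<tturnstile> cut_rel \<bullet> pair CutT CutT c d'"
  shows "\<Gamma> \<tturnstile> d' \<^bold>=\<^bsub>CutT\<^esub> d"
  using rel wt by (intro forces_pair_eqI forces_set_eq_ratI wt_lower_upper)
    (simp_all add: forces_cut_rel notnot_at_def)

text \<open>Both cuts have the interiors of the sides of \<open>d\<close> as their sides, by
  \<open>cut_interior\<close>, and pairs with equal projections are equal.\<close>

lemma cut_rel_left_unique:
  assumes wt: "wt c CutT" "wt c' CutT" "wt d CutT"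
    and rel: "\<Gamma> \<tturnstile> cut_rel \<bullet> pair CutT CutT c d" "\<Gamma> \<tturnstile> cut_rel \<bullet> pair CutT CutT c' d"
  shows "\<Gamma> \<tturnstile> c' \<^bold>=\<^bsub>CutT\<^esub> c"
proof -
  have "interior_at less_at \<Gamma> (lower b) (lower d) \<and> interior_at greater_at \<Gamma> (upper b) (upper d)"
    if "wt b CutT" "\<Gamma> \<tturnstile> cut_rel \<bullet> pair CutT CutT b d" for b
    using that(2) unfolding forces_cut_rel[OF that(1) wt(3)] forces_Reals_d[OF that(1)]
    by (blast intro: cut_interior[OF wt_lower_upper[OF that(1)]])
  from this[OF wt(1) rel(1)] this[OF wt(2) rel(2)] show ?thesis
    using wt by (intro forces_pair_eqI forces_set_eq_ratI wt_lower_upper)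
      (simp_all add: interior_at_def)
qed

lemma cut_rel_total:
  assumes c: "wt c CutT" "\<Gamma> \<tturnstile> Reals_d \<bullet> c"
  shows "\<exists>d. wt d CutT \<and> (\<Gamma> \<tturnstile> cut_rel \<bullet> pair CutT CutT c d)"
proof -
  obtain A B where wt: "wt A (PowT RatT)" "wt B (PowT RatT)"
    and nn: "\<And>\<Gamma>. notnot_at \<Gamma> (lower c) A" "\<And>\<Gamma>. notnot_at \<Gamma> (upper c) B"
    using ex_notnot_set wt_lower_upper[OF c(1)] by meson
  let ?d = "pair (PowT RatT) (PowT RatT) A B"
  have d: "wt ?d CutT"
    using wt by (simp add: has_type_iff_infer)
  have "notnot_at \<Gamma> (lower c) (lower ?d)" "notnot_at \<Gamma> (upper c) (upper ?d)"
    using nn notnot_at_cong_right[OF forces_lower_upper_pair(1)[OF wt]]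
      notnot_at_cong_right[OF forces_lower_upper_pair(2)[OF wt]] by blast+
  then have "\<Gamma> \<tturnstile> cut_rel \<bullet> pair CutT CutT c ?d"
    using forces_cut_rel[OF c(1) d] c cut_notnot_cut[OF c d] by blast
  with d show ?thesis
    by blast
qed

text \<open>The preimage consists of the interiors of both sides; \<open>interior_notnot\<close>
  shows that its double complement is \<open>d\<close> again.\<close>

lemma cut_rel_surj:
  assumes d: "wt d CutT" "\<Gamma> \<tturnstile> Located_cl \<bullet> d"
  shows "\<exists>c. wt c CutT \<and> (\<Gamma> \<tturnstile> cut_rel \<bullet> pair CutT CutT c d)"
proof -
  obtain A B where wt: "wt A (PowT RatT)" "wt B (PowT RatT)"
    and int: "\<And>\<Gamma>. interior_at less_at \<Gamma> A (lower d)" "\<And>\<Gamma>. interior_at greater_at \<Gamma> B (upper d)"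
    using ex_interior_set lower.orientation_axioms upper.orientation_axioms wt_lower_upper[OF d(1)]
    by meson
  let ?c = "pair (PowT RatT) (PowT RatT) A B"
  have c: "wt ?c CutT"
    using wt by (simp add: has_type_iff_infer)
  have int': "interior_at less_at \<Gamma> (lower ?c) (lower d)" "interior_at greater_at \<Gamma> (upper ?c) (upper d)"
    using int interior_at_cong_left[OF forces_lower_upper_pair(1)[OF wt]]
      interior_at_cong_left[OF forces_lower_upper_pair(2)[OF wt]] by blast+
  have "notnot_at \<Gamma> (lower ?c) (lower d)" "notnot_at \<Gamma> (upper ?c) (upper d)"
    using d int' lower.interior_notnot upper.interior_notnot forces_Located_cl by blast+
  then have "\<Gamma> \<tturnstile> cut_rel \<bullet> pair CutT CutT ?c d"
    using forces_cut_rel[OF c d(1)] d classical_cut_interior_cut[OF d c int'] by blast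
  with c show ?thesis
    by blast
qed

theorem theorem5p5:
  shows "{} \<^bold>\<turnstile> isomorphic CutT CutT \<bullet> Reals_d \<bullet> Located_cl"
proof -
  have "{||} \<tturnstile> isomorphic CutT CutT \<bullet> Reals_d \<bullet> Located_cl"
  proof (rule isomorphicI[OF wt_Reals_d wt_Located_cl wt_cut_rel])
    fix c d \<Delta>
    assume "wt c CutT" "wt d CutT" "\<Delta> \<tturnstile> cut_rel \<bullet> pair CutT CutT c d"
    then show "(\<Delta> \<tturnstile> Reals_d \<bullet> c) \<and> (\<Delta> \<tturnstile> Located_cl \<bullet> d)"
      by (simp add: forces_cut_rel)
  next
    fix c \<Delta>
    assume c: "wt c CutT" "\<Delta> \<tturnstile> Reals_d \<bullet> c"
    then show "\<exists>d. wt d CutT \<and> (\<Delta> \<tturnstile> cut_rel \<bullet> pair CutT CutT c d) \<and> (\<forall>\<Delta>'\<ge>\<Delta>. \<forall>d'. wt d' CutT \<longrightarrow>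
        (\<Delta>' \<tturnstile> cut_rel \<bullet> pair CutT CutT c d') \<longrightarrow> (\<Delta>' \<tturnstile> d' \<^bold>=\<^bsub>CutT\<^esub> d))"
      using cut_rel_total cut_rel_right_unique forces_mono by meson
  next
    fix d \<Delta>
    assume d: "wt d CutT" "\<Delta> \<tturnstile> Located_cl \<bullet> d"
    then show "\<exists>c. wt c CutT \<and> (\<Delta> \<tturnstile> cut_rel \<bullet> pair CutT CutT c d) \<and> (\<forall>\<Delta>'\<ge>\<Delta>. \<forall>c'. wt c' CutT \<longrightarrow>
        (\<Delta>' \<tturnstile> cut_rel \<bullet> pair CutT CutT c' d) \<longrightarrow> (\<Delta>' \<tturnstile> c' \<^bold>=\<^bsub>CutT\<^esub> c))"
      using cut_rel_surj cut_rel_left_unique forces_mono by meson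
  qed
  then show ?thesis
    by (simp add: forces_def)
qed

end
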